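(* Let $n\ge 1$. (i) If $T$ is a subgroup of $\mathrm{Homeo}(\mathcal{L}^n)$ in which every element is of finite order, then $T$ is isomorphic to a subgroup of $G_n=(\mathbb{Z}/2\mathbb{Z})^n\ltimes S_n$. (ii) If $T$ is a subgroup of $\mathrm{Homeo}(\mathcal{L}_+^n)$ in which every element is of finite order, then $T$ is isomorphic to a subgroup of $S_n$.
   Context: Let $\Omega$ be the smallest uncountable ordinal and $S_\Omega$ the set of all ordinals less than $\Omega$. The semi-closed half-long line $\mathcal{L}_+$ is the set $S_\Omega\times[0,1)$ with the lexicographic order (the ordinal being the leading coordinate) and the order topology; its smallest element is denoted $0$. Let $\mathcal{L}_-$ be $\mathcal{L}_+$ with its order reversed. The long line $\mathcal{L}$ is the linearly ordered space $\mathcal{L}_-\cup\mathcal{L}_+$, with the two copies of $0$ identified ($\mathcal{L}_-$ lying below $\mathcal{L}_+$), with the order topology. Powers $X^n$ carry the product topology. $\mathrm{Homeo}(X)$ is the group of all homeomorphisms of $X$ onto itself. $S_n$ is the symmetric group on $n$ letters, and $G_n=(\mathbb{Z}/2\mathbb{Z})^n\ltimes S_n$ is the semidirect product in which $S_n$ acts on the normal subgroup $(\mathbb{Z}/2\mathbb{Z})^n$ by permuting the factors. *)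

theory Defs
  imports
    "HOL-Analysis.Analysis"
    "HOL-Algebra.Sym_Groups"
    "HOL-Algebra.Product_Groups"
    "HOL-Algebra.Elementary_Groups"
    "HOL-Algebra.Bij"
begin

section \<open>The set of countable ordinals\<close>

text \<open>
  \<open>cardSuc natLeq\<close> is a well-order of order type the least uncountable ordinal, so its field is
  order isomorphic to the set of all countable ordinals; the lemmas \<open>uncountable_omega1\<close>,
  \<open>countable_omega1_below\<close> and \<open>omega1_least\<close> below confirm this.
\<close>

typedef omega1 = "Field (cardSuc natLeq)"
proof -
  have "Field (cardSuc natLeq) \<noteq> {}"
    using cardSuc_finite[OF natLeq_Card_order] Field_natLeq by (metis infinite_UNIV_nat finite.emptyI)
  then show ?thesis by auto
qed

lemma well_order_cardSuc_natLeq: "Well_order (cardSuc natLeq)"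
  using cardSuc_Card_order[OF natLeq_Card_order] card_order_on_well_order_on by blast

instantiation omega1 :: wellorder
begin

definition less_eq_omega1 :: "omega1 \<Rightarrow> omega1 \<Rightarrow> bool"
  where "x \<le> y \<longleftrightarrow> (Rep_omega1 x, Rep_omega1 y) \<in> cardSuc natLeq"

definition less_omega1 :: "omega1 \<Rightarrow> omega1 \<Rightarrow> bool"
  where "x < y \<longleftrightarrow> x \<le> y \<and> x \<noteq> (y :: omega1)"

instance
proof
  have wo: "Well_order (cardSuc natLeq)" by (rule well_order_cardSuc_natLeq)
  then have refl: "Refl (cardSuc natLeq)" and tr: "trans (cardSuc natLeq)"
    and anti: "antisym (cardSuc natLeq)" and tot: "Total (cardSuc natLeq)"
    and wf: "wf (cardSuc natLeq - Id)"
    unfolding well_order_on_def linear_order_on_def partial_order_on_def preorder_on_def by auto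
  have le_antisym: "x = y" if "x \<le> y" "y \<le> x" for x y :: omega1
    using that anti unfolding less_eq_omega1_def antisym_def by (metis Rep_omega1_inject)
  fix x y z :: omega1
  show "(x < y) = (x \<le> y \<and> \<not> y \<le> x)"
    unfolding less_omega1_def
    using le_antisym refl Rep_omega1 unfolding less_eq_omega1_def refl_on_def by metis
  show "x \<le> x" using refl Rep_omega1[of x] unfolding less_eq_omega1_def refl_on_def by auto
  show "x \<le> z" if "x \<le> y" "y \<le> z"
    using that tr unfolding less_eq_omega1_def trans_def by blast
  show "x = y" if "x \<le> y" "y \<le> x" using le_antisym that .
  show "x \<le> y \<or> y \<le> x"
    using tot refl Rep_omega1[of x] Rep_omega1[of y]
    unfolding less_eq_omega1_def total_on_def refl_on_def by metis
next
  fix P :: "omega1 \<Rightarrow> bool" and a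
  assume step: "\<And>x. (\<And>y. y < x \<Longrightarrow> P y) \<Longrightarrow> P x"
  have "wf (cardSuc natLeq - Id)"
    using well_order_cardSuc_natLeq unfolding well_order_on_def by auto
  then have "wf (inv_image (cardSuc natLeq - Id) Rep_omega1)" by (rule wf_inv_image)
  then show "P a"
    by (induction a rule: wf_induct_rule)
      (rule step, auto simp: less_omega1_def less_eq_omega1_def Rep_omega1_inject)
qed

end

context includes cardinal_syntax
begin

lemma countable_iff_ordLeq_natLeq: "countable A \<longleftrightarrow> |A| \<le>o natLeq"
  unfolding countable_def card_of_ordLeq[of _ "UNIV :: nat set", simplified]
  using card_of_nat ordLeq_ordIso_trans ordIso_symmetric card_of_ordLeq[of A "UNIV :: nat set"]
  by blast

lemma uncountable_omega1: "uncountable (UNIV :: omega1 set)"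
proof
  assume "countable (UNIV :: omega1 set)"
  then have "countable (Rep_omega1 ` UNIV)" by (rule countable_image)
  then have "countable (Field (cardSuc natLeq))"
    using type_definition.Rep_range[OF type_definition_omega1] by simp
  then have "|Field (cardSuc natLeq)| \<le>o natLeq"
    by (simp add: countable_iff_ordLeq_natLeq)
  moreover have "|Field (cardSuc natLeq)| =o cardSuc natLeq"
    by (rule card_of_Field_ordIso[OF cardSuc_Card_order[OF natLeq_Card_order]])
  ultimately have "cardSuc natLeq \<le>o natLeq"
    by (meson ordIso_symmetric ordIso_ordLeq_trans)
  then show False
    using cardSuc_greater[OF natLeq_Card_order] not_ordLess_ordLeq by blast
qed

lemma countable_omega1_below: "countable {y. y < (x :: omega1)}"
proof -
  let ?r = "cardSuc natLeq"
  have "|underS ?r (Rep_omega1 x)| <o ?r"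
    by (rule card_of_underS[OF cardSuc_Card_order[OF natLeq_Card_order] Rep_omega1])
  then have "|underS ?r (Rep_omega1 x)| \<le>o natLeq"
    using cardSuc_ordLeq_ordLess[OF natLeq_Card_order card_of_Card_order] by blast
  then have "countable (underS ?r (Rep_omega1 x))"
    by (simp add: countable_iff_ordLeq_natLeq)
  moreover have "Rep_omega1 ` {y. y < x} \<subseteq> underS ?r (Rep_omega1 x)"
    by (auto simp: underS_def less_omega1_def less_eq_omega1_def Rep_omega1_inject)
  ultimately have "countable (Rep_omega1 ` {y. y < x})" using countable_subset by blast
  then show ?thesis
    using countable_image_inj_on by (metis Rep_omega1_inject inj_onI)
qed

lemma omega1_least:
  assumes "Well_order r" "uncountable (Field r)"
  shows "cardSuc natLeq \<le>o r"
proof -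
  have "\<not> |Field r| \<le>o natLeq"
    using assms(2) by (simp add: countable_iff_ordLeq_natLeq)
  then have "natLeq <o |Field r|"
    using not_ordLeq_iff_ordLess[OF natLeq_Well_order card_of_Well_order[of "Field r"]]
      ordLess_or_ordLeq[OF natLeq_Well_order card_of_Well_order[of "Field r"]] by blast
  then have "cardSuc natLeq \<le>o |Field r|"
    using cardSuc_ordLess_ordLeq[OF natLeq_Card_order card_of_Card_order] by blast
  moreover have "|Field r| \<le>o r" by (rule card_of_least) (use assms(1) in auto)
  ultimately show ?thesis using ordLeq_transitive by blast
qed

end


section \<open>The semi-closed half-long line and the long line\<close>

typedef half_long_line = "(UNIV :: omega1 set) \<times> {0..<1 :: real}"
  by auto

setup_lifting type_definition_half_long_line

instantiation half_long_line :: linorder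
begin

lift_definition less_eq_half_long_line :: "half_long_line \<Rightarrow> half_long_line \<Rightarrow> bool"
  is "\<lambda>(a, s) (b, t). a < b \<or> a = b \<and> s \<le> t" .

lift_definition less_half_long_line :: "half_long_line \<Rightarrow> half_long_line \<Rightarrow> bool"
  is "\<lambda>(a, s) (b, t). a < b \<or> a = b \<and> s < t" .

instance
proof
  fix x y z :: half_long_line
  show "(x < y) = (x \<le> y \<and> \<not> y \<le> x)" by transfer auto
  show "x \<le> x" by transfer auto
  show "x \<le> y \<Longrightarrow> y \<le> z \<Longrightarrow> x \<le> z" by transfer auto
  show "x \<le> y \<Longrightarrow> y \<le> x \<Longrightarrow> x = y" by transfer auto
  show "x \<le> y \<or> y \<le> x" by transfer auto
qed

end

instantiation half_long_line :: linorder_topology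
begin

definition open_half_long_line :: "half_long_line set \<Rightarrow> bool"
  where "open_half_long_line = generate_topology (range (\<lambda>a. {..<a}) \<union> range (\<lambda>a. {a<..}))"

instance
  by standard (rule open_half_long_line_def)

end

instantiation half_long_line :: zero
begin

lift_definition zero_half_long_line :: half_long_line is "(LEAST a. True, 0)" by auto

instance ..

end

lemma zero_half_long_line_le: "0 \<le> (x :: half_long_line)"
proof transfer
  fix x :: "omega1 \<times> real"
  assume "x \<in> UNIV \<times> {0..<1}"
  moreover have "(LEAST a :: omega1. True) \<le> fst x" by (rule Least_le) simp
  ultimately show
    "(case (LEAST a. True, 0) of (a, s) \<Rightarrow> \<lambda>(b, t). a < b \<or> a = b \<and> s \<le> t) x"
    by (auto simp: order_le_less)
qed

text \<open>
  In the disjoint sum the summand \<open>Inl\<close> carries the reversed half-long line and \<open>Inr\<close> the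
  half-long line; the preorder \<open>long_sum_le\<close> puts the former below the latter, up to
  equivalence of the two origins.
\<close>

definition long_glue :: "half_long_line + half_long_line \<Rightarrow> half_long_line + half_long_line \<Rightarrow> bool"
  where "long_glue u v \<longleftrightarrow> u = v \<or> (u \<in> {Inl 0, Inr 0} \<and> v \<in> {Inl 0, Inr 0})"

fun long_sum_le :: "half_long_line + half_long_line \<Rightarrow> half_long_line + half_long_line \<Rightarrow> bool"
  where
    "long_sum_le (Inl x) (Inl y) \<longleftrightarrow> y \<le> x"
  | "long_sum_le (Inr x) (Inr y) \<longleftrightarrow> x \<le> y"
  | "long_sum_le (Inl x) (Inr y) \<longleftrightarrow> True"
  | "long_sum_le (Inr x) (Inl y) \<longleftrightarrow> x = 0 \<and> y = 0"

quotient_type long_line = "half_long_line + half_long_line" / long_glue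
  by (rule equivpI) (auto simp: reflp_def symp_def transp_def long_glue_def)

lemma half_long_line_le_zero: "x \<le> 0 \<longleftrightarrow> x = (0 :: half_long_line)"
  using zero_half_long_line_le by (auto intro: antisym)

lemma long_glue_iff: "long_glue u v \<longleftrightarrow> long_sum_le u v \<and> long_sum_le v u"
  by (cases u; cases v) (auto simp: long_glue_def half_long_line_le_zero)

lemma long_sum_le_trans: "long_sum_le u v \<Longrightarrow> long_sum_le v w \<Longrightarrow> long_sum_le u w"
  by (cases u; cases v; cases w) (auto simp: half_long_line_le_zero zero_half_long_line_le)

instantiation long_line :: linorder
begin

lift_definition less_eq_long_line :: "long_line \<Rightarrow> long_line \<Rightarrow> bool" is long_sum_le
  by (meson long_glue_iff long_sum_le_trans)

definition less_long_line :: "long_line \<Rightarrow> long_line \<Rightarrow> bool"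
  where "x < y \<longleftrightarrow> x \<le> y \<and> \<not> y \<le> (x :: long_line)"

instance
proof
  fix x y z :: long_line
  show "(x < y) = (x \<le> y \<and> \<not> y \<le> x)" by (rule less_long_line_def)
  show "x \<le> x"
  proof transfer
    show "long_sum_le u u" for u by (cases u) auto
  qed
  show "x \<le> y \<Longrightarrow> y \<le> z \<Longrightarrow> x \<le> z" by transfer (rule long_sum_le_trans)
  show "x \<le> y \<Longrightarrow> y \<le> x \<Longrightarrow> x = y" by transfer (simp add: long_glue_iff)
  show "x \<le> y \<or> y \<le> x"
  proof transfer
    show "long_sum_le u v \<or> long_sum_le v u" for u v by (cases u; cases v) auto
  qed
qed

end

instantiation long_line :: linorder_topology
begin

definition open_long_line :: "long_line set \<Rightarrow> bool"
  where "open_long_line = generate_topology (range (\<lambda>a. {..<a}) \<union> range (\<lambda>a. {a<..}))"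

instance
  by standard (rule open_long_line_def)

end

text \<open>Points of a power are the functions on \<open>{1..n}\<close> extended by \<^const>\<open>undefined\<close>.\<close>

definition power_topology :: "'a topology \<Rightarrow> nat \<Rightarrow> (nat \<Rightarrow> 'a) topology"
  where "power_topology X n = product_topology (\<lambda>_. X) {1..n}"


section \<open>Groups\<close>

text \<open>
  Restricting to extensional maps makes a homeomorphism determined by its values on the space,
  so that the group has no spurious copies of elements.
\<close>

definition homeo_group :: "'a topology \<Rightarrow> ('a \<Rightarrow> 'a) monoid"
  where "homeo_group X =
    BijGroup (topspace X)\<lparr>carrier := {f \<in> extensional (topspace X). homeomorphic_map X X f}\<rparr>"

lemma group_homeo_group: "group (homeo_group X)"
proof -
  let ?S = "topspace X"
  let ?H = "{f \<in> extensional ?S. homeomorphic_map X X f}"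
  have HB: "f \<in> Bij ?S" if "f \<in> ?H" for f
    using that by (auto simp: Bij_def bij_betw_def homeomorphic_imp_injective_map
        homeomorphic_imp_surjective_map)
  have "subgroup ?H (BijGroup ?S)"
  proof (rule subgroup.intro)
    show "?H \<subseteq> carrier (BijGroup ?S)" using HB by (auto simp: BijGroup_def)
  next
    fix f g assume fg: "f \<in> ?H" "g \<in> ?H"
    then have "homeomorphic_map X X (f \<circ> g)" by (auto intro: homeomorphic_map_compose)
    then have "homeomorphic_map X X (compose ?S f g)"
      by (rule homeomorphic_map_eq) (simp add: compose_def)
    then show "f \<otimes>\<^bsub>BijGroup ?S\<^esub> g \<in> ?H"
      using HB fg by (simp add: BijGroup_def)
  next
    have "homeomorphic_map X X (\<lambda>x\<in>?S. x)"
      by (rule homeomorphic_map_eq[of X X id]) auto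
    then show "\<one>\<^bsub>BijGroup ?S\<^esub> \<in> ?H" by (simp add: BijGroup_def)
  next
    fix f assume f: "f \<in> ?H"
    then obtain g where g: "homeomorphic_maps X X f g"
      by (auto simp: homeomorphic_map_maps)
    then have "homeomorphic_map X X g"
      using homeomorphic_map_maps homeomorphic_maps_sym by blast
    moreover have "g x = restrict (inv_into ?S f) ?S x" if "x \<in> ?S" for x
    proof -
      have "g x \<in> ?S" "f (g x) = x"
        using g that by (auto simp: homeomorphic_maps_def continuous_map_def)
      moreover have "inj_on f ?S" using f homeomorphic_imp_injective_map by blast
      ultimately show ?thesis using that by (metis inv_into_f_f restrict_apply')
    qed
    ultimately have "homeomorphic_map X X (restrict (inv_into ?S f) ?S)"
      by (rule homeomorphic_map_eq)
    then show "inv\<^bsub>BijGroup ?S\<^esub> f \<in> ?H"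
      by (simp add: inv_BijGroup[OF HB[OF f]])
  qed
  then show ?thesis
    unfolding homeo_group_def by (rule group.subgroup_imp_group[OF group_BijGroup])
qed

definition semidirect_product ::
    "('a, 'c) monoid_scheme \<Rightarrow> ('b, 'd) monoid_scheme \<Rightarrow> ('b \<Rightarrow> 'a \<Rightarrow> 'a) \<Rightarrow> ('a \<times> 'b) monoid"
  where "semidirect_product N K act =
    \<lparr>carrier = carrier N \<times> carrier K,
     monoid.mult = (\<lambda>(a, h) (b, k). (a \<otimes>\<^bsub>N\<^esub> act h b, h \<otimes>\<^bsub>K\<^esub> k)),
     one = (\<one>\<^bsub>N\<^esub>, \<one>\<^bsub>K\<^esub>)\<rparr>"

text \<open>The inverse makes this a left action: the \<open>i\<close>-th entry is moved to position \<open>p i\<close>.\<close>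

definition permute_factors :: "nat \<Rightarrow> (nat \<Rightarrow> nat) \<Rightarrow> (nat \<Rightarrow> 'a) \<Rightarrow> (nat \<Rightarrow> 'a)"
  where "permute_factors n p a = (\<lambda>i\<in>{1..n}. a (inv_into UNIV p i))"

definition G_group :: "nat \<Rightarrow> ((nat \<Rightarrow> int) \<times> (nat \<Rightarrow> nat)) monoid"
  where "G_group n =
    semidirect_product (product_group {1..n} (\<lambda>_. integer_mod_group 2)) (sym_group n)
      (permute_factors n)"

lemma group_G_group: "group (G_group n)"
proof (rule groupI)
  let ?I = "{1..n}"
  have carr: "carrier (G_group n) = (\<Pi>\<^sub>E i\<in>?I. {0..<2}) \<times> {p. p permutes ?I}"
    by (simp add: G_group_def semidirect_product_def sym_group_def carrier_integer_mod_group)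
  have mult: "(a, p) \<otimes>\<^bsub>G_group n\<^esub> (b, q) = ((\<lambda>i\<in>?I. (a i + permute_factors n p b i) mod 2), p \<circ> q)"
    for a b p q
    by (simp add: G_group_def semidirect_product_def sym_group_def product_group_def)
  have one: "\<one>\<^bsub>G_group n\<^esub> = ((\<lambda>i\<in>?I. 0), id)"
    by (simp add: G_group_def semidirect_product_def sym_group_def product_group_def)
  have inI: "inv_into UNIV p i \<in> ?I" if "p permutes ?I" "i \<in> ?I" for p i
    using permutes_in_image[OF permutes_inv[OF that(1)]] that(2) by simp
  fix x y z
  assume x: "x \<in> carrier (G_group n)"
  obtain a p where xe: "x = (a, p)" by (cases x)
  have a: "a \<in> (\<Pi>\<^sub>E i\<in>?I. {0..<2})" and p: "p permutes ?I" using x xe carr by auto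
  show "\<one>\<^bsub>G_group n\<^esub> \<otimes>\<^bsub>G_group n\<^esub> x = x"
  proof -
    have "(\<lambda>i\<in>?I. ((\<lambda>i\<in>?I. 0) i + permute_factors n id a i) mod 2) = a"
    proof
      fix i
      show "(\<lambda>i\<in>?I. ((\<lambda>i\<in>?I. 0) i + permute_factors n id a i) mod 2) i = a i"
      proof (cases "i \<in> ?I")
        case True
        then have "a i \<in> {0..<2}" using a by blast
        then show ?thesis using True by (simp add: permute_factors_def)
      next
        case False
        then show ?thesis using a by (auto simp: PiE_def extensional_def)
      qed
    qed
    then show ?thesis unfolding xe one mult by simp
  qed
  show "\<exists>y\<in>carrier (G_group n). y \<otimes>\<^bsub>G_group n\<^esub> x = \<one>\<^bsub>G_group n\<^esub>"
  proof (rule bexI)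
    let ?b = "\<lambda>i\<in>?I. (- a (p i)) mod 2"
    have "(\<lambda>i\<in>?I. (?b i + permute_factors n (inv_into UNIV p) a i) mod 2) = (\<lambda>i\<in>?I. 0)"
      by (rule restrict_ext)
        (simp add: permute_factors_def permutes_inv_inv[OF p] mod_add_left_eq)
    then show "(?b, inv_into UNIV p) \<otimes>\<^bsub>G_group n\<^esub> x = \<one>\<^bsub>G_group n\<^esub>"
      unfolding xe one mult using permutes_inv_o(2)[OF p] by simp
    show "(?b, inv_into UNIV p) \<in> carrier (G_group n)"
      unfolding carr using permutes_inv[OF p] by auto
  qed
  assume y: "y \<in> carrier (G_group n)"
  obtain b q where ye: "y = (b, q)" by (cases y)
  have b: "b \<in> (\<Pi>\<^sub>E i\<in>?I. {0..<2})" and q: "q permutes ?I" using y ye carr by auto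
  show "x \<otimes>\<^bsub>G_group n\<^esub> y \<in> carrier (G_group n)"
    unfolding xe ye mult carr using permutes_compose[OF q p] by auto
  assume z: "z \<in> carrier (G_group n)"
  obtain c r where ze: "z = (c, r)" by (cases z)
  have "(\<lambda>i\<in>?I. ((\<lambda>i\<in>?I. (a i + permute_factors n p b i) mod 2) i
            + permute_factors n (p \<circ> q) c i) mod 2)
      = (\<lambda>i\<in>?I. (a i + permute_factors n p (\<lambda>i\<in>?I. (b i + permute_factors n q c i) mod 2) i) mod 2)"
  proof (rule restrict_ext)
    fix i assume i: "i \<in> ?I"
    have "inv_into UNIV (p \<circ> q) i = inv_into UNIV q (inv_into UNIV p i)"
      using o_inv_distrib[OF permutes_bij[OF p] permutes_bij[OF q]] by simp
    then show "((\<lambda>i\<in>?I. (a i + permute_factors n p b i) mod 2) i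
            + permute_factors n (p \<circ> q) c i) mod 2
      = (a i + permute_factors n p (\<lambda>i\<in>?I. (b i + permute_factors n q c i) mod 2) i) mod 2"
      using i inI[OF p i] inI[OF q inI[OF p i]]
      by (simp add: permute_factors_def mod_add_left_eq mod_add_right_eq add.assoc del: atLeastAtMost_iff)
  qed
  then show "x \<otimes>\<^bsub>G_group n\<^esub> y \<otimes>\<^bsub>G_group n\<^esub> z = x \<otimes>\<^bsub>G_group n\<^esub> (y \<otimes>\<^bsub>G_group n\<^esub> z)"
    unfolding xe ye ze mult by (simp only: o_assoc)
next
  show "\<one>\<^bsub>G_group n\<^esub> \<in> carrier (G_group n)"
    by (simp add: G_group_def semidirect_product_def sym_group_def carrier_integer_mod_group
        product_group_def permutes_id)
qed

end

theory Submission
  imports Defs "HOL-Homology.Homology" "HOL-Number_Theory.Cong"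
begin

text \<open>
  A continuous real function on the half-long line is eventually constant. Hence for club many
  countable ordinals \<open>r\<close> a homeomorphism \<open>f\<close> of the power maps every open face of the cube of
  size \<open>r\<close> into an open face, and which face goes where does not depend on \<open>r\<close>. The induced map of
  faces preserves incidence, so it is determined by a permutation of the ends of the coordinate axes
  that maps opposite ends to opposite ends, which is an element of \<open>G_n\<close> (of \<open>S_n\<close> if every axis
  has a single end).

  If \<open>f\<close> has prime order and fixes all faces, it is the identity: by induction on the dimension it is
  the identity on the boundary of a face, and a map of prime period on a ball that is the identity on
  the boundary sphere is trivial (a theorem of Newman). For the latter, if \<open>y\<close> is not fixed, the
  average of \<open>f^i x - y\<close> over the period, supplemented by powers of the Fourier coefficients of the
  sequence \<open>f^i x\<close>, gives an equivariant map from the ball to a sphere with a linear rotation, which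
  on the boundary sphere is homotopic to the inclusion of the fixed sphere. Chains in the ball that
  bound the boundary sphere successively under the operators \<open>1 - f\<close> and \<open>1 + f + ... + f^(p-1)\<close> are
  mapped to chains that can be compared with an explicit resolution by iterated double suspension,
  whose final class is not divisible by \<open>p\<close>.
\<close>


section \<open>Maps of prime period on a ball\<close>

text \<open>A map of finite order need not look linear near a fixed point, so no local argument
  excludes that it is the identity on a large set only; hence the homological detour. Chains are
  integral, and not being divisible by p plays the role of being nonzero mod p. The contradiction is
  one of length. In the contractible ball the alternating fillings go on forever. In the sphere of
  dimension d + 2q they can be compared with the explicit ones up to the top degree, where the
  filling from the ball has a successor and the explicit one leaves an indivisible class. There the
  comparison leaves only an error (1 + g + ... + g^(p-1)) e with a top cycle e, and this is p e up
  to a boundary because a rotation is homotopic to the identity; so the explicit class would be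
  divisible. Primality enters twice: some power of a nontrivial element of finite order has prime
  order, and frequencies can be inverted modulo a prime, so that all Fourier coefficients can be
  made to turn at the same speed. On the half-long line the walls where a coordinate is 0 are not
  among the faces that the induction fixes; the cube is therefore doubled across them.\<close>

definition red_cycle :: "nat \<Rightarrow> 'a topology \<Rightarrow> 'a chain \<Rightarrow> bool" where
  "red_cycle k X c \<longleftrightarrow> singular_relcycle k X {} c \<and>
     homologous_rel_set k X {} c \<in> carrier (reduced_homology_group (int k) X)"

lemma red_cycle_singular: "red_cycle k X c \<Longrightarrow> singular_chain k X c"
  by (simp add: red_cycle_def singular_cycle)

text \<open>Reduced and ordinary homology differ only in degree 0. Carrying the reduced condition
  along lets a fixed sphere of dimension 0, two points, be treated like the others.\<close>

lemma red_cycle_pos: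
  assumes "0 < k" "singular_chain k X c" "chain_boundary k c = 0"
  shows "red_cycle k X c"
  using assms by (auto simp: red_cycle_def un_reduced_homology_group singular_cycle
      carrier_relative_homology_group)

lemma red_cycle_chain_map:
  assumes "red_cycle k X c" "continuous_map X Y f"
  shows "red_cycle k Y (chain_map k f c)"
proof -
  have c: "singular_relcycle k X {} c" using assms by (simp add: red_cycle_def)
  have "hom_induced (int k) X {} Y {} f (homologous_rel_set k X {} c) = homologous_rel_set k Y {} (chain_map k f c)"
    using hom_induced_chain_map[OF assms(2) _ c] by simp
  then show ?thesis
    using assms hom_induced_reduced[of "homologous_rel_set k X {} c" "int k" X Y f]
    by (auto simp: red_cycle_def intro: singular_relcycle_chain_map)
qed

lemma red_cycle_bounds:
  assumes "red_cycle k X c" "trivial_group (reduced_homology_group (int k) X)"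
  obtains b where "singular_chain (Suc k) X b" "chain_boundary (Suc k) b = c"
proof -
  have "homologous_rel_set k X {} c = singular_relboundary_set k X {}"
    using assms by (auto simp: red_cycle_def trivial_group_def one_reduced_homology_group)
  then have "singular_relboundary k X {} c" by (simp add: homologous_rel_set_eq_relboundary)
  then show thesis using that singular_boundary by blast
qed

text \<open>Divisibility is asked in reduced homology, which for a sphere is the group of integers
  in the top degree, degree 0 included.\<close>

definition divisible_class :: "nat \<Rightarrow> nat \<Rightarrow> 'a topology \<Rightarrow> 'a chain \<Rightarrow> bool" where
  "divisible_class p k X c \<longleftrightarrow> (\<exists>e\<in>carrier (reduced_homology_group (int k) X).
     homologous_rel_set k X {} c = e [^]\<^bsub>reduced_homology_group (int k) X\<^esub> p)"

lemma divisible_class_hom: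
  assumes "divisible_class p k X c" "singular_relcycle k X {} c" "continuous_map X Y f"
  shows "divisible_class p k Y (chain_map k f c)"
proof -
  let ?G = "reduced_homology_group (int k) X" and ?H = "reduced_homology_group (int k) Y"
  let ?h = "hom_induced (int k) X {} Y {} f"
  interpret group_hom ?G ?H ?h
    by (simp add: group_hom_def group_hom_axioms_def hom_induced_reduced_hom)
  obtain e where e: "e \<in> carrier ?G" "homologous_rel_set k X {} c = e [^]\<^bsub>?G\<^esub> p"
    using assms by (auto simp: divisible_class_def)
  have "homologous_rel_set k Y {} (chain_map k f c) = ?h (homologous_rel_set k X {} c)"
    using hom_induced_chain_map[OF assms(3) _ assms(2)] by simp
  also have "\<dots> = ?h e [^]\<^bsub>?H\<^esub> p" using e hom_nat_pow by simp
  finally show ?thesis using e by (auto simp: divisible_class_def)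
qed

text \<open>Homology classes are sets of homologous chains and multiply as sumsets, so a multiple of
  a cycle becomes a group power by induction.\<close>

lemma homologous_rel_set_sum_pow:
  assumes "singular_relcycle k X {} e"
  shows "homologous_rel_set k X {} (frag_cmul (int p) e)
    = homologous_rel_set k X {} e [^]\<^bsub>homology_group (int k) X\<^esub> p"
proof (induction p)
  case 0
  have "singular_relboundary k X {} 0" by simp
  then show ?case by (simp add: homologous_rel_set_eq_relboundary)
next
  case (Suc p)
  have c: "singular_relcycle k X {} (frag_cmul (int p) e)" using assms by (simp add: singular_relcycle_cmul)
  have "homologous_rel_set k X {} (a + b) = (\<Union>r\<in>homologous_rel_set k X {} a. \<Union>s\<in>homologous_rel_set k X {} b. {r + s})" for a b
  proof
    show "homologous_rel_set k X {} (a + b) \<subseteq> (\<Union>r\<in>homologous_rel_set k X {} a. \<Union>s\<in>homologous_rel_set k X {} b. {r + s})"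
    proof
      fix x assume x: "x \<in> homologous_rel_set k X {} (a + b)"
      then have "homologous_rel k X {} a (x - b)"
        by (simp add: homologous_rel_def algebra_simps)
      then show "x \<in> (\<Union>r\<in>homologous_rel_set k X {} a. \<Union>s\<in>homologous_rel_set k X {} b. {r + s})"
        by (metis (no_types, lifting) UN_I diff_add_cancel homologous_rel_refl mem_Collect_eq singletonI)
    qed
  qed (auto simp: homologous_rel_add)
  moreover have "frag_cmul (int (Suc p)) e = frag_cmul (int p) e + e"
    by (metis add.commute frag_cmul_distrib frag_cmul_one of_nat_Suc)
  ultimately show ?case
    by (simp add: Suc[symmetric] mult_relative_homology_group)
qed

lemma divisible_classI:
  assumes "0 < k" "singular_relcycle k X {} e" "singular_chain (Suc k) X b"
    "c = frag_cmul (int p) e + chain_boundary (Suc k) b"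
  shows "divisible_class p k X c"
proof -
  have "homologous_rel k X {} c (frag_cmul (int p) e)"
    unfolding homologous_rel_def using assms singular_boundary by auto
  then have "homologous_rel_set k X {} c = homologous_rel_set k X {} (frag_cmul (int p) e)"
    by (metis homologous_rel_eq)
  then show ?thesis
    using assms by (auto simp: divisible_class_def un_reduced_homology_group homologous_rel_set_sum_pow
      carrier_relative_homology_group)
qed

lemma sphere_generator:
  assumes "1 < p"
  obtains z where "red_cycle k (nsphere k) z" "\<not> divisible_class p k (nsphere k) z"
proof -
  let ?G = "reduced_homology_group (int k) (nsphere k)"
  obtain \<phi> where \<phi>: "\<phi> \<in> iso integer_group ?G"
    using group.iso_sym[OF group_reduced_homology_group reduced_homology_group_nsphere(1)]
    unfolding is_iso_def by blast
  interpret group_hom integer_group ?G \<phi>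
    using \<phi> by (simp add: group_hom_def group_hom_axioms_def iso_def)
  have bij: "bij_betw \<phi> UNIV (carrier ?G)" using \<phi> by (simp add: iso_def)
  have "\<phi> 1 \<in> carrier ?G" using bij by (auto simp: bij_betw_def)
  then have "\<phi> 1 \<in> carrier (homology_group (int k) (nsphere k))"
    using carrier_reduced_homology_group_subset by blast
  then obtain z where z: "singular_relcycle k (nsphere k) {} z" "\<phi> 1 = homologous_rel_set k (nsphere k) {} z"
    by (auto simp: carrier_relative_homology_group)
  show thesis
  proof
    show "red_cycle k (nsphere k) z" using z \<open>\<phi> 1 \<in> carrier ?G\<close> by (simp add: red_cycle_def)
    show "\<not> divisible_class p k (nsphere k) z"
    proof
      assume "divisible_class p k (nsphere k) z"
      then obtain e where e: "e \<in> carrier ?G" "\<phi> 1 = e [^]\<^bsub>?G\<^esub> p"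
        using z by (auto simp: divisible_class_def)
      then obtain a where a: "e = \<phi> a" using bij unfolding bij_betw_def by (metis imageE)
      have "\<phi> 1 = \<phi> (a [^]\<^bsub>integer_group\<^esub> p)" using e a hom_nat_pow[of a p] by simp
      then have "1 = a [^]\<^bsub>integer_group\<^esub> p" using bij by (auto simp: bij_betw_def inj_on_def)
      moreover have "a [^]\<^bsub>integer_group\<^esub> m = int m * a" for m :: nat
        by (induction m) (auto simp: algebra_simps)
      ultimately have "1 = int p * a" by simp
      then show False using assms by (metis dvdI nat_dvd_1_iff_1 int_dvd_int_iff of_nat_1 less_irrefl)
    qed
  qed
qed

text \<open>The suspension isomorphism between the top reduced groups of the two spheres passes
  through the pair (sphere, lower hemisphere) and, by excision, (upper hemisphere, equator). It
  takes the class of \<open>a1 + a2\<close> to that of the boundary of \<open>a1\<close>, since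
  \<open>a2\<close> vanishes relative to the lower hemisphere. Isomorphisms transport
  divisibility.\<close>

lemma suspension_not_divisible:
  assumes A1: "singular_chain (Suc k) (subtopology (nsphere (Suc k)) {x. x (Suc k) \<ge> 0}) a1"
    and A2: "singular_chain (Suc k) (subtopology (nsphere (Suc k)) {x. x (Suc k) \<le> 0}) a2"
    and bd: "singular_chain k (nsphere k) (chain_boundary (Suc k) a1)"
    and cyc: "chain_boundary (Suc k) (a1 + a2) = 0"
    and dv: "divisible_class p (Suc k) (nsphere (Suc k)) (a1 + a2)"
  shows "divisible_class p k (nsphere k) (chain_boundary (Suc k) a1)"
proof -
  let ?S = "nsphere (Suc k)"
  let ?U = "subtopology (nsphere (Suc k)) {x. x (Suc k) \<ge> 0}" and ?eq = "{x. x (Suc k) = (0::real)}"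
  let ?L = "{x. x (Suc k) \<le> (0::real)}"
  let ?G = "reduced_homology_group (int (Suc k)) ?S"
  let ?R = "relative_homology_group (int (Suc k)) ?S ?L"
  let ?Q = "relative_homology_group (int (Suc k)) ?U ?eq"
  let ?K = "reduced_homology_group (int k) (nsphere k)"
  let ?\<alpha> = "hom_induced (int (Suc k)) ?S {} ?S ?L id"
  let ?\<beta> = "hom_induced (int (Suc k)) ?U ?eq ?S ?L id"
  let ?\<gamma> = "hom_boundary (int (Suc k)) ?U ?eq"
  have \<alpha>: "?\<alpha> \<in> iso ?G ?R" by (rule iso_reduced_homology_group_lower_hemisphere) simp
  have \<beta>: "?\<beta> \<in> iso ?Q ?R" by (rule iso_relative_homology_group_upper_hemisphere)
  have \<gamma>: "?\<gamma> \<in> iso ?Q ?K" using iso_upper_hemisphere_reduced_homology_group[of "int k" k] by (simp add: add.commute)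
  interpret \<alpha>: group_hom ?G ?R ?\<alpha> using \<alpha> by (simp add: group_hom_def group_hom_axioms_def iso_def)
  interpret \<beta>: group_hom ?Q ?R ?\<beta> using \<beta> by (simp add: group_hom_def group_hom_axioms_def iso_def)
  interpret \<gamma>: group_hom ?Q ?K ?\<gamma> using \<gamma> by (simp add: group_hom_def group_hom_axioms_def iso_def)
  have equator: "subtopology ?U ?eq = nsphere k"
  proof -
    have "{x. 0 \<le> x (Suc k)} \<inter> {x. x (Suc k) = 0} = {x. x (Suc k) = (0::real)}" by auto
    then show ?thesis by (simp add: subtopology_nsphere_equator subtopology_subtopology)
  qed
  have c1: "singular_relcycle (Suc k) ?U ?eq a1"
    using A1 bd by (simp add: singular_relcycle equator)
  have S1: "singular_chain (Suc k) ?S a1" and S2: "singular_chain (Suc k) ?S a2"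
    using A1 A2 by (auto simp: singular_chain_subtopology)
  have c12: "singular_relcycle (Suc k) ?S {} (a1 + a2)"
    using S1 S2 cyc by (simp add: singular_cycle singular_chain_add)
  obtain e where e: "e \<in> carrier ?G" "homologous_rel_set (Suc k) ?S {} (a1 + a2) = e [^]\<^bsub>?G\<^esub> p"
    using dv by (auto simp: divisible_class_def)
  have "?\<alpha> (homologous_rel_set (Suc k) ?S {} (a1 + a2)) = homologous_rel_set (Suc k) ?S ?L (chain_map (Suc k) id (a1 + a2))"
    by (rule hom_induced_chain_map) (use c12 in auto)
  also have "chain_map (Suc k) id (a1 + a2) = a1 + a2"
    using c12 chain_map_ident singular_cycle by blast
  also have "homologous_rel_set (Suc k) ?S ?L (a1 + a2) = homologous_rel_set (Suc k) ?S ?L a1"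
  proof -
    have "homologous_rel (Suc k) ?S ?L (a1 + a2) a1"
      unfolding homologous_rel_def using A2 by (simp add: singular_chain_imp_relboundary)
    then show ?thesis by (metis homologous_rel_eq)
  qed
  also have "\<dots> = homologous_rel_set (Suc k) ?S ?L (chain_map (Suc k) id a1)"
    using S1 chain_map_ident by metis
  also have "\<dots> = ?\<beta> (homologous_rel_set (Suc k) ?U ?eq a1)"
    by (rule hom_induced_chain_map[symmetric]) (use c1 in \<open>auto simp: continuous_map_from_subtopology\<close>)
  finally have 1: "?\<alpha> e [^]\<^bsub>?R\<^esub> p = ?\<beta> (homologous_rel_set (Suc k) ?U ?eq a1)"
    unfolding e(2) \<alpha>.hom_nat_pow[OF e(1)] .
  \<comment> \<open>The p-th root \<open>e\<close> is carried back along excision; injectivity then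
    identifies the p-th power of \<open>w\<close> with the class of \<open>a1\<close>.\<close>
  have "?\<alpha> e \<in> carrier ?R" using \<alpha>.hom_closed[OF e(1)] .
  then have "?\<alpha> e \<in> ?\<beta> ` carrier ?Q"
    using \<beta> unfolding iso_def bij_betw_def by blast
  then obtain w where w: "w \<in> carrier ?Q" "?\<alpha> e = ?\<beta> w" by (rule imageE)
  have a1c: "homologous_rel_set (Suc k) ?U ?eq a1 \<in> carrier ?Q"
    using c1 carrier_relative_homology_group by blast
  have eqw: "?\<beta> (w [^]\<^bsub>?Q\<^esub> p) = ?\<beta> (homologous_rel_set (Suc k) ?U ?eq a1)"
    unfolding \<beta>.hom_nat_pow[OF w(1)] 1[symmetric] w(2) ..
  then have wp: "w [^]\<^bsub>?Q\<^esub> p = homologous_rel_set (Suc k) ?U ?eq a1"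
  proof -
    have inj: "inj_on ?\<beta> (carrier ?Q)" using \<beta> unfolding iso_def bij_betw_def by blast
    have wp: "w [^]\<^bsub>?Q\<^esub> p \<in> carrier ?Q" using w(1) by (rule \<beta>.G.nat_pow_closed)
    show ?thesis by (rule inj_onD[OF inj eqw wp a1c])
  qed
  have "?\<gamma> (homologous_rel_set (Suc k) ?U ?eq a1) = homologous_rel_set k (nsphere k) {} (chain_boundary (Suc k) a1)"
  proof -
    have "1 \<le> Suc k" by simp
    from hom_boundary_chain_boundary[OF c1 this] show ?thesis
      unfolding equator diff_Suc_Suc minus_nat.diff_0 .
  qed
  then have "homologous_rel_set k (nsphere k) {} (chain_boundary (Suc k) a1) = ?\<gamma> w [^]\<^bsub>?K\<^esub> p"
    unfolding wp[symmetric] \<gamma>.hom_nat_pow[OF w(1)] by (rule sym)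
  then show ?thesis using \<gamma>.hom_closed[OF w(1)] unfolding divisible_class_def by blast
qed

section \<open>Radial projection, cones and rotations of spheres\<close>

definition nrm :: "nat \<Rightarrow> (nat \<Rightarrow> real) \<Rightarrow> nat \<Rightarrow> real" where
  "nrm m x = (\<lambda>i. x i / sqrt (\<Sum>j\<le>m. (x j)\<^sup>2))"

lemma nrm_nsphere: "x \<in> topspace (nsphere m) \<Longrightarrow> nrm m x = x"
  by (simp add: nrm_def nsphere)

lemma sum_squares_pos: "i \<le> m \<Longrightarrow> (x i :: real) \<noteq> 0 \<Longrightarrow> 0 < (\<Sum>j\<le>m. (x j)\<^sup>2)" for m :: nat
  by (rule sum_pos2[of _ i]) auto

lemma continuous_map_nrm:
  assumes c: "\<And>i. i \<le> m \<Longrightarrow> continuous_map X euclideanreal (\<lambda>x. f x i)"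
    and z: "\<And>x i. x \<in> topspace X \<Longrightarrow> m < i \<Longrightarrow> f x i = 0"
    and nz: "\<And>x. x \<in> topspace X \<Longrightarrow> \<exists>i\<le>m. f x i \<noteq> 0"
  shows "continuous_map X (nsphere m) (\<lambda>x. nrm m (f x))"
proof -
  have pos: "0 < (\<Sum>j\<le>m. (f x j)\<^sup>2)" if "x \<in> topspace X" for x
    using nz[OF that] sum_squares_pos by blast
  have c': "continuous_map X euclideanreal (\<lambda>x. f x i)" for i
  proof (cases "i \<le> m")
    case False
    have "continuous_map X euclideanreal (\<lambda>x. 0)" by simp
    then show ?thesis by (rule continuous_map_eq) (use False z in auto)
  qed (rule c)
  have 1: "continuous_map X (powertop_real UNIV) (\<lambda>x. nrm m (f x))"
    unfolding nrm_def continuous_map_componentwise_UNIV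
    by (intro allI continuous_intros c') (use pos in \<open>auto simp: less_imp_neq[THEN not_sym]\<close>)
  have 2: "(\<Sum>i\<le>m. (nrm m (f x) i)\<^sup>2) = 1" if "x \<in> topspace X" for x
    using pos[OF that] by (simp add: nrm_def power_divide flip: sum_divide_distrib)
  show ?thesis
    unfolding nsphere continuous_map_in_subtopology using 1 2 z by (auto simp: nrm_def)
qed

lemma nrm_scale: "0 < c \<Longrightarrow> nrm m (\<lambda>i. c * x i) = nrm m x"
  by (simp add: nrm_def power_mult_distrib real_sqrt_mult flip: sum_distrib_left)

text \<open>Segments towards \<open>w\<close> stay in the cone and miss the origin, so the
  straight-line homotopy can be projected radially to the sphere; invariance under positive scaling
  keeps the result in \<open>C\<close>.\<close>

lemma contractible_cone_section:
  assumes w: "w \<in> topspace (nsphere m)"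
    and scale: "\<And>x c. x \<in> C \<Longrightarrow> 0 < c \<Longrightarrow> (\<lambda>i. c * x i) \<in> C"
    and seg: "\<And>x t. x \<in> topspace (nsphere m) \<Longrightarrow> x \<in> C \<Longrightarrow> 0 \<le> t \<Longrightarrow> t \<le> 1 \<Longrightarrow>
      (\<lambda>i. (1 - t) * x i + t * w i) \<in> C \<and> (\<exists>i\<le>m. (1 - t) * x i + t * w i \<noteq> 0)"
  shows "contractible_space (subtopology (nsphere m) C)"
proof -
  let ?I = "top_of_set {0..1::real}" and ?X = "subtopology (nsphere m) C"
  let ?h = "\<lambda>(t, x). \<lambda>i. (1 - t) * x i + t * w i"
  have proj: "continuous_map (prod_topology ?I ?X) euclideanreal (\<lambda>z. snd z i)" for i
    using continuous_map_compose[OF continuous_map_snd[of ?I ?X] continuous_map_from_subtopology[OF continuous_map_nsphere_projection[of m i], of C]]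
    by (simp add: o_def)
  have 1: "continuous_map (prod_topology ?I ?X) (nsphere m) (\<lambda>z. nrm m (?h z))"
  proof (rule continuous_map_nrm)
    fix i
    show "continuous_map (prod_topology ?I ?X) euclideanreal (\<lambda>x. ?h x i)"
      unfolding case_prod_unfold
      by (intro continuous_intros proj continuous_map_into_fulltopology[OF continuous_map_fst])
  next
    fix z i assume "z \<in> topspace (prod_topology ?I ?X)" "m < i"
    then show "?h z i = 0" using w by (auto simp: nsphere)
  next
    fix z assume "z \<in> topspace (prod_topology ?I ?X)"
    then show "\<exists>i\<le>m. ?h z i \<noteq> 0" using seg by (auto simp: case_prod_unfold)
  qed
  have "nrm m (?h z) \<in> C" if "z \<in> topspace (prod_topology ?I ?X)" for z
  proof -
    obtain t x where z: "z = (t, x)" by fastforce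
    have *: "?h z \<in> C \<and> (\<exists>i\<le>m. ?h z i \<noteq> 0)" using that seg by (auto simp: z)
    then have "0 < inverse (sqrt (\<Sum>j\<le>m. (?h z j)\<^sup>2))" using sum_squares_pos by fastforce
    then have "(\<lambda>i. inverse (sqrt (\<Sum>j\<le>m. (?h z j)\<^sup>2)) * ?h z i) \<in> C" using scale * by blast
    then show ?thesis by (simp add: nrm_def divide_inverse mult.commute)
  qed
  then have 2: "continuous_map (prod_topology ?I ?X) ?X (\<lambda>z. nrm m (?h z))"
    using 1 by (auto simp: continuous_map_in_subtopology)
  have "homotopic_with (\<lambda>x. True) ?X ?X id (\<lambda>x. w)"
    by (subst homotopic_with, simp, rule exI[of _ "\<lambda>z. nrm m (?h z)"])
      (use 2 w in \<open>auto simp: nrm_nsphere\<close>)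
  then show ?thesis unfolding contractible_space_def by blast
qed

lemma nsphere_subtopology:
  assumes "a \<le> b" shows "nsphere a = subtopology (nsphere b) {x. \<forall>i>a. x i = 0}"
proof -
  have "(\<Sum>i\<le>b. (x i)\<^sup>2) = (\<Sum>i\<le>a. (x i)\<^sup>2)" if "\<forall>i>a. x i = 0" for x :: "nat \<Rightarrow> real"
    by (rule sum.mono_neutral_right) (use assms that in auto)
  then have "{x. (\<Sum>i\<le>a. (x i)\<^sup>2) = 1 \<and> (\<forall>i>a. x i = 0)}
     = {x. (\<Sum>i\<le>b. (x i)\<^sup>2) = 1 \<and> (\<forall>i>b. x i = (0::real))} \<inter> {x. \<forall>i>a. x i = 0}"
    using assms by auto
  then show ?thesis unfolding nsphere subtopology_subtopology by simp
qed

lemma singular_chain_nsphere_mono: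
  "singular_chain m (nsphere a) c \<Longrightarrow> a \<le> b \<Longrightarrow> singular_chain m (nsphere b) c"
  by (metis nsphere_subtopology singular_chain_subtopology)

text \<open>The model action. With angle 2 pi / p it is the join of a fixed sphere of dimension d
  with the free rotation of order p on a sphere of odd dimension.\<close>

definition rot :: "nat \<Rightarrow> real \<Rightarrow> (nat \<Rightarrow> real) \<Rightarrow> nat \<Rightarrow> real" where
  "rot d \<theta> x = (\<lambda>i. if i \<le> d then x i else if odd (i - d) then cos \<theta> * x i - sin \<theta> * x (Suc i)
     else sin \<theta> * x (i - 1) + cos \<theta> * x i)"

lemma rot_rot: "rot d \<theta> (rot d \<phi> x) = rot d (\<theta> + \<phi>) x"
proof
  fix i
  show "rot d \<theta> (rot d \<phi> x) i = rot d (\<theta> + \<phi>) x i"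
  proof -
    consider "i \<le> d" | j where "i = Suc (d + 2 * j)" | j where "i = Suc (Suc (d + 2 * j))"
    proof (cases "i \<le> d")
      case False
      then obtain m where m: "i = Suc (d + m)" using less_imp_Suc_add by fastforce
      show ?thesis
      proof (cases "even m")
        case True
        then show ?thesis using m that(2) by (auto elim!: evenE)
      next
        case False
        then show ?thesis using m that(3) by (auto elim!: oddE)
      qed
    qed
    then show ?thesis
    proof cases
      case 1 then show ?thesis by (simp add: rot_def)
    next
      case 2 then show ?thesis by (simp add: rot_def cos_add sin_add algebra_simps)
    next
      case 3 then show ?thesis by (simp add: rot_def cos_add sin_add algebra_simps)
    qed
  qed
qed

lemma rot_0 [simp]: "rot d 0 x = x"
  by (auto simp: rot_def fun_eq_iff)

lemma rot_2pi [simp]: "rot d (2 * pi) x = x"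
  by (auto simp: rot_def fun_eq_iff)

lemma rot_funpow: "(rot d \<theta> ^^ j) x = rot d (real j * \<theta>) x"
  by (induction j) (auto simp: rot_rot algebra_simps)

lemma sum_squares_rot: "(\<Sum>i\<le>d + 2 * q. (rot d \<theta> x i)\<^sup>2) = (\<Sum>i\<le>d + 2 * q. (x i)\<^sup>2)"
proof (induction q)
  case 0
  show ?case by (simp add: rot_def)
next
  case (Suc q)
  have "(rot d \<theta> x (Suc (d + 2 * q)))\<^sup>2 + (rot d \<theta> x (Suc (Suc (d + 2 * q))))\<^sup>2
     = ((sin \<theta>)\<^sup>2 + (cos \<theta>)\<^sup>2) * ((x (Suc (d + 2 * q)))\<^sup>2 + (x (Suc (Suc (d + 2 * q))))\<^sup>2)"
  proof -
    have "(c * a - s * b)\<^sup>2 + (s * a + c * b)\<^sup>2 = (s\<^sup>2 + c\<^sup>2) * (a\<^sup>2 + b\<^sup>2)" for a b c s :: real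
      by (simp add: power2_eq_square algebra_simps)
    then show ?thesis by (simp add: rot_def del: sin_cos_squared_add sin_cos_squared_add2)
  qed
  then show ?case using Suc by simp
qed

lemma continuous_map_rot_homotopy:
  assumes "continuous_map Z euclideanreal \<theta>" "continuous_map Z (nsphere (d + 2 * q)) x"
  shows "continuous_map Z (nsphere (d + 2 * q)) (\<lambda>z. rot d (\<theta> z) (x z))"
proof -
  have p: "continuous_map Z euclideanreal (\<lambda>z. x z i)" for i
    using continuous_map_compose[OF assms(2) continuous_map_nsphere_projection[of _ i]] by (simp add: o_def)
  have c: "continuous_map Z euclideanreal (\<lambda>z. cos (\<theta> z))" "continuous_map Z euclideanreal (\<lambda>z. sin (\<theta> z))"
    using continuous_map_compose[OF assms(1), of euclideanreal cos] continuous_map_compose[OF assms(1), of euclideanreal sin]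
    by (simp_all add: o_def continuous_on_cos continuous_on_sin)
  have 1: "continuous_map Z euclideanreal (\<lambda>z. rot d (\<theta> z) (x z) i)" for i
  proof -
    consider "i \<le> d" | "d < i" "odd (i - d)" | "d < i" "even (i - d)" by force
    then show ?thesis
    proof cases
      case 1 then show ?thesis using p by (simp add: rot_def)
    next
      case 2
      have "continuous_map Z euclideanreal (\<lambda>z. cos (\<theta> z) * x z i - sin (\<theta> z) * x z (Suc i))"
        by (intro continuous_intros p c)
      then show ?thesis using 2 by (simp add: rot_def)
    next
      case 3
      have "continuous_map Z euclideanreal (\<lambda>z. sin (\<theta> z) * x z (i - 1) + cos (\<theta> z) * x z i)"
        by (intro continuous_intros p c)
      then show ?thesis using 3 by (simp add: rot_def)
    qed
  qed
  have x: "(\<Sum>i\<le>d + 2 * q. (x z i)\<^sup>2) = 1" "\<And>i. d + 2 * q < i \<Longrightarrow> x z i = 0" if "z \<in> topspace Z" for z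
    using continuous_map_image_subset_topspace[OF assms(2)] that by (auto simp: nsphere)
  have 3: "rot d (\<theta> z) (x z) i = 0" if "z \<in> topspace Z" "d + 2 * q < i" for z i
  proof -
    \<comment> \<open>Only the coordinate right after the last pair could read the entry at
      \<open>d + 2 * q\<close>, but it is the first of its own pair and therefore looks
      forward.\<close>
    have "odd (i - d)" if "i - 1 = d + 2 * q"
    proof -
      have "i = Suc (d + 2 * q)" using that \<open>d + 2 * q < i\<close> by linarith
      then show ?thesis by simp
    qed
    moreover have "x z (i - 1) = 0" if "i - 1 \<noteq> d + 2 * q"
      using x(2)[OF \<open>z \<in> topspace Z\<close>, of "i - 1"] that \<open>d + 2 * q < i\<close> by linarith
    ultimately have "odd (i - d) \<or> x z (i - 1) = 0" by blast
    then show ?thesis using x(2)[OF that(1), of i] x(2)[OF that(1), of "Suc i"] that by (auto simp: rot_def)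
  qed
  show ?thesis
    unfolding nsphere continuous_map_in_subtopology continuous_map_componentwise_UNIV
    using 1 3 x(1) by (auto simp: sum_squares_rot)
qed

lemma continuous_map_rot: "continuous_map (nsphere (d + 2 * q)) (nsphere (d + 2 * q)) (rot d \<theta>)"
  by (rule continuous_map_rot_homotopy) auto

lemma rot_homotopic_id:
  "homotopic_with (\<lambda>_. True) (nsphere (d + 2 * q)) (nsphere (d + 2 * q)) id (rot d \<theta>)"
proof -
  let ?P = "prod_topology (top_of_set {0..1::real}) (nsphere (d + 2 * q))"
  have "continuous_map ?P (nsphere (d + 2 * q)) (\<lambda>z. rot d (fst z * \<theta>) (snd z))"
    by (intro continuous_map_rot_homotopy continuous_map_snd continuous_intros
        continuous_map_into_fulltopology[OF continuous_map_fst])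
  then show ?thesis
    by (subst homotopic_with, simp, intro exI[of _ "\<lambda>z. rot d (fst z * \<theta>) (snd z)"]) auto
qed

section \<open>The norm operator on singular chains\<close>

definition norm_op :: "nat \<Rightarrow> nat \<Rightarrow> ('a \<Rightarrow> 'a) \<Rightarrow> 'a chain \<Rightarrow> 'a chain" where
  "norm_op p k f c = (\<Sum>j<p. chain_map k (f ^^ j) c)"

lemma continuous_map_funpow: "continuous_map X X f \<Longrightarrow> continuous_map X X (f ^^ j)"
  by (induction j) (auto intro: continuous_map_compose)

lemma singular_chain_norm_op:
  "singular_chain k X c \<Longrightarrow> continuous_map X X f \<Longrightarrow> singular_chain k X (norm_op p k f c)"
  unfolding norm_op_def by (blast intro: singular_chain_sum singular_chain_chain_map continuous_map_funpow)

lemma chain_map_norm_op: "chain_map k f (norm_op p k f c) = norm_op p k f (chain_map k f c)"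
proof -
  have "chain_map k f (chain_map k (f ^^ j) c) = chain_map k (f ^^ j) (chain_map k f c)" for j
    by (metis chain_map_compose comp_apply funpow_Suc_right funpow.simps(2))
  then show ?thesis unfolding norm_op_def by (simp add: chain_map_sum)
qed

lemma norm_op_diff: "norm_op p k f (a - b) = norm_op p k f a - norm_op p k f b"
  by (simp add: norm_op_def chain_map_diff sum_subtractf)

text \<open>The sum of f^j (c - f c) over j < p collapses to c - f^p c. Together with commutation of
  the norm and f this makes 1 - f and the norm compose to zero in either order.\<close>

lemma norm_op_telescope:
  assumes "singular_chain k X c" "\<And>x. x \<in> topspace X \<Longrightarrow> (f ^^ p) x = x"
  shows "norm_op p k f (c - chain_map k f c) = 0"
proof -
  have "norm_op m k f (c - chain_map k f c) = c - chain_map k (f ^^ m) c" for m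
  proof (induction m)
    case 0
    show ?case using chain_map_id_gen[OF assms(1), of "\<lambda>a. a"] by (simp add: norm_op_def id_def)
  next
    case (Suc m)
    have "chain_map k (f ^^ m) (chain_map k f c) = chain_map k (f ^^ Suc m) c"
      by (metis chain_map_compose comp_apply funpow_Suc_right)
    then show ?case using Suc by (simp add: norm_op_def chain_map_diff del: funpow.simps)
  qed
  then show ?thesis using chain_map_id_gen[OF assms] by simp
qed

lemma norm_op_invariant:
  assumes "singular_chain k X c" "\<And>x. x \<in> topspace X \<Longrightarrow> (f ^^ p) x = x"
  shows "chain_map k f (norm_op p k f c) = norm_op p k f c"
  using norm_op_telescope[OF assms] unfolding chain_map_norm_op norm_op_diff by simp

lemma chain_boundary_norm_op:
  "singular_chain k X c \<Longrightarrow> chain_boundary k (norm_op p k f c) = norm_op p (k - 1) f (chain_boundary k c)"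
  by (simp add: norm_op_def chain_boundary_sum o_def chain_boundary_chain_map)

lemma chain_map_norm_op_equivariant:
  assumes "singular_chain k X c" "\<And>x. x \<in> topspace X \<Longrightarrow> h (f x) = g (h x)" "continuous_map X X f"
  shows "chain_map k h (norm_op p k f c) = norm_op p k g (chain_map k h c)"
proof -
  have "(h \<circ> (f ^^ j)) x = ((g ^^ j) \<circ> h) x" if "x \<in> topspace X" for x j
  proof (induction j)
    case (Suc j)
    have "(f ^^ j) x \<in> topspace X" using continuous_map_funpow[OF assms(3)] that
      by (meson continuous_map_image_subset_topspace image_subset_iff)
    then show ?case using Suc assms(2) by simp
  qed simp
  then have "chain_map k (h \<circ> (f ^^ j)) c = chain_map k ((g ^^ j) \<circ> h) c" for j
    using assms(1) by (rule chain_map_eq[rotated])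
  then show ?thesis by (simp add: norm_op_def chain_map_sum o_def chain_map_compose[unfolded o_def])
qed

section \<open>Double suspension along a rotation of order p\<close>

text \<open>In polar coordinates the sector of angles from 0 to \<open>\<alpha>\<close> is cut out
  by two linear forms. A turn by j times \<open>\<alpha>\<close> moves it to angles between
  \<open>\<alpha>\<close> and 2 pi, where one of the forms is nonpositive. For p = 2 the sector is a
  half-plane and both forms equal \<open>b\<close>.\<close>

lemma sector_rotation:
  fixes a b \<alpha> :: real
  assumes p: "2 \<le> p" and \<alpha>: "\<alpha> = 2 * pi / real p" and j: "1 \<le> j" "j < p"
    and ab: "0 \<le> b" "0 \<le> sin \<alpha> * a - cos \<alpha> * b"
  defines "a' \<equiv> cos (real j * \<alpha>) * a - sin (real j * \<alpha>) * b"
    and "b' \<equiv> sin (real j * \<alpha>) * a + cos (real j * \<alpha>) * b"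
  shows "min b' (sin \<alpha> * a' - cos \<alpha> * b') \<le> 0"
proof (cases "a = 0 \<and> b = 0")
  case True
  then show ?thesis by (simp add: a'_def b'_def)
next
  case False
  define r where "r = sqrt (a\<^sup>2 + b\<^sup>2)"
  have r: "0 < r" "r\<^sup>2 = a\<^sup>2 + b\<^sup>2" using False by (auto simp: r_def sum_power2_gt_zero_iff)
  have "(a / r)\<^sup>2 + (b / r)\<^sup>2 = 1" using r(1) by (simp add: power_divide flip: add_divide_distrib r(2))
  moreover have "0 \<le> b / r" using ab r by simp
  ultimately obtain \<theta> where \<theta>: "0 \<le> \<theta>" "\<theta> \<le> pi" "a / r = cos \<theta>" "b / r = sin \<theta>"
    using sincos_total_pi by metis
  then have a: "a = r * cos \<theta>" and b: "b = r * sin \<theta>" using r by (auto simp: field_simps)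
  have \<alpha>0: "0 < \<alpha>" "\<alpha> \<le> pi" using p by (auto simp: \<alpha> field_simps)
  have "0 \<le> r * sin (\<alpha> - \<theta>)" using ab by (simp add: a b sin_diff algebra_simps)
  then have s: "0 \<le> sin (\<alpha> - \<theta>)" using r by (simp add: zero_le_mult_iff)
  have \<theta>\<alpha>: "\<theta> \<le> \<alpha>"
  proof (rule ccontr)
    assume "\<not> \<theta> \<le> \<alpha>"
    then have "0 < sin (\<theta> - \<alpha>)" using \<theta> \<alpha>0 by (intro sin_gt_zero) auto
    then show False using s sin_minus[of "\<theta> - \<alpha>"] by simp
  qed
  define \<psi> where "\<psi> = \<theta> + real j * \<alpha>"
  have a': "a' = r * cos \<psi>" and b': "b' = r * sin \<psi>"
    by (simp_all add: a'_def b'_def a b \<psi>_def cos_add sin_add algebra_simps)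
  have c: "sin \<alpha> * a' - cos \<alpha> * b' = r * sin (\<alpha> - \<psi>)"
    by (simp add: a' b' sin_diff algebra_simps)
  have "real j * \<alpha> \<ge> 1 * \<alpha>" using j \<alpha>0 by (intro mult_right_mono) auto
  then have \<psi>1: "\<alpha> \<le> \<psi>" using \<theta> by (simp add: \<psi>_def)
  have "\<psi> \<le> (real j + 1) * \<alpha>" using \<theta>\<alpha> by (simp add: \<psi>_def algebra_simps)
  also have "\<dots> \<le> real p * \<alpha>" using j \<alpha>0 by (intro mult_right_mono) auto
  also have "\<dots> = 2 * pi" using p by (simp add: \<alpha>)
  finally have \<psi>2: "\<psi> \<le> 2 * pi" .
  show ?thesis
  proof (cases "pi \<le> \<psi>")
    case True
    have "sin \<psi> \<le> 0"
    proof (cases "\<psi> = 2 * pi")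
      case False
      then show ?thesis using True \<psi>2 by (intro sin_le_zero) auto
    qed simp
    then have "b' \<le> 0" using r by (simp add: b' mult_nonneg_nonpos)
    then show ?thesis by simp
  next
    case False
    then have "0 \<le> sin (\<psi> - \<alpha>)" using \<psi>1 \<alpha>0 by (intro sin_ge_zero) auto
    then have "sin (\<alpha> - \<psi>) \<le> 0" using sin_minus[of "\<psi> - \<alpha>"] by simp
    then have "r * sin (\<alpha> - \<psi>) \<le> 0" using r by (simp add: mult_nonneg_nonpos)
    then show ?thesis using c by simp
  qed
qed

text \<open>\<open>D\<close> fills the cycle inside the hemisphere over the ray of angle 0,
  \<open>E\<close> fills the sector between this hemisphere and its rotated copy, and the p rotated
  copies of \<open>E\<close> close up to the double suspension of \<open>Z\<close>. Indivisibility
  is checked by folding the plane of the two new coordinates: the sector becomes the upper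
  half-plane and its rotated copies fall into the lower one, so that the suspension lemma applies
  twice.\<close>

lemma equivariant_double_suspension:
  fixes d q p :: nat
  defines "k \<equiv> d + 2 * q" and "g \<equiv> rot d (2 * pi / real p)"
  assumes p: "2 \<le> p" and Z: "red_cycle k (nsphere k) Z" and gZ: "chain_map k g Z = Z"
    and nd: "\<not> divisible_class p k (nsphere k) Z"
  obtains D E where "singular_chain (Suc k) (nsphere (Suc (Suc k))) D" "chain_boundary (Suc k) D = Z"
    "singular_chain (Suc (Suc k)) (nsphere (Suc (Suc k))) E"
    "chain_boundary (Suc (Suc k)) E = D - chain_map (Suc k) g D"
    "\<not> divisible_class p (Suc (Suc k)) (nsphere (Suc (Suc k))) (norm_op p (Suc (Suc k)) g E)"
proof -
  define \<alpha> where "\<alpha> = 2 * pi / real p"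
  have g: "g = rot d \<alpha>" by (simp add: g_def \<alpha>_def)
  have \<alpha>0: "0 < \<alpha>" "\<alpha> \<le> pi" using p by (auto simp: \<alpha>_def field_simps)
  have cos1: "cos \<alpha> < 1" using cos_monotone_0_pi[of 0 \<alpha>] \<alpha>0 by simp
  have sin0: "0 \<le> sin \<alpha>" using \<alpha>0 by (intro sin_ge_zero) auto
  let ?S = "nsphere (Suc (Suc k))"
  \<comment> \<open>\<open>\<sigma>\<close> is positive exactly in the interior of the sector.
    \<open>\<tau>\<close> is the linear form that vanishes on the bisector, positive on the side of
    angle 0 and negative on the side of angle \<open>\<alpha>\<close>. They are the two coordinates
    of the folding map.\<close>
  define \<sigma> \<tau> where "\<sigma> = (\<lambda>a b. min b (sin \<alpha> * a - cos \<alpha> * b))" and "\<tau> = (\<lambda>a b. a * (1 - cos \<alpha>) - b * sin \<alpha>)"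
  \<comment> \<open>The folded pair vanishes only at the origin, so radial projection after folding
    is defined.\<close>
  have eq0: "a = 0 \<and> b = 0" if st: "\<sigma> a b = 0" "\<tau> a b = 0" for a b
  proof -
    have b: "b = 0"
    proof (rule ccontr)
      assume nz: "b \<noteq> 0"
      then have v: "sin \<alpha> * a = cos \<alpha> * b" using st(1) by (auto simp: \<sigma>_def min_def split: if_splits)
      have u: "a = a * cos \<alpha> + b * sin \<alpha>" using st(2) by (simp add: \<tau>_def algebra_simps)
      have "a * sin \<alpha> = a * sin \<alpha> * cos \<alpha> + b * (sin \<alpha>)\<^sup>2"
        by (subst u) (simp add: algebra_simps power2_eq_square)
      also have "\<dots> = b * ((cos \<alpha>)\<^sup>2 + (sin \<alpha>)\<^sup>2)"
      proof -
        have "a * sin \<alpha> * cos \<alpha> = b * (cos \<alpha>)\<^sup>2" using v by (metis mult.commute mult.assoc power2_eq_square)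
        then show ?thesis by (simp add: distrib_left del: sin_cos_squared_add sin_cos_squared_add2 sin_cos_squared_add3)
      qed
      finally have "b = cos \<alpha> * b" using v by (simp add: mult.commute)
      then show False using nz cos1 by simp
    qed
    then show ?thesis using st(2) cos1 by (simp add: \<tau>_def)
  qed
  have gc: "continuous_map ?S ?S g"
    using continuous_map_rot[of d "Suc q" \<alpha>] by (simp add: g k_def)
  have gj: "(g ^^ j) x (Suc k) = cos (real j * \<alpha>) * x (Suc k) - sin (real j * \<alpha>) * x (Suc (Suc k))"
    "(g ^^ j) x (Suc (Suc k)) = sin (real j * \<alpha>) * x (Suc k) + cos (real j * \<alpha>) * x (Suc (Suc k))" for j x
    unfolding g rot_funpow by (simp_all add: rot_def k_def)
  have g1: "g x (Suc k) = cos \<alpha> * x (Suc k) - sin \<alpha> * x (Suc (Suc k))"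
    "g x (Suc (Suc k)) = sin \<alpha> * x (Suc k) + cos \<alpha> * x (Suc (Suc k))" for x
    using gj[of 1] by simp_all
  have gp: "(g ^^ p) x = x" for x
    unfolding g rot_funpow using p by (simp add: \<alpha>_def)
  define W where "W = {x. 0 \<le> \<sigma> (x (Suc k)) (x (Suc (Suc k)))}"
  define V where "V = {x. \<sigma> (x (Suc k)) (x (Suc (Suc k))) \<le> 0}"
  have contr: "contractible_space (subtopology ?S W)"
  proof (rule contractible_cone_section)
    \<comment> \<open>The unit vector on the bisector of the sector.\<close>
    let ?w = "\<lambda>i. if i = Suc k then cos (\<alpha> / 2) else if i = Suc (Suc k) then sin (\<alpha> / 2) else 0"
    show "?w \<in> topspace ?S" by (simp add: nsphere)
    fix x assume xW: "x \<in> W"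
    let ?a = "x (Suc k)" and ?b = "x (Suc (Suc k))"
    have ab: "0 \<le> ?b" "0 \<le> sin \<alpha> * ?a - cos \<alpha> * ?b" using xW by (auto simp: W_def \<sigma>_def)
    {
      fix c :: real assume "0 < c"
      have "0 \<le> c * ?b" "0 \<le> c * (sin \<alpha> * ?a - cos \<alpha> * ?b)" using ab \<open>0 < c\<close> by simp_all
      then show "(\<lambda>i. c * x i) \<in> W" by (simp add: W_def \<sigma>_def algebra_simps)
    }
    fix t :: real assume xS: "x \<in> topspace ?S" and t: "0 \<le> t" "t \<le> 1"
    have s2: "0 < sin (\<alpha> / 2)" using \<alpha>0 by (intro sin_gt_zero) auto
    have d: "sin \<alpha> * cos (\<alpha> / 2) - cos \<alpha> * sin (\<alpha> / 2) = sin (\<alpha> / 2)"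
      using sin_diff[of \<alpha> "\<alpha> / 2"] by simp
    have "0 \<le> (1 - t) * ?b + t * sin (\<alpha> / 2)" using ab t s2 by simp
    moreover have "0 \<le> (1 - t) * (sin \<alpha> * ?a - cos \<alpha> * ?b) + t * (sin \<alpha> * cos (\<alpha> / 2) - cos \<alpha> * sin (\<alpha> / 2))"
      unfolding d using ab t s2 by simp
    ultimately have 1: "(\<lambda>i. (1 - t) * x i + t * ?w i) \<in> W" by (simp add: W_def \<sigma>_def algebra_simps)
    have 2: "\<exists>i\<le>Suc (Suc k). (1 - t) * x i + t * ?w i \<noteq> 0"
    proof (cases "t = 0")
      case True
      have "\<exists>i\<le>Suc (Suc k). x i \<noteq> 0"
      proof (rule ccontr)
        assume "\<not> (\<exists>i\<le>Suc (Suc k). x i \<noteq> 0)"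
        then have "(\<Sum>i\<le>Suc (Suc k). (x i)\<^sup>2) = 0" by (intro sum.neutral) auto
        then show False using xS unfolding nsphere by simp
      qed
      then show ?thesis using True by simp
    next
      case False
      have "0 < (1 - t) * ?b + t * sin (\<alpha> / 2)" using ab t s2 False by (intro add_nonneg_pos) auto
      then show ?thesis by (intro exI[of _ "Suc (Suc k)"]) simp
    qed
    show "(\<lambda>i. (1 - t) * x i + t * ?w i) \<in> W \<and> (\<exists>i\<le>Suc (Suc k). (1 - t) * x i + t * ?w i \<noteq> 0)"
      using 1 2 by blast
  qed
  have sph: "nsphere (Suc k) = subtopology ?S {x. \<forall>i>Suc k. x i = 0}" "nsphere k = subtopology ?S {x. \<forall>i>k. x i = 0}"
    by (rule nsphere_subtopology; simp)+
  \<comment> \<open>The hemisphere over the ray of angle 0; \<open>g\<close> carries it to the one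
    over the ray of angle \<open>\<alpha>\<close>. Both are sides of \<open>W\<close>.\<close>
  define U where "U = subtopology (nsphere (Suc k)) {x. 0 \<le> x (Suc k)}"
  have U: "x \<in> topspace ?S" "\<And>i. Suc k < i \<Longrightarrow> x i = 0" "0 \<le> x (Suc k)" if "x \<in> topspace U" for x
    using that by (auto simp: U_def sph)
  have Uc: "continuous_map U ?S id" unfolding U_def sph by (simp add: continuous_map_from_subtopology)
  have kU: "continuous_map (nsphere k) U id"
    unfolding U_def sph(1) unfolding sph(2) by (auto simp: continuous_map_in_subtopology continuous_map_from_subtopology)
  have Zs: "singular_chain k (nsphere k) Z" using Z by (rule red_cycle_singular)
  have "red_cycle k U (chain_map k id Z)" using red_cycle_chain_map[OF Z kU] .
  then have "red_cycle k U Z" using chain_map_ident[OF Zs] by simp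
  moreover have "trivial_group (reduced_homology_group (int k) U)"
    unfolding U_def by (intro trivial_reduced_homology_group_contractible_space contractible_space_upper_hemisphere) simp
  ultimately obtain D where D: "singular_chain (Suc k) U D" "chain_boundary (Suc k) D = Z"
    using red_cycle_bounds by blast
  have DS: "singular_chain (Suc k) ?S D"
    using singular_chain_chain_map[OF D(1) Uc] chain_map_ident[OF D(1)] by simp
  have \<sigma>0: "\<sigma> a 0 = 0" "\<sigma> (cos \<alpha> * a) (sin \<alpha> * a) = 0" if "0 \<le> a" for a
    using mult_nonneg_nonneg[OF sin0 that] by (simp_all add: \<sigma>_def)
  have U\<sigma>: "\<sigma> (x (Suc k)) (x (Suc (Suc k))) = 0" "\<sigma> (g x (Suc k)) (g x (Suc (Suc k))) = 0" if "x \<in> topspace U" for x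
    using \<sigma>0[OF U(3)[OF that]] U(2)[OF that, of "Suc (Suc k)"] by (simp_all add: g1)
  have UW: "continuous_map U (subtopology ?S W) id" "continuous_map U (subtopology ?S W) g"
    using Uc U\<sigma> continuous_map_compose[OF Uc gc]
    by (auto simp: continuous_map_in_subtopology W_def)
  have gD: "chain_boundary (Suc k) (chain_map (Suc k) g D) = Z"
    using chain_boundary_chain_map[OF D(1), of g] D(2) gZ by simp
  have "singular_chain (Suc k) (subtopology ?S W) (D - chain_map (Suc k) g D)"
    using singular_chain_chain_map[OF D(1) UW(1)] singular_chain_chain_map[OF D(1) UW(2)] chain_map_ident[OF D(1)]
    by (simp add: singular_chain_diff)
  then have "red_cycle (Suc k) (subtopology ?S W) (D - chain_map (Suc k) g D)"
    by (intro red_cycle_pos) (use D gD in \<open>auto simp: chain_boundary_diff\<close>)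
  then obtain E where E: "singular_chain (Suc (Suc k)) (subtopology ?S W) E"
    "chain_boundary (Suc (Suc k)) E = D - chain_map (Suc k) g D"
    using red_cycle_bounds trivial_reduced_homology_group_contractible_space[OF contr] by blast
  have ES: "singular_chain (Suc (Suc k)) ?S E" using E(1) singular_chain_subtopology by blast
  \<comment> \<open>Folding keeps the old coordinates; after projection to the sphere it is the
    identity on the sphere of dimension \<open>k\<close>, so it does not change
    \<open>Z\<close>.\<close>
  define r where "r = (\<lambda>x i. if i \<le> k then x i else if i = Suc k then \<tau> (x (Suc k)) (x (Suc (Suc k)))
     else if i = Suc (Suc k) then \<sigma> (x (Suc k)) (x (Suc (Suc k))) else 0)"
  define \<rho> where "\<rho> = (\<lambda>x. nrm (Suc (Suc k)) (r x))"
  have \<rho>c: "continuous_map ?S ?S \<rho>"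
    unfolding \<rho>_def
  proof (rule continuous_map_nrm)
    fix i assume "i \<le> Suc (Suc k)"
    then consider "i \<le> k" | "i = Suc k" | "i = Suc (Suc k)" by linarith
    then show "continuous_map ?S euclideanreal (\<lambda>x. r x i)"
    proof cases
      case 1 then show ?thesis by (simp add: r_def continuous_map_nsphere_projection)
    next
      case 2
      have "continuous_map ?S euclideanreal (\<lambda>x. \<tau> (x (Suc k)) (x (Suc (Suc k))))"
        unfolding \<tau>_def by (intro continuous_intros continuous_map_nsphere_projection)
      then show ?thesis using 2 by (simp add: r_def)
    next
      case 3
      have "continuous_map ?S euclideanreal (\<lambda>x. \<sigma> (x (Suc k)) (x (Suc (Suc k))))"
        unfolding \<sigma>_def by (intro continuous_intros continuous_map_real_min continuous_map_nsphere_projection)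
      then show ?thesis using 3 by (simp add: r_def)
    qed
  next
    fix x assume x: "x \<in> topspace ?S"
    show "\<exists>i\<le>Suc (Suc k). r x i \<noteq> 0"
    proof (rule ccontr)
      assume "\<not> (\<exists>i\<le>Suc (Suc k). r x i \<noteq> 0)"
      then have z: "r x i = 0" if "i \<le> Suc (Suc k)" for i using that by blast
      have "\<tau> (x (Suc k)) (x (Suc (Suc k))) = 0" "\<sigma> (x (Suc k)) (x (Suc (Suc k))) = 0"
        using z[of "Suc k"] z[of "Suc (Suc k)"] by (simp_all add: r_def)
      then have "x (Suc k) = 0" "x (Suc (Suc k)) = 0" using eq0 by blast+
      moreover have "x i = 0" if "i \<le> k" for i using z[of i] that by (simp add: r_def)
      ultimately have "(\<Sum>i\<le>Suc (Suc k). (x i)\<^sup>2) = 0" by simp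
      then show False using x unfolding nsphere by simp
    qed
  qed (simp add: r_def)
  have \<rho>pos: "0 \<le> \<rho> x i" if "0 \<le> r x i" for x i
    using that by (simp add: \<rho>_def nrm_def sum_nonneg)
  have \<rho>neg: "\<rho> x i \<le> 0" if "r x i \<le> 0" for x i
    using that by (simp add: \<rho>_def nrm_def sum_nonneg divide_nonpos_nonneg)
  have \<rho>zero: "\<rho> x i = 0" if "r x i = 0" for x i
    using that by (simp add: \<rho>_def nrm_def)
  have \<rho>id: "\<rho> x = x" if "x \<in> topspace (nsphere k)" for x
  proof -
    have x: "x \<in> topspace ?S" "\<And>i. k < i \<Longrightarrow> x i = 0" using that by (auto simp: sph)
    then have "r x = x" by (auto simp: r_def \<tau>_def \<sigma>_def fun_eq_iff)
    then show ?thesis using nrm_nsphere[OF x(1)] by (simp add: \<rho>_def)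
  qed
  \<comment> \<open>The folded images of the two sides of the sector: one lies where the coordinate
    \<open>\<tau>\<close> is nonnegative, the other where it is nonpositive. Their sum is the
    boundary of the folded \<open>E\<close>.\<close>
  define B1 B2 where "B1 = chain_map (Suc k) \<rho> D" and "B2 = - chain_map (Suc k) \<rho> (chain_map (Suc k) g D)"
  have B1: "singular_chain (Suc k) (subtopology (nsphere (Suc k)) {x. 0 \<le> x (Suc k)}) B1"
    unfolding B1_def
  proof (rule singular_chain_chain_map[OF D(1)])
    have "\<rho> x i = 0" if "x \<in> topspace U" "Suc k < i" for x i
      using U\<sigma>[OF that(1)] that by (intro \<rho>zero) (auto simp: r_def)
    moreover have "0 \<le> \<rho> x (Suc k)" if "x \<in> topspace U" for x
      using U[OF that] cos1 by (intro \<rho>pos) (auto simp: r_def \<tau>_def)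
    ultimately show "continuous_map U (subtopology (nsphere (Suc k)) {x. 0 \<le> x (Suc k)}) \<rho>"
      using continuous_map_compose[OF Uc \<rho>c] unfolding sph(1)
      by (auto simp: continuous_map_in_subtopology)
  qed
  have "singular_chain (Suc k) (subtopology (nsphere (Suc k)) {x. x (Suc k) \<le> 0}) (chain_map (Suc k) (\<rho> \<circ> g) D)"
  proof (rule singular_chain_chain_map[OF D(1)])
    have *: "\<rho> (g x) i = 0" if "x \<in> topspace U" "Suc k < i" for x i
      using U\<sigma>[OF that(1)] that by (intro \<rho>zero) (auto simp: r_def)
    have "\<rho> (g x) (Suc k) \<le> 0" if "x \<in> topspace U" for x
    proof (rule \<rho>neg)
      let ?a = "x (Suc k)"
      have "r (g x) (Suc k) = ?a * cos \<alpha> - ?a * ((cos \<alpha>)\<^sup>2 + (sin \<alpha>)\<^sup>2)"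
        using U[OF that] by (simp add: r_def \<tau>_def g1 algebra_simps power2_eq_square del: sin_cos_squared_add sin_cos_squared_add2 sin_cos_squared_add3)
      also have "\<dots> = ?a * (cos \<alpha> - 1)" by (simp add: algebra_simps)
      also have "\<dots> \<le> 0" using U[OF that] cos1 by (intro mult_nonneg_nonpos) auto
      finally show "r (g x) (Suc k) \<le> 0" .
    qed
    then show "continuous_map U (subtopology (nsphere (Suc k)) {x. x (Suc k) \<le> 0}) (\<rho> \<circ> g)"
      using continuous_map_compose[OF continuous_map_compose[OF Uc gc] \<rho>c] * unfolding sph(1)
      by (auto simp: continuous_map_in_subtopology)
  qed
  then have B2: "singular_chain (Suc k) (subtopology (nsphere (Suc k)) {x. x (Suc k) \<le> 0}) B2"
    by (simp add: B2_def singular_chain_minus chain_map_compose)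
  have dB1: "chain_boundary (Suc k) B1 = Z"
    unfolding B1_def using chain_boundary_chain_map[OF D(1), of \<rho>] D(2) chain_map_id_gen[OF Zs \<rho>id] by simp
  have gDS: "singular_chain (Suc k) ?S (chain_map (Suc k) g D)" using singular_chain_chain_map[OF DS gc] .
  have dB2: "chain_boundary (Suc k) B2 = - Z"
    unfolding B2_def using chain_boundary_chain_map[OF gDS, of \<rho>] gD chain_map_id_gen[OF Zs \<rho>id]
    by (simp add: chain_boundary_minus)
  have nd1: "\<not> divisible_class p (Suc k) (nsphere (Suc k)) (B1 + B2)"
  proof
    assume dv: "divisible_class p (Suc k) (nsphere (Suc k)) (B1 + B2)"
    have "singular_chain k (nsphere k) (chain_boundary (Suc k) B1)" using dB1 Zs by simp
    moreover have "chain_boundary (Suc k) (B1 + B2) = 0" using dB1 dB2 by (simp add: chain_boundary_add)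
    ultimately show False
      using suspension_not_divisible[OF B1 B2 _ _ dv] nd dB1 by simp
  qed
  \<comment> \<open>The folded norm of \<open>E\<close> is split into the copy for j = 0, in the
    upper hemisphere, and all other copies, in the lower one.\<close>
  define A1 A2 where "A1 = chain_map (Suc (Suc k)) \<rho> E"
    and "A2 = (\<Sum>j\<in>{1..<p}. chain_map (Suc (Suc k)) \<rho> (chain_map (Suc (Suc k)) (g ^^ j) E))"
  have A1: "singular_chain (Suc (Suc k)) (subtopology ?S {x. 0 \<le> x (Suc (Suc k))}) A1"
    unfolding A1_def
  proof (rule singular_chain_chain_map[OF E(1)])
    have "0 \<le> \<rho> x (Suc (Suc k))" if "x \<in> W" for x
      using that by (intro \<rho>pos) (auto simp: r_def W_def)
    then show "continuous_map (subtopology ?S W) (subtopology ?S {x. 0 \<le> x (Suc (Suc k))}) \<rho>"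
      using \<rho>c by (auto simp: continuous_map_in_subtopology continuous_map_from_subtopology)
  qed
  have A2: "singular_chain (Suc (Suc k)) (subtopology ?S {x. x (Suc (Suc k)) \<le> 0}) A2"
    unfolding A2_def
  proof (rule singular_chain_sum)
    fix j assume j: "j \<in> {1..<p}"
    have "singular_chain (Suc (Suc k)) (subtopology ?S {x. x (Suc (Suc k)) \<le> 0}) (chain_map (Suc (Suc k)) (\<rho> \<circ> (g ^^ j)) E)"
    proof (rule singular_chain_chain_map[OF E(1)])
      have "\<rho> ((g ^^ j) x) (Suc (Suc k)) \<le> 0" if "x \<in> W" for x
      proof (rule \<rho>neg)
        have "0 \<le> x (Suc (Suc k))" "0 \<le> sin \<alpha> * x (Suc k) - cos \<alpha> * x (Suc (Suc k))"
          using that by (auto simp: W_def \<sigma>_def)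
        from sector_rotation[OF p \<alpha>_def _ _ this, of j] j
        show "r ((g ^^ j) x) (Suc (Suc k)) \<le> 0"
          unfolding r_def \<sigma>_def gj by auto
      qed
      then show "continuous_map (subtopology ?S W) (subtopology ?S {x. x (Suc (Suc k)) \<le> 0}) (\<rho> \<circ> (g ^^ j))"
        using continuous_map_compose[OF continuous_map_funpow[OF gc, of j] \<rho>c]
        by (auto simp: continuous_map_in_subtopology continuous_map_from_subtopology)
    qed
    then show "singular_chain (Suc (Suc k)) (subtopology ?S {x. x (Suc (Suc k)) \<le> 0})
        (chain_map (Suc (Suc k)) \<rho> (chain_map (Suc (Suc k)) (g ^^ j) E))"
      by (simp add: chain_map_compose)
  qed
  let ?N = "norm_op p (Suc (Suc k)) g E"
  have A12: "A1 + A2 = chain_map (Suc (Suc k)) \<rho> ?N"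
  proof -
    have "{..<p} = insert 0 {1..<p}" using p by auto
    then have "?N = chain_map (Suc (Suc k)) (g ^^ 0) E + (\<Sum>j\<in>{1..<p}. chain_map (Suc (Suc k)) (g ^^ j) E)"
      by (simp add: norm_op_def)
    also have "chain_map (Suc (Suc k)) (g ^^ 0) E = E" using chain_map_id_gen[OF E(1), of "g ^^ 0"] by (simp del: funpow.simps add: funpow_0)
    finally show ?thesis by (simp add: chain_map_add chain_map_sum o_def A1_def A2_def)
  qed
  have NS: "singular_chain (Suc (Suc k)) ?S ?N" by (rule singular_chain_norm_op[OF ES gc])
  have dN: "chain_boundary (Suc (Suc k)) ?N = 0"
    using chain_boundary_norm_op[OF ES, of p g] norm_op_telescope[OF DS gp] E(2) by simp
  have dA1: "chain_boundary (Suc (Suc k)) A1 = B1 + B2"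
    unfolding A1_def B1_def B2_def using chain_boundary_chain_map[OF ES, of \<rho>] E(2) by (simp add: chain_map_diff)
  have "\<not> divisible_class p (Suc (Suc k)) ?S ?N"
  proof
    assume "divisible_class p (Suc (Suc k)) ?S ?N"
    then have dv: "divisible_class p (Suc (Suc k)) ?S (A1 + A2)"
      unfolding A12 using divisible_class_hom[OF _ _ \<rho>c] NS dN singular_cycle by blast
    have "singular_chain (Suc k) (nsphere (Suc k)) (chain_boundary (Suc (Suc k)) A1)"
      unfolding dA1 using B1 B2 by (intro singular_chain_add) (auto simp: singular_chain_subtopology)
    moreover have "chain_boundary (Suc (Suc k)) (A1 + A2) = 0"
      unfolding A12 using chain_boundary_chain_map[OF NS, of \<rho>] dN by simp
    ultimately show False
      using suspension_not_divisible[OF A1 A2 _ _ dv] nd1 dA1 by simp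
  qed
  then show thesis using that DS D(2) ES E(2) by blast
qed

section \<open>Alternating resolutions by chains\<close>

definition op_chain :: "nat \<Rightarrow> nat \<Rightarrow> ('a \<Rightarrow> 'a) \<Rightarrow> nat \<Rightarrow> 'a chain \<Rightarrow> 'a chain" where
  "op_chain p k f i c = (if even i then c - chain_map k f c else norm_op p k f c)"

text \<open>A truncation of the periodic free resolution of the cyclic group of order p, realized by
  fillings that start from \<open>z\<close>. \<open>m\<close> counts the chains; for
  \<open>m = 0\<close> there is no condition, which is where the induction over spheres
  begins.\<close>

definition resolution :: "nat \<Rightarrow> nat \<Rightarrow> ('a \<Rightarrow> 'a) \<Rightarrow> 'a topology \<Rightarrow> 'a chain \<Rightarrow> (nat \<Rightarrow> 'a chain) \<Rightarrow> nat \<Rightarrow> bool" where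
  "resolution p d f X z c m \<longleftrightarrow> (\<forall>i<m. singular_chain (Suc (d + i)) X (c i)) \<and>
     (0 < m \<longrightarrow> chain_boundary (Suc d) (c 0) = z) \<and>
     (\<forall>i. Suc i < m \<longrightarrow> chain_boundary (Suc (Suc (d + i))) (c (Suc i)) = op_chain p (Suc (d + i)) f i (c i))"

lemma singular_chain_op:
  "singular_chain k X c \<Longrightarrow> continuous_map X X f \<Longrightarrow> singular_chain k X (op_chain p k f i c)"
  by (simp add: op_chain_def singular_chain_norm_op singular_chain_diff singular_chain_chain_map)

lemma op_chain_diff: "op_chain p k f i (a - b) = op_chain p k f i a - op_chain p k f i b"
  by (simp add: op_chain_def norm_op_diff chain_map_diff)

lemma chain_boundary_op:
  "singular_chain k X c \<Longrightarrow> chain_boundary k (op_chain p k f i c) = op_chain p (k - 1) f i (chain_boundary k c)"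
  by (simp add: op_chain_def chain_boundary_norm_op chain_boundary_diff chain_boundary_chain_map)

lemma op_chain_op_chain:
  assumes "singular_chain k X c" "\<And>x. x \<in> topspace X \<Longrightarrow> (f ^^ p) x = x" "continuous_map X X f"
  shows "op_chain p k f (Suc i) (op_chain p k f i c) = 0"
  using norm_op_telescope[OF assms(1,2)] norm_op_invariant[OF assms(1,2)] by (simp add: op_chain_def)

text \<open>Consecutive operators compose to zero, so each operator image is a cycle and bounds in a
  contractible space. The predicate \<open>P\<close> carries this cycle condition from stage to
  stage.\<close>

lemma resolution_exists:
  assumes X: "contractible_space X" and f: "continuous_map X X f" "\<And>x. x \<in> topspace X \<Longrightarrow> (f ^^ p) x = x"
    and z: "red_cycle d X z" "chain_map d f z = z"
  obtains c where "\<And>m. resolution p d f X z c m"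
proof -
  have triv: "trivial_group (reduced_homology_group (int k) X)" for k
    using X trivial_reduced_homology_group_contractible_space by blast
  obtain c0 where c0: "singular_chain (Suc d) X c0" "chain_boundary (Suc d) c0 = z"
    using red_cycle_bounds[OF z(1) triv] by blast
  define P where "P = (\<lambda>i c. singular_chain (Suc (d + i)) X c \<and>
     chain_boundary (Suc (d + i)) (op_chain p (Suc (d + i)) f i c) = 0 \<and> (i = 0 \<longrightarrow> chain_boundary (Suc d) c = z))"
  define Q where "Q = (\<lambda>i c c'. chain_boundary (Suc (Suc (d + i))) c' = op_chain p (Suc (d + i)) f i c)"
  have "\<exists>c. \<forall>i. P i (c i) \<and> Q i (c i) (c (Suc i))"
  proof (rule dependent_nat_choice)
    \<comment> \<open>The first operator image is a cycle because \<open>z\<close> is invariant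
      under \<open>f\<close>.\<close>
    show "\<exists>c. P 0 c"
      using c0 z(2) by (auto simp: P_def chain_boundary_op op_chain_def chain_boundary_diff chain_boundary_chain_map)
  next
    fix c i assume c: "P i c"
    have cs: "singular_chain (Suc (d + i)) X c" using c by (simp add: P_def)
    have "red_cycle (Suc (d + i)) X (op_chain p (Suc (d + i)) f i c)"
      by (rule red_cycle_pos) (use c singular_chain_op[OF cs f(1)] in \<open>auto simp: P_def\<close>)
    then obtain c' where c': "singular_chain (Suc (Suc (d + i))) X c'"
      "chain_boundary (Suc (Suc (d + i))) c' = op_chain p (Suc (d + i)) f i c"
      using red_cycle_bounds[OF _ triv] by blast
    have "P (Suc i) c'"
      using c' chain_boundary_op[OF c'(1), of p f "Suc i"] op_chain_op_chain[OF cs f(2) f(1)] by (simp add: P_def)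
    then show "\<exists>c'. P (Suc i) c' \<and> Q i c c'" using c' by (auto simp: Q_def)
  qed
  then obtain c where c: "\<And>i. P i (c i)" "\<And>i. Q i (c i) (c (Suc i))" by blast
  show thesis
    by (rule that[of c]) (use c in \<open>auto simp: resolution_def P_def Q_def\<close>)
qed

text \<open>Each double suspension adds two chains: \<open>D\<close> fills the norm of the last
  chain (or \<open>z\<close> itself at the start) and \<open>E\<close> fills \<open>D - g D\<close>.
  The class that a further stage would have to kill is the norm of \<open>E\<close>, and it remains
  indivisible.\<close>

lemma sphere_resolution:
  fixes p d :: nat
  defines "g \<equiv> rot d (2 * pi / real p)"
  assumes p: "2 \<le> p" and z: "red_cycle d (nsphere d) z" "\<not> divisible_class p d (nsphere d) z"
    and gz: "chain_map d g z = z"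
  shows "\<exists>c. resolution p d g (nsphere (d + 2 * q)) z c (2 * q) \<and>
    red_cycle (d + 2 * q) (nsphere (d + 2 * q)) (if q = 0 then z else norm_op p (d + 2 * q) g (c (2 * q - 1))) \<and>
    \<not> divisible_class p (d + 2 * q) (nsphere (d + 2 * q)) (if q = 0 then z else norm_op p (d + 2 * q) g (c (2 * q - 1)))"
proof (induction q)
  case 0
  show ?case using z by (simp add: resolution_def)
next
  case (Suc q)
  let ?k = "d + 2 * q"
  let ?S = "nsphere (Suc (Suc ?k))"
  have gp: "(g ^^ p) x = x" for x
    unfolding g_def rot_funpow using p by simp
  obtain c where c: "resolution p d g (nsphere ?k) z c (2 * q)"
    and Z: "red_cycle ?k (nsphere ?k) (if q = 0 then z else norm_op p ?k g (c (2 * q - 1)))"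
    and nd: "\<not> divisible_class p ?k (nsphere ?k) (if q = 0 then z else norm_op p ?k g (c (2 * q - 1)))"
    using Suc by blast
  let ?Z = "if q = 0 then z else norm_op p ?k g (c (2 * q - 1))"
  have gZ: "chain_map ?k g ?Z = ?Z"
  proof (cases "q = 0")
    case False
    then have "2 * q - 1 < 2 * q" "Suc (d + (2 * q - 1)) = ?k" by auto
    then have "singular_chain ?k (nsphere ?k) (c (2 * q - 1))"
      using c unfolding resolution_def by metis
    from norm_op_invariant[OF this gp] show ?thesis using False by simp
  qed (use gz in simp)
  obtain D E where D: "singular_chain (Suc ?k) ?S D" "chain_boundary (Suc ?k) D = ?Z"
    and E: "singular_chain (Suc (Suc ?k)) ?S E" "chain_boundary (Suc (Suc ?k)) E = D - chain_map (Suc ?k) g D"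
    and nd': "\<not> divisible_class p (Suc (Suc ?k)) ?S (norm_op p (Suc (Suc ?k)) g E)"
    using equivariant_double_suspension[OF p Z] gZ nd unfolding g_def by blast
  define c' where "c' = c(2 * q := D, Suc (2 * q) := E)"
  have [simp]: "d + 2 * Suc q = Suc (Suc ?k)" "2 * Suc q = Suc (Suc (2 * q))" "2 * Suc q - 1 = Suc (2 * q)" by auto
  have gc: "continuous_map ?S ?S g" using continuous_map_rot[of d "Suc q"] by (simp add: g_def)
  have "resolution p d g ?S z c' (Suc (Suc (2 * q)))"
    unfolding resolution_def
  proof (intro conjI allI impI)
    fix i assume "i < Suc (Suc (2 * q))"
    then consider "i < 2 * q" | "i = 2 * q" | "i = Suc (2 * q)" by linarith
    then show "singular_chain (Suc (d + i)) ?S (c' i)"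
    proof cases
      case 1
      then have "singular_chain (Suc (d + i)) (nsphere ?k) (c i)" using c by (simp add: resolution_def)
      then show ?thesis using 1 singular_chain_nsphere_mono by (simp add: c'_def)
    qed (use D E in \<open>simp_all add: c'_def\<close>)
  next
    show "chain_boundary (Suc d) (c' 0) = z"
      using c D by (auto simp: c'_def resolution_def)
  next
    fix i assume "Suc i < Suc (Suc (2 * q))"
    then consider "Suc i < 2 * q" | "Suc i = 2 * q" | "i = 2 * q" by linarith
    then show "chain_boundary (Suc (Suc (d + i))) (c' (Suc i)) = op_chain p (Suc (d + i)) g i (c' i)"
    proof cases
      case 1
      then show ?thesis using c by (simp add: c'_def resolution_def)
    next
      case 2
      then have i: "i = 2 * q - 1" "q \<noteq> 0" "odd i" "Suc (d + i) = ?k" by (auto, presburger)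
      have "c' (Suc i) = D" "c' i = c i" using 2 by (auto simp: c'_def)
      then show ?thesis using D(2) i by (simp add: op_chain_def)
    next
      case 3
      then show ?thesis using E by (simp add: c'_def op_chain_def)
    qed
  qed
  moreover have "c' (Suc (2 * q)) = E" by (simp add: c'_def)
  moreover have "red_cycle (Suc (Suc ?k)) ?S (norm_op p (Suc (Suc ?k)) g E)"
    by (rule red_cycle_pos)
      (use singular_chain_norm_op[OF E(1) gc] chain_boundary_norm_op[OF E(1), of p g] norm_op_telescope[OF D(1) gp] E(2) in auto)
  ultimately show ?case using nd' by (intro exI[of _ c']) simp
qed

text \<open>The difference of the first chains is a cycle. As long as homology vanishes, the cycle
  bounds some \<open>b\<close>; correcting the next difference by the operator applied to
  \<open>b\<close> makes it a cycle again and does not change its image under the following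
  operator. In the top degree the cycle need not bound, so the conclusion keeps
  \<open>e\<close>.\<close>

lemma resolution_compare:
  assumes c: "resolution p d f Y z c m" and c': "resolution p d f Y z c' m"
    and f: "continuous_map Y Y f" "\<And>x. x \<in> topspace Y \<Longrightarrow> (f ^^ p) x = x"
    and triv: "\<And>i. Suc i < m \<Longrightarrow> trivial_group (reduced_homology_group (int (Suc (d + i))) Y)"
    and "i < m"
  shows "\<exists>e. singular_relcycle (Suc (d + i)) Y {} e \<and>
    op_chain p (Suc (d + i)) f i (c i) - op_chain p (Suc (d + i)) f i (c' i) = op_chain p (Suc (d + i)) f i e"
  using \<open>i < m\<close>
proof (induction i)
  case 0
  have "singular_relcycle (Suc d) Y {} (c 0 - c' 0)"
  proof -
    have "singular_chain (Suc d) Y (c 0)" "singular_chain (Suc d) Y (c' 0)"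
      using c c' 0 unfolding resolution_def by (metis add_0_right)+
    then show ?thesis
      using c c' 0 by (simp add: resolution_def singular_cycle singular_chain_diff chain_boundary_diff)
  qed
  then show ?case by (auto simp: op_chain_diff)
next
  case (Suc i)
  let ?k = "Suc (d + i)"
  obtain e where e: "singular_relcycle ?k Y {} e" "op_chain p ?k f i (c i) - op_chain p ?k f i (c' i) = op_chain p ?k f i e"
    using Suc by auto
  have "red_cycle ?k Y e" using e by (intro red_cycle_pos) (auto simp: singular_cycle)
  then obtain b where b: "singular_chain (Suc ?k) Y b" "chain_boundary (Suc ?k) b = e"
    using red_cycle_bounds[OF _ triv[OF Suc.prems]] by blast
  let ?e = "c (Suc i) - c' (Suc i) - op_chain p (Suc ?k) f i b"
  have cs: "singular_chain (Suc ?k) Y (c (Suc i))" "singular_chain (Suc ?k) Y (c' (Suc i))"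
    using c c' Suc.prems by (auto simp: resolution_def)
  have "chain_boundary (Suc ?k) (c (Suc i)) = op_chain p ?k f i (c i)"
    "chain_boundary (Suc ?k) (c' (Suc i)) = op_chain p ?k f i (c' i)"
    using c c' Suc.prems by (simp_all add: resolution_def)
  then have "chain_boundary (Suc ?k) ?e = 0"
    using e(2) chain_boundary_op[OF b(1), of p f i] b(2) by (simp add: chain_boundary_diff)
  then have "singular_relcycle (Suc ?k) Y {} ?e"
    using cs singular_chain_op[OF b(1) f(1)] by (simp add: singular_cycle singular_chain_diff)
  moreover have "op_chain p (Suc ?k) f (Suc i) (op_chain p (Suc ?k) f i b) = 0"
    using op_chain_op_chain[OF b(1) f(2) f(1)] .
  ultimately show ?case
    by (intro exI[of _ ?e]) (simp add: op_chain_diff)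
qed

text \<open>Every power of \<open>f\<close> is homotopic to the identity, so each of the
  \<open>p\<close> summands is homologous to \<open>e\<close>.\<close>

lemma norm_op_homologous:
  assumes f: "homotopic_with (\<lambda>_. True) Y Y id f" and e: "singular_relcycle k Y {} e"
  obtains b where "singular_chain (Suc k) Y b" "norm_op p k f e = frag_cmul (int p) e + chain_boundary (Suc k) b"
proof -
  have fc: "continuous_map Y Y f" using homotopic_with_imp_continuous_maps[OF f] by blast
  have es: "singular_chain k Y e" using e by (simp add: singular_cycle)
  have "homotopic_with (\<lambda>_. True) Y Y id (f ^^ j)" for j
  proof (induction j)
    case (Suc j)
    have "homotopic_with (\<lambda>_. True) Y Y (f \<circ> id) (f \<circ> (f ^^ j))"
      by (rule homotopic_with_compose_continuous_map_left[OF Suc fc]) auto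
    then have "homotopic_with (\<lambda>_. True) Y Y f (f ^^ Suc j)" by simp
    then show ?case using f homotopic_with_trans by blast
  qed (simp add: id_def)
  then have "hom_induced (int k) Y {} Y {} id = hom_induced (int k) Y {} Y {} (f ^^ j)" for j
    by (rule homology_homotopy_empty)
  then have "homologous_rel_set k Y {} (chain_map k id e) = homologous_rel_set k Y {} (chain_map k (f ^^ j) e)" for j
    using hom_induced_chain_map[OF _ _ e, of Y id "{}"] hom_induced_chain_map[OF continuous_map_funpow[OF fc, of j] _ e, of "{}"]
    by simp
  then have "homologous_rel k Y {} (chain_map k (f ^^ j) e) e" for j
    using chain_map_ident[OF es] by (metis homologous_rel_refl mem_Collect_eq)
  then have "\<exists>b. singular_chain (Suc k) Y b \<and> chain_boundary (Suc k) b = chain_map k (f ^^ j) e - e" for j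
    unfolding homologous_rel_def singular_boundary by blast
  then obtain b where b: "\<And>j. singular_chain (Suc k) Y (b j)" "\<And>j. chain_boundary (Suc k) (b j) = chain_map k (f ^^ j) e - e"
    by metis
  show thesis
  proof
    show "singular_chain (Suc k) Y (\<Sum>j<p. b j)" using b by (intro singular_chain_sum)
    have "(\<Sum>j<p. e) = frag_cmul (int p) e"
      by (induction p) (simp_all add: frag_cmul_distrib)
    then show "norm_op p k f e = frag_cmul (int p) e + chain_boundary (Suc k) (\<Sum>j<p. b j)"
      by (simp add: norm_op_def chain_boundary_sum o_def b sum_subtractf)
  qed
qed

text \<open>A free-resolution argument: chains in \<open>X\<close> bounding the image of the fundamental cycle are pushed to
  a sphere with a linear action and compared with an explicit resolution there.\<close>

lemma no_equivariant_map:
  fixes p d q :: nat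
  defines "g \<equiv> rot d (2 * pi / real p)"
  assumes p: "2 \<le> p" and q: "0 < q" and X: "contractible_space X"
    and f: "continuous_map X X f" "\<And>x. x \<in> topspace X \<Longrightarrow> (f ^^ p) x = x"
    and \<Phi>: "continuous_map X (nsphere (d + 2 * q)) \<Phi>" "\<And>x. x \<in> topspace X \<Longrightarrow> \<Phi> (f x) = g (\<Phi> x)"
    and s: "continuous_map (nsphere d) X s" "\<And>v. v \<in> topspace (nsphere d) \<Longrightarrow> f (s v) = s v"
    and hom: "homotopic_with (\<lambda>_. True) (nsphere d) (nsphere d) (\<Phi> \<circ> s) id"
  shows False
proof -
  let ?S = "nsphere (d + 2 * q)"
  obtain z where z: "red_cycle d (nsphere d) z" "\<not> divisible_class p d (nsphere d) z"
    using sphere_generator[of p d] p by auto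
  have zs: "singular_chain d (nsphere d) z" using z(1) red_cycle_singular by blast
  define zX where "zX = chain_map d s z"
  have zX: "red_cycle d X zX" unfolding zX_def using red_cycle_chain_map[OF z(1) s(1)] .
  have "chain_map d (f \<circ> s) z = chain_map d s z" by (rule chain_map_eq[OF zs]) (use s in auto)
  then have fzX: "chain_map d f zX = zX" by (simp add: zX_def chain_map_compose)
  obtain c where c: "\<And>m. resolution p d f X zX c m" using resolution_exists[OF X f zX fzX] by blast
  \<comment> \<open>The pushed-forward fundamental cycle. It is homologous to \<open>z\<close> by
    the homotopy hypothesis, hence indivisible, and \<open>g\<close> fixes it because it lies in the
    fixed sphere.\<close>
  define z0 where "z0 = chain_map d (\<Phi> \<circ> s) z"
  have \<kappa>: "continuous_map (nsphere d) (nsphere d) (\<Phi> \<circ> s)" using homotopic_with_imp_continuous_maps[OF hom] by blast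
  have z0: "red_cycle d (nsphere d) z0" unfolding z0_def using red_cycle_chain_map[OF z(1) \<kappa>] .
  have zc: "singular_relcycle d (nsphere d) {} z" using z(1) by (simp add: red_cycle_def)
  have "homologous_rel_set d (nsphere d) {} z0 = homologous_rel_set d (nsphere d) {} (chain_map d id z)"
    unfolding z0_def using hom_induced_chain_map[OF \<kappa> _ zc, of "{}"] hom_induced_chain_map[OF _ _ zc, of "nsphere d" id "{}"]
      homology_homotopy_empty[OF hom, of "int d"] by simp
  then have nd0: "\<not> divisible_class p d (nsphere d) z0"
    using z(2) chain_map_ident[OF zs] by (simp add: divisible_class_def)
  have "g x = x" if "x \<in> topspace (nsphere d)" for x
  proof
    fix i
    have x: "x m = 0" if "d < m" for m using \<open>x \<in> topspace (nsphere d)\<close> that by (simp add: nsphere)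
    have "odd (i - d) \<or> d < i - 1" if "d < i" using that by (cases "i = Suc d") auto
    then show "g x i = x i" using x[of i] x[of "Suc i"] x[of "i - 1"] by (auto simp: g_def rot_def)
  qed
  then have gz0: "chain_map d g z0 = z0" using chain_map_id_gen[OF red_cycle_singular[OF z0]] by blast
  obtain D where D: "resolution p d g ?S z0 D (2 * q)"
    "\<not> divisible_class p (d + 2 * q) ?S (norm_op p (d + 2 * q) g (D (2 * q - 1)))"
    using sphere_resolution[OF p z0 nd0, of q] gz0 q unfolding g_def by auto
  define C where "C = (\<lambda>i. chain_map (Suc (d + i)) \<Phi> (c i))"
  have cs: "singular_chain (Suc (d + i)) X (c i)" for i using c[of "Suc i"] by (simp add: resolution_def)
  have op: "chain_map k \<Phi> (op_chain p k f i b) = op_chain p k g i (chain_map k \<Phi> b)" if "singular_chain k X b" for k i b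
  proof (cases "even i")
    case True
    have "chain_map k (\<Phi> \<circ> f) b = chain_map k (g \<circ> \<Phi>) b"
      by (rule chain_map_eq[OF that]) (use \<Phi> in auto)
    then show ?thesis using True by (simp add: op_chain_def chain_map_diff chain_map_compose)
  next
    case False
    then show ?thesis using chain_map_norm_op_equivariant[where h=\<Phi> and f=f and g=g, OF that \<Phi>(2) f(1)] by (simp add: op_chain_def)
  qed
  have Cb: "chain_boundary (Suc (Suc (d + i))) (C (Suc i)) = op_chain p (Suc (d + i)) g i (C i)" for i
  proof -
    have "chain_boundary (Suc (Suc (d + i))) (c (Suc i)) = op_chain p (Suc (d + i)) f i (c i)"
      using c[of "Suc (Suc i)"] by (simp add: resolution_def)
    then show ?thesis using chain_boundary_chain_map[OF cs[of "Suc i"], of \<Phi>] op[OF cs] by (simp add: C_def)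
  qed
  have "chain_boundary (Suc d) (C 0) = z0"
    using chain_boundary_chain_map[OF cs[of 0], of \<Phi>] c[of 1]
    by (simp add: C_def z0_def resolution_def zX_def chain_map_compose)
  moreover have Cs: "singular_chain (Suc (d + i)) ?S (C i)" for i
    unfolding C_def using singular_chain_chain_map[OF cs \<Phi>(1)] .
  ultimately have C: "resolution p d g ?S z0 C (2 * q)" using Cb by (simp add: resolution_def)
  have gc: "continuous_map ?S ?S g" unfolding g_def by (rule continuous_map_rot)
  have gp: "(g ^^ p) x = x" for x unfolding g_def rot_funpow using p by simp
  \<comment> \<open>The last stage that both systems have. The system coming from \<open>X\<close>
    continues with one more chain, which makes the norm of \<open>C i\<close> a boundary; the
    explicit system stops here with an indivisible norm.\<close>
  define i where "i = 2 * q - 1"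
  have i: "i < 2 * q" "odd i" "Suc (d + i) = d + 2 * q" using q by (auto simp: i_def)
  have "trivial_group (reduced_homology_group (int (Suc (d + j))) ?S)" if "Suc j < 2 * q" for j
    by (rule reduced_homology_group_nsphere(2)) (use that in simp)
  from resolution_compare[OF C D(1) gc gp this i(1)]
  obtain e where e: "singular_relcycle (d + 2 * q) ?S {} e"
    "norm_op p (d + 2 * q) g (C i) - norm_op p (d + 2 * q) g (D i) = norm_op p (d + 2 * q) g e"
    using i by (auto simp: op_chain_def)
  have "homotopic_with (\<lambda>_. True) ?S ?S id g" unfolding g_def by (rule rot_homotopic_id)
  from norm_op_homologous[OF this e(1), of p]
  obtain b where b: "singular_chain (Suc (d + 2 * q)) ?S b"
    "norm_op p (d + 2 * q) g e = frag_cmul (int p) e + chain_boundary (Suc (d + 2 * q)) b" by blast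
  have "norm_op p (d + 2 * q) g (C i) = chain_boundary (Suc (d + 2 * q)) (C (Suc i))"
    using Cb[of i] i by (simp add: op_chain_def)
  then have "norm_op p (d + 2 * q) g (D i) = chain_boundary (Suc (d + 2 * q)) (C (Suc i)) - (frag_cmul (int p) e + chain_boundary (Suc (d + 2 * q)) b)"
    using e(2) b(2) by (simp add: algebra_simps)
  then have eq: "norm_op p (d + 2 * q) g (D i) = chain_boundary (Suc (d + 2 * q)) (C (Suc i)) - (frag_cmul (int p) e + chain_boundary (Suc (d + 2 * q)) b)" .
  have eq': "norm_op p (d + 2 * q) g (D i) = frag_cmul (int p) (- e) + chain_boundary (Suc (d + 2 * q)) (C (Suc i) - b)"
  proof -
    have neg: "frag_cmul (int p) (- e) = - frag_cmul (int p) e"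
      by (metis frag_cmul_cmul frag_cmul_minus_one mult.commute)
    have "x - (y + w) = - y + (x - w)" for x y w :: "(nat \<Rightarrow> real) chain" by (simp add: algebra_simps)
    then show ?thesis unfolding neg chain_boundary_diff eq .
  qed
  have "divisible_class p (d + 2 * q) ?S (norm_op p (d + 2 * q) g (D i))"
  proof (rule divisible_classI[OF _ _ _ eq'])
    show "singular_chain (Suc (d + 2 * q)) ?S (C (Suc i) - b)"
      using Cs[of "Suc i"] b(1) i by (intro singular_chain_diff) simp_all
  qed (use q e in \<open>auto simp: singular_relcycle_minus\<close>)
  then show False using D(2) by (simp add: i_def)
qed

section \<open>Fourier coefficients of an orbit and the equivariant map\<close>

lemma roots_of_unity_sum:
  fixes p :: nat and m :: int
  assumes "0 < p" "\<bar>m\<bar> < int p" "m \<noteq> 0"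
  shows "(\<Sum>a<p. cis (2 * pi * of_int m / real p) ^ a) = 0"
proof -
  let ?w = "cis (2 * pi * of_int m / real p)"
  have "?w \<noteq> 1"
  proof
    assume "?w = 1"
    then have "cos (2 * pi * of_int m / real p) = 1" by (metis cis.sel(1) one_complex.sel(1))
    then obtain n :: int where "2 * pi * of_int m / real p = of_int n * 2 * pi" using cos_one_2pi_int by auto
    then have "of_int m = of_int n * real p" using assms(1) by (simp add: field_simps)
    then have m: "m = n * int p" by (metis of_int_eq_iff of_int_mult of_int_of_nat_eq)
    then have "n \<noteq> 0" using assms(3) by auto
    then have "1 \<le> \<bar>n\<bar>" by linarith
    then have "int p \<le> \<bar>n\<bar> * int p" using mult_right_mono[of 1 "\<bar>n\<bar>" "int p"] by simp
    then show False using m assms(2) by (simp add: abs_mult)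
  qed
  moreover have "?w ^ p = 1"
  proof -
    have eq: "real p * (2 * pi * of_int m / real p) = 2 * pi * of_int m" using assms(1) by simp
    have "?w ^ p = cis (real p * (2 * pi * of_int m / real p))" by (rule Complex.DeMoivre)
    also have "\<dots> = 1" unfolding eq by (rule cis_multiple_2pi) simp
    finally show ?thesis .
  qed
  ultimately show ?thesis by (simp add: geometric_sum)
qed

text \<open>Fourier inversion: summing the coefficients against the characters recovers
  \<open>p\<close> times the entry \<open>t k\<close>, and only frequency 0, the plain sum,
  contributes.\<close>

lemma dft_constant:
  fixes t :: "nat \<Rightarrow> real"
  assumes p: "0 < p" and z: "\<And>a. 1 \<le> a \<Longrightarrow> a < p \<Longrightarrow> (\<Sum>i<p. cis (- 2 * pi * real i / real p) ^ a * of_real (t i)) = 0"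
    and k: "k < p"
  shows "real p * t k = (\<Sum>i<p. t i)"
proof -
  let ?z = "\<lambda>m::int. cis (2 * pi * of_int m / real p)"
  have "(\<Sum>a<p. ?z (int k) ^ a * (\<Sum>i<p. cis (- 2 * pi * real i / real p) ^ a * of_real (t i)))
    = (\<Sum>a\<in>{0}. ?z (int k) ^ a * (\<Sum>i<p. cis (- 2 * pi * real i / real p) ^ a * of_real (t i)))"
    by (rule sum.mono_neutral_right) (use p z in auto)
  also have "\<dots> = of_real (\<Sum>i<p. t i)" by simp
  also have "(\<Sum>a<p. ?z (int k) ^ a * (\<Sum>i<p. cis (- 2 * pi * real i / real p) ^ a * of_real (t i)))
    = (\<Sum>a<p. \<Sum>i<p. ?z (int k - int i) ^ a * of_real (t i))"
    unfolding sum_distrib_left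
  proof (intro sum.cong refl)
    fix a i
    have "?z (int k) * cis (- 2 * pi * real i / real p) = ?z (int k - int i)"
      by (simp add: cis_mult diff_divide_distrib right_diff_distrib)
    then show "?z (int k) ^ a * (cis (- 2 * pi * real i / real p) ^ a * of_real (t i)) = ?z (int k - int i) ^ a * of_real (t i)"
      by (simp only: mult.assoc[symmetric] power_mult_distrib[symmetric])
  qed
  also have "\<dots> = (\<Sum>i<p. (\<Sum>a<p. ?z (int k - int i) ^ a) * of_real (t i))"
    by (subst sum.swap) (simp add: sum_distrib_right)
  also have "\<dots> = (\<Sum>i\<in>{k}. (\<Sum>a<p. ?z (int k - int i) ^ a) * of_real (t i))"
  proof (rule sum.mono_neutral_right)
    show "\<forall>i\<in>{..<p} - {k}. (\<Sum>a<p. ?z (int k - int i) ^ a) * of_real (t i) = 0"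
    proof
      fix i assume "i \<in> {..<p} - {k}"
      then have "(\<Sum>a<p. ?z (int k - int i) ^ a) = 0" using k by (intro roots_of_unity_sum p) auto
      then show "(\<Sum>a<p. ?z (int k - int i) ^ a) * of_real (t i) = 0" by simp
    qed
  qed (use k in auto)
  also have "\<dots> = of_real (real p * t k)" by simp
  finally show ?thesis by (metis of_real_eq_iff)
qed

lemma continuous_map_complex_mult:
  fixes f g :: "'a \<Rightarrow> complex"
  assumes "continuous_map X euclidean f" "continuous_map X euclidean g"
  shows "continuous_map X euclidean (\<lambda>x. f x * g x)"
  using assms unfolding continuous_map_atin limitin_canonical_iff by (auto intro: tendsto_mult)

lemma continuous_map_complex_power:
  fixes f :: "'a \<Rightarrow> complex"
  assumes "continuous_map X euclidean f"
  shows "continuous_map X euclidean (\<lambda>x. f x ^ n)"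
  by (induction n) (auto intro: continuous_map_complex_mult assms)

lemma continuous_map_Euclidean_space_projection: "continuous_map (Euclidean_space n) euclideanreal (\<lambda>x. x i)"
  unfolding Euclidean_space_def
  by (blast intro: continuous_map_from_subtopology [OF continuous_map_product_projection])

lemma nrm_rot:
  "nrm (d + 2 * q) (rot d \<theta> x) = rot d \<theta> (nrm (d + 2 * q) x)"
  unfolding nrm_def sum_squares_rot by (auto simp: rot_def fun_eq_iff algebra_simps diff_divide_distrib add_divide_distrib)

lemma sum_cyclic_shift:
  fixes F :: "nat \<Rightarrow> 'a::ab_group_add"
  assumes "F p = F 0"
  shows "(\<Sum>i<p. F (Suc i)) = (\<Sum>i<p. F i)"
  using sum.lessThan_Suc_shift[of F p] assms by simp

text \<open>If all nonconstant Fourier coefficients of an orbit vanish, the orbit is one fixed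
  point, which is also its average and therefore differs from the moved point \<open>y\<close>. So
  the coefficients and the average minus \<open>y\<close> never vanish together, and normalizing
  them gives the equivariant map excluded above. The homotopy hypothesis says that \<open>s\<close>
  winds once around \<open>y\<close>.\<close>

theorem prime_period_trivial:
  fixes p d :: nat
  assumes p: "prime p" and X: "contractible_space X"
    and f: "continuous_map X X f" "\<And>x. x \<in> topspace X \<Longrightarrow> (f ^^ p) x = x"
    and \<iota>: "continuous_map X (Euclidean_space (Suc d)) \<iota>" "inj_on \<iota> (topspace X)"
    and s: "continuous_map (nsphere d) X s" "\<And>v. v \<in> topspace (nsphere d) \<Longrightarrow> f (s v) = s v"
    and y: "y \<in> topspace X" "f y \<noteq> y"
    and hom: "homotopic_with (\<lambda>_. True) (nsphere d) (nsphere d) (\<lambda>v. nrm d (\<lambda>i. \<iota> (s v) i - \<iota> y i)) id"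
  shows False
proof -
  have p2: "2 \<le> p" using p prime_ge_2_nat by blast
  \<comment> \<open>The Fourier coefficient at frequency \<open>a\<close> of coordinate
    \<open>l\<close> along the orbit of \<open>x\<close>; applying \<open>f\<close> multiplies it by
    the a-th power of \<open>\<zeta>\<close>.\<close>
  define T where "T = (\<lambda>a l x. \<Sum>i<p. cis (- 2 * pi * real i / real p) ^ a * complex_of_real (\<iota> ((f ^^ i) x) l))"
  \<comment> \<open>Raising the coefficient at frequency \<open>a\<close> to the power
    \<open>b a\<close>, an inverse modulo \<open>p\<close>, makes \<open>f\<close> act on all of
    them by the same factor \<open>\<zeta>\<close>.\<close>
  have "\<exists>b. [a * b = 1] (mod p)" if "a \<in> {1..<p}" for a
  proof -
    have "coprime a p" using p that by (metis atLeastLessThan_iff coprime_commute nat_dvd_not_less less_le_trans prime_imp_coprime zero_less_one)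
    then show ?thesis using cong_solve_coprime_nat by auto
  qed
  then obtain b where b: "\<And>a. a \<in> {1..<p} \<Longrightarrow> [a * b a = 1] (mod p)" by metis
  \<comment> \<open>One complex coordinate for each nonzero frequency and each of the
    \<open>d + 1\<close> real coordinates.\<close>
  define q where "q = Suc d * (p - 1)"
  have q: "0 < q" using p2 by (simp add: q_def)
  \<comment> \<open>\<open>m\<close> encodes a frequency (remainder plus 1) and a coordinate
    (quotient).\<close>
  define h where "h = (\<lambda>m x. T (m mod (p - 1) + 1) (m div (p - 1)) x ^ b (m mod (p - 1) + 1))"
  have am: "m mod (p - 1) + 1 \<in> {1..<p}" for m
  proof -
    have "m mod (p - 1) < p - 1" using p2 by (intro mod_less_divisor) simp
    then show ?thesis unfolding atLeastLessThan_iff by linarith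
  qed
  define \<zeta> where "\<zeta> = cis (2 * pi / real p)"
  have fX: "(f ^^ i) x \<in> topspace X" if "x \<in> topspace X" for x i
    using continuous_map_funpow[OF f(1), of i] that by (meson continuous_map_image_subset_topspace image_subset_iff)
  have w: "cis (- 2 * pi * real (Suc i) / real p) * \<zeta> = cis (- 2 * pi * real i / real p)" for i
    unfolding \<zeta>_def cis_mult by (rule arg_cong[where f = cis]) (use p2 in \<open>simp add: field_simps\<close>)
  have Tf: "T a l (f x) = \<zeta> ^ a * T a l x" if "x \<in> topspace X" for a l x
  proof -
    let ?F = "\<lambda>i. cis (- 2 * pi * real i / real p) ^ a * complex_of_real (\<iota> ((f ^^ i) x) l)"
    have "cis (- 2 * pi * real p / real p) = 1" using p2 by (simp add: complex_eq_iff)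
    then have F: "?F p = ?F 0" using f(2)[OF that] by simp
    have "T a l (f x) = (\<Sum>i<p. \<zeta> ^ a * ?F (Suc i))"
      unfolding T_def
    proof (rule sum.cong)
      fix i
      show "cis (- 2 * pi * real i / real p) ^ a * complex_of_real (\<iota> ((f ^^ i) (f x)) l) = \<zeta> ^ a * ?F (Suc i)"
        unfolding w[of i, symmetric] by (simp add: power_mult_distrib funpow_swap1 mult_ac)
    qed simp
    also have "\<dots> = \<zeta> ^ a * T a l x"
      unfolding sum_distrib_left[symmetric] using sum_cyclic_shift[of ?F, OF F] by (simp add: T_def)
    finally show ?thesis .
  qed
  have \<zeta>p: "\<zeta> ^ p = 1" unfolding \<zeta>_def using p2 by (simp add: Complex.DeMoivre)
  have hf: "h m (f x) = \<zeta> * h m x" if "x \<in> topspace X" for m x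
  proof -
    let ?a = "m mod (p - 1) + 1"
    have "(?a * b ?a) mod p = 1" using b[OF am[of m]] p2 by (simp add: cong_def)
    then obtain c where "?a * b ?a = 1 + p * c" by (metis mod_div_mult_eq mult.commute)
    then have "\<zeta> ^ (?a * b ?a) = \<zeta>" using \<zeta>p by (simp add: power_add power_mult)
    then show ?thesis unfolding h_def Tf[OF that] power_mult_distrib power_mult[symmetric] by (simp only:)
  qed
  \<comment> \<open>The centred average fills the fixed coordinates of \<open>rot\<close>; real and
    imaginary parts of \<open>h\<close> fill the pairs that it turns.\<close>
  define R where "R = (\<lambda>x i. if i \<le> d then (\<Sum>k<p. \<iota> ((f ^^ k) x) i) / real p - \<iota> y i
     else if d + 2 * q < i then 0
     else if odd (i - d) then Re (h ((i - d - 1) div 2) x) else Im (h ((i - d - 1) div 2) x))"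
  have Rf: "R (f x) = rot d (2 * pi / real p) (R x)" if x: "x \<in> topspace X" for x
  proof
    fix i
    have \<zeta>: "Re \<zeta> = cos (2 * pi / real p)" "Im \<zeta> = sin (2 * pi / real p)" by (simp_all add: \<zeta>_def)
    consider "i \<le> d" | m where "i = Suc (d + 2 * m)" | m where "i = Suc (Suc (d + 2 * m))"
    proof (cases "i \<le> d")
      case False
      then obtain m where m: "i = Suc (d + m)" using less_imp_Suc_add by fastforce
      show ?thesis
      proof (cases "even m")
        case True
        then show ?thesis using m that(2) by (auto elim!: evenE)
      next
        case False
        then show ?thesis using m that(3) by (auto elim!: oddE)
      qed
    qed
    moreover have [simp]: "2 * q < Suc (2 * m) \<longleftrightarrow> q \<le> m" "2 * q < Suc (Suc (2 * m)) \<longleftrightarrow> q \<le> m" for m by presburger+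
    ultimately show "R (f x) i = rot d (2 * pi / real p) (R x) i"
    proof cases
      case 1
      have "(\<Sum>k<p. \<iota> ((f ^^ Suc k) x) i) = (\<Sum>k<p. \<iota> ((f ^^ k) x) i)"
        by (rule sum_cyclic_shift) (simp add: f(2)[OF x])
      then show ?thesis using 1 by (simp add: R_def rot_def funpow_swap1)
    next
      case 2
      then show ?thesis by (auto simp: R_def rot_def hf[OF x] \<zeta>)
    next
      case 3
      then show ?thesis by (auto simp: R_def rot_def hf[OF x] \<zeta>)
    qed
  qed
  have \<iota>c: "continuous_map X euclideanreal (\<lambda>x. \<iota> ((f ^^ k) x) l)" for k l
  proof -
    have "continuous_map (Euclidean_space (Suc d)) euclideanreal (\<lambda>x. x l)"
      by (rule continuous_map_Euclidean_space_projection)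
    from continuous_map_compose[OF continuous_map_compose[OF continuous_map_funpow[OF f(1)] \<iota>(1)] this]
    show ?thesis by (simp add: o_def)
  qed
  have Tc: "continuous_map X euclidean (T a l)" for a l
  proof -
    have "continuous_map X euclidean (\<lambda>x. complex_of_real (\<iota> ((f ^^ i) x) l))" for i
      using continuous_map_compose[OF \<iota>c, of euclidean complex_of_real] by (simp add: o_def continuous_on_of_real)
    then show ?thesis unfolding T_def by (intro continuous_map_sum continuous_map_complex_mult) auto
  qed
  have hc: "continuous_map X euclidean (h m)" for m
    unfolding h_def by (intro continuous_map_complex_power Tc)
  have Rc: "continuous_map X euclideanreal (\<lambda>x. R x i)" for i
  proof -
    have 1: "continuous_map X euclideanreal (\<lambda>x. Re (h m x))" "continuous_map X euclideanreal (\<lambda>x. Im (h m x))" for m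
      using continuous_map_compose[OF hc, of euclideanreal Re] continuous_map_compose[OF hc, of euclideanreal Im]
      by (simp_all add: o_def continuous_on_Re continuous_on_Im)
    have 2: "continuous_map X euclideanreal (\<lambda>x. (\<Sum>k<p. \<iota> ((f ^^ k) x) i) / real p - \<iota> y i)"
      by (intro continuous_intros \<iota>c) (use p2 in auto)
    show ?thesis unfolding R_def by (cases "i \<le> d"; cases "d + 2 * q < i"; cases "odd (i - d)") (simp_all add: 1 2)
  qed
  have \<iota>0: "\<iota> x l = 0" if "x \<in> topspace X" "d < l" for x l
    using continuous_map_image_subset_topspace[OF \<iota>(1)] that by (auto simp: topspace_Euclidean_space)
  have nz: "\<exists>i\<le>d + 2 * q. R x i \<noteq> 0" if x: "x \<in> topspace X" for x
  proof (rule ccontr)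
    assume "\<not> (\<exists>i\<le>d + 2 * q. R x i \<noteq> 0)"
    then have R0: "R x i = 0" if "i \<le> d + 2 * q" for i using that by blast
    have h0: "h m x = 0" if "m < q" for m
    proof (rule complex_eqI)
      show "Re (h m x) = Re 0" using R0[of "Suc (d + 2 * m)"] that by (simp add: R_def)
      show "Im (h m x) = Im 0" using R0[of "Suc (Suc (d + 2 * m))"] that by (simp add: R_def)
    qed
    have T0: "T a l x = 0" if a: "1 \<le> a" "a < p" and l: "l \<le> d" for a l
    proof -
      define m where "m = l * (p - 1) + (a - 1)"
      have m1: "m mod (p - 1) = a - 1" "m div (p - 1) = l"       proof -
        have "a - 1 < p - 1" "p - 1 \<noteq> 0" using a by auto
        then show "m mod (p - 1) = a - 1" "m div (p - 1) = l"
          unfolding m_def by (simp_all only: mod_mult_self3 div_mult_self3 mod_less div_less add_0_right not_False_eq_True)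
      qed
      have "m < l * (p - 1) + (p - 1)" using a by (simp add: m_def)
      also have "\<dots> \<le> q" using mult_le_mono1[of "Suc l" "Suc d" "p - 1"] l by (simp add: q_def)
      finally have "h m x = 0" by (rule h0)
      then show ?thesis using a m1 by (simp add: h_def)
    qed
    have const: "real p * \<iota> ((f ^^ k) x) l = (\<Sum>i<p. \<iota> ((f ^^ i) x) l)" if "k < p" "l \<le> d" for k l
      by (rule dft_constant) (use p2 that T0[of _ l] in \<open>auto simp: T_def\<close>)
    have "\<iota> (f x) l = \<iota> x l" for l
    proof (cases "l \<le> d")
      case True
      then have "real p * \<iota> (f x) l = real p * \<iota> x l" using const[of 0 l] const[of 1 l] p2 by simp
      then show ?thesis using p2 by simp
    next
      case False
      then show ?thesis using \<iota>0[OF x] \<iota>0[OF fX[OF x, of 1]] by simp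
    qed
    then have "\<iota> (f x) = \<iota> x" by blast
    then have fx: "f x = x" using inj_onD[OF \<iota>(2)] x fX[OF x, of 1] by simp
    have "\<iota> x l = \<iota> y l" for l
    proof (cases "l \<le> d")
      case True
      have "R x l = 0" using R0 True by simp
      then show ?thesis using True const[of 0 l] p2 by (simp add: R_def field_simps)
    next
      case False
      then show ?thesis using \<iota>0[OF x] \<iota>0[OF y(1)] by simp
    qed
    then have "\<iota> x = \<iota> y" by blast
    then have "x = y" using inj_onD[OF \<iota>(2)] x y(1) by blast
    then show False using fx y(2) by simp
  qed
  define \<Phi> where "\<Phi> = (\<lambda>x. nrm (d + 2 * q) (R x))"
  have \<Phi>c: "continuous_map X (nsphere (d + 2 * q)) \<Phi>"
    unfolding \<Phi>_def by (rule continuous_map_nrm) (use Rc nz in \<open>auto simp: R_def\<close>)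
  have \<Phi>f: "\<Phi> (f x) = rot d (2 * pi / real p) (\<Phi> x)" if "x \<in> topspace X" for x
    unfolding \<Phi>_def Rf[OF that] by (rule nrm_rot)
  have \<Phi>s: "nrm d (\<lambda>i. \<iota> (s v) i - \<iota> y i) = (\<Phi> \<circ> s) v" if v: "v \<in> topspace (nsphere d)" for v
  proof -
    have sv: "s v \<in> topspace X" using continuous_map_image_subset_topspace[OF s(1)] v by blast
    have fs: "(f ^^ i) (s v) = s v" for i by (induction i) (simp_all add: s(2)[OF v])
    have "h m (s v) = 0" for m
    proof -
      let ?a = "m mod (p - 1) + 1"
      have "(?a * b ?a) mod p = 1" using b[OF am[of m]] p2 by (simp add: cong_def)
      \<comment> \<open>A zero exponent would turn the vanishing coefficient into 1.\<close>
      then have "b ?a \<noteq> 0" by (metis mod_0 mult_0_right zero_neq_one)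
      have "cis (- 2 * pi * real i / real p) ^ ?a = cis (2 * pi * of_int (- int ?a) / real p) ^ i" for i
      proof -
        have "real c * (- 2 * pi * real i / real p) = real i * (2 * pi * of_int (- int c) / real p)" for c by simp
        then show ?thesis by (simp only: Complex.DeMoivre)
      qed
      then have "(\<Sum>i<p. cis (- 2 * pi * real i / real p) ^ ?a) = (\<Sum>i<p. cis (2 * pi * of_int (- int ?a) / real p) ^ i)"
        by (intro sum.cong refl)
      also have "\<dots> = 0" using am[of m] p2 by (intro roots_of_unity_sum) (simp_all add: abs_minus_cancel)
      finally have "T ?a l (s v) = 0" for l
        unfolding T_def fs sum_distrib_right[symmetric] by simp
      then show ?thesis using \<open>b ?a \<noteq> 0\<close> by (simp add: h_def)
    qed
    then have R: "R (s v) = (\<lambda>i. \<iota> (s v) i - \<iota> y i)"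
      using p2 \<iota>0[OF sv] \<iota>0[OF y(1)] by (auto simp: R_def fs fun_eq_iff)
    have "(\<Sum>j\<le>d + 2 * q. (R (s v) j)\<^sup>2) = (\<Sum>j\<le>d. (R (s v) j)\<^sup>2)"
      by (rule sum.mono_neutral_right) (use R \<iota>0[OF sv] \<iota>0[OF y(1)] in auto)
    then show ?thesis by (simp add: \<Phi>_def nrm_def R)
  qed
  have "homotopic_with (\<lambda>_. True) (nsphere d) (nsphere d) (\<Phi> \<circ> s) id"
    by (rule homotopic_with_eq[OF hom]) (use \<Phi>s in auto)
  from no_equivariant_map[OF p2 q X f \<Phi>c \<Phi>f s this] show False .
qed

text \<open>A moved \<open>y\<close> satisfies \<open>N y < 1\<close>, since the boundary
  \<open>N x = 1\<close> is fixed. The boundary is parametrized by \<open>v / N v\<close>. Shrinking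
  \<open>y\<close> to the origin never meets it, because \<open>N\<close> is homogeneous, so the
  boundary winds once around \<open>y\<close>. Gauges cover both the symmetric cube and the
  asymmetric double of the corner cube.\<close>

theorem gauge_ball_periodic_trivial:
  fixes p d :: nat and N :: "(nat \<Rightarrow> real) \<Rightarrow> real"
  defines "E \<equiv> Euclidean_space (Suc d)"
  defines "X \<equiv> subtopology E {x. N x \<le> 1}"
  assumes p: "prime p" and Nc: "continuous_map E euclideanreal N"
    and Nh: "\<And>x c. x \<in> topspace E \<Longrightarrow> 0 \<le> c \<Longrightarrow> N (\<lambda>i. c * x i) = c * N x"
    and Np: "\<And>x i. x \<in> topspace E \<Longrightarrow> x i \<noteq> 0 \<Longrightarrow> 0 < N x"
    and H: "continuous_map X X H" "\<And>x. x \<in> topspace X \<Longrightarrow> (H ^^ p) x = x"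
    and fx: "\<And>x. x \<in> topspace X \<Longrightarrow> N x = 1 \<Longrightarrow> H x = x"
    and y: "y \<in> topspace X"
  shows "H y = y"
proof (rule ccontr)
  assume yH: "H y \<noteq> y"
  have E: "topspace E = {x. \<forall>i\<ge>Suc d. x i = 0}" by (simp add: E_def topspace_Euclidean_space)
  have X: "topspace X = {x \<in> topspace E. N x \<le> 1}" by (auto simp: X_def)
  have scale: "(\<lambda>i. c * x i) \<in> topspace E" if "x \<in> topspace E" for c x using that by (simp add: E)
  have N0: "0 \<le> N x" if "x \<in> topspace E" for x
  proof (cases "\<exists>i. x i \<noteq> 0")
    case True
    then show ?thesis using Np[OF that] by (auto intro: less_imp_le)
  next
    case False
    then have "(\<lambda>i. 0 * x i) = x" by auto
    then show ?thesis using Nh[OF that, of 0] by simp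
  qed
  have proj: "continuous_map Z euclideanreal (\<lambda>z. F z i)" if "continuous_map Z E F" for Z F i
  proof -
    have "continuous_map E euclideanreal (\<lambda>x. x i)"
      unfolding E_def by (rule continuous_map_Euclidean_space_projection)
    from continuous_map_compose[OF that this] show ?thesis by (simp add: o_def)
  qed
  have into: "continuous_map Z E F" if "\<And>i. continuous_map Z euclideanreal (\<lambda>z. F z i)"
    "\<And>z i. z \<in> topspace Z \<Longrightarrow> Suc d \<le> i \<Longrightarrow> F z i = 0" for Z :: "'z topology" and F
    using that by (auto simp: E_def Euclidean_space_def continuous_map_in_subtopology continuous_map_componentwise_UNIV)
  have XE: "continuous_map X E id" by (simp add: X_def continuous_map_from_subtopology)
  have contr: "contractible_space X"
  proof -
    let ?P = "prod_topology (top_of_set {0..1::real}) X"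
    let ?h = "\<lambda>z. (\<lambda>i. (1 - fst z) * snd z i)"
    have s: "continuous_map ?P E snd" using continuous_map_compose[OF continuous_map_snd XE] by (simp add: o_def)
    have "continuous_map ?P E ?h"
    proof (rule into)
      show "continuous_map ?P euclideanreal (\<lambda>z. (1 - fst z) * snd z i)" for i
        by (intro continuous_intros proj s continuous_map_into_fulltopology[OF continuous_map_fst])
    qed (auto simp: X E)
    moreover have "N (?h z) \<le> 1" if "z \<in> topspace ?P" for z
    proof -
      have z: "snd z \<in> topspace E" "N (snd z) \<le> 1" "0 \<le> fst z" "fst z \<le> 1" using that by (auto simp: X)
      have "(1 - fst z) * N (snd z) \<le> 1 * 1" using z N0[OF z(1)] by (intro mult_mono) auto
      then show ?thesis using Nh[OF z(1), of "1 - fst z"] z by simp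
    qed
    ultimately have "continuous_map ?P X ?h" by (auto simp: X_def continuous_map_in_subtopology)
    then have "homotopic_with (\<lambda>_. True) X X id (\<lambda>_. \<lambda>i. 0)"
      by (subst homotopic_with, simp, intro exI[of _ ?h]) auto
    then show ?thesis unfolding contractible_space_def by blast
  qed
  have sph: "v \<in> topspace E" "\<exists>i. v i \<noteq> 0" if "v \<in> topspace (nsphere d)" for v
  proof -
    show "v \<in> topspace E" using that by (auto simp: nsphere E)
    show "\<exists>i. v i \<noteq> 0"
    proof (rule ccontr)
      assume "\<not> (\<exists>i. v i \<noteq> 0)"
      then have "(\<Sum>i\<le>d. (v i)\<^sup>2) = 0" by simp
      then show False using that by (simp add: nsphere)
    qed
  qed
  have Nv: "0 < N v" if "v \<in> topspace (nsphere d)" for v using sph[OF that] Np by blast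
  define s where "s = (\<lambda>v i. v i / N v :: real)"
  have s_alt: "s v = (\<lambda>i. inverse (N v) * v i)" for v by (simp add: s_def divide_inverse mult.commute)
  have sN: "s v \<in> topspace E" "N (s v) = 1" if "v \<in> topspace (nsphere d)" for v
    using Nh[OF sph(1)[OF that], of "inverse (N v)"] Nv[OF that] scale[OF sph(1)[OF that]] by (auto simp: s_alt)
  have SE: "continuous_map (nsphere d) E id"
    unfolding E_def nsphere_def by (simp add: continuous_map_from_subtopology)
  have NS: "continuous_map (nsphere d) euclideanreal N" using continuous_map_compose[OF SE Nc] by simp
  have sc: "continuous_map (nsphere d) euclideanreal (\<lambda>v. s v i)" for i
    unfolding s_def by (intro continuous_intros NS continuous_map_nsphere_projection) (use Nv in force)
  have "continuous_map (nsphere d) E s" by (rule into) (use sc sN E in auto)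
  then have sX: "continuous_map (nsphere d) X s" using sN by (auto simp: X_def continuous_map_in_subtopology)
  have yE: "y \<in> topspace E" "N y < 1" using y yH fx[OF y] by (auto simp: X)
  have "homotopic_with (\<lambda>_. True) (nsphere d) (nsphere d) (\<lambda>v. nrm d (\<lambda>i. s v i - y i)) id"
  proof -
    let ?P = "prod_topology (top_of_set {0..1::real}) (nsphere d)"
    let ?h = "\<lambda>z. nrm d (\<lambda>i. s (snd z) i - (1 - fst z) * y i)"
    have "continuous_map ?P (nsphere d) ?h"
    proof (rule continuous_map_nrm)
      fix i
      have "continuous_map ?P euclideanreal (\<lambda>z. s (snd z) i)"
        using continuous_map_compose[OF continuous_map_snd sc] by (simp add: o_def)
      then show "continuous_map ?P euclideanreal (\<lambda>z. s (snd z) i - (1 - fst z) * y i)"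
        by (intro continuous_intros continuous_map_into_fulltopology[OF continuous_map_fst])
    next
      fix z i assume "z \<in> topspace ?P" "d < i"
      then show "s (snd z) i - (1 - fst z) * y i = 0"
        using sN(1)[of "snd z"] yE(1) by (auto simp: E)
    next
      fix z assume z: "z \<in> topspace ?P"
      show "\<exists>i\<le>d. s (snd z) i - (1 - fst z) * y i \<noteq> 0"
      proof (rule ccontr)
        assume 0: "\<not> (\<exists>i\<le>d. s (snd z) i - (1 - fst z) * y i \<noteq> 0)"
        have zs: "snd z \<in> topspace (nsphere d)" "0 \<le> fst z" "fst z \<le> 1" using z by auto
        have "s (snd z) = (\<lambda>i. (1 - fst z) * y i)"
        proof
          fix i show "s (snd z) i = (1 - fst z) * y i"
            using 0 sN(1)[OF zs(1)] yE(1) by (cases "i \<le> d") (auto simp: E)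
        qed
        then have "1 = (1 - fst z) * N y" using sN(2)[OF zs(1)] Nh[OF yE(1), of "1 - fst z"] zs by simp
        moreover have "(1 - fst z) * N y \<le> 1 * N y" using zs N0[OF yE(1)] by (intro mult_right_mono) auto
        ultimately show False using yE(2) by simp
      qed
    qed
    moreover have "nrm d (s v) = v" if "v \<in> topspace (nsphere d)" for v
      unfolding s_alt using nrm_scale[of "inverse (N v)" d v] Nv[OF that] nrm_nsphere[OF that] by simp
    ultimately show ?thesis
      by (subst homotopic_with, simp, intro exI[of _ ?h]) auto
  qed
  then show False
    using prime_period_trivial[OF p contr H, of d id s y] XE sX sN fx y yH unfolding E_def
    by (auto simp: X[unfolded E_def])
qed

section \<open>Cubes as unit balls of gauges\<close>

fun cmax :: "nat \<Rightarrow> (nat \<Rightarrow> real) \<Rightarrow> real" where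
  "cmax 0 s = s 0"
| "cmax (Suc d) s = max (cmax d s) (s (Suc d))"

definition cmin :: "nat \<Rightarrow> (nat \<Rightarrow> real) \<Rightarrow> real" where "cmin d s = - cmax d (\<lambda>k. - s k)"

lemma cmax_le: "cmax d s \<le> c \<longleftrightarrow> (\<forall>k\<le>d. s k \<le> c)"
  by (induction d) (auto simp: le_Suc_eq)

lemma cmax_attained: "\<exists>k\<le>d. cmax d s = s k"
  by (induction d) (auto simp: max_def le_Suc_eq)

lemma cmax_scale: "0 \<le> c \<Longrightarrow> cmax d (\<lambda>k. c * s k) = c * cmax d s"
  by (induction d) (auto simp: max_mult_distrib_left)

lemma cmax_cong: "(\<And>k. k \<le> d \<Longrightarrow> s k = t k) \<Longrightarrow> cmax d s = cmax d t"
  by (induction d) auto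

lemma cmax_add: "cmax d (\<lambda>k. s k + c) = cmax d s + c"
  by (induction d) auto

lemma continuous_map_cmax:
  "(\<And>k. continuous_map X euclideanreal (\<lambda>x. F x k)) \<Longrightarrow> continuous_map X euclideanreal (\<lambda>x. cmax d (F x))"
  by (induction d) (auto intro: continuous_map_real_max)

lemma cmin_ge: "c \<le> cmin d s \<longleftrightarrow> (\<forall>k\<le>d. c \<le> s k)"
proof -
  have "c \<le> cmin d s \<longleftrightarrow> cmax d (\<lambda>k. - s k) \<le> - c" by (auto simp: cmin_def)
  then show ?thesis by (simp add: cmax_le)
qed

lemma cmin_attained: "\<exists>k\<le>d. cmin d s = s k"
  using cmax_attained[of d "\<lambda>k. - s k"] by (auto simp: cmin_def)

lemma cmin_scale: "0 \<le> c \<Longrightarrow> cmin d (\<lambda>k. c * s k) = c * cmin d s"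
  using cmax_scale[of c d "\<lambda>k. - s k"] by (simp add: cmin_def)

lemma cmin_le_cmax: "cmin d s \<le> cmax d s"
  using cmin_attained[of d s] cmax_le[of d s "cmax d s"] by auto

lemma continuous_map_cmin:
  "(\<And>k. continuous_map X euclideanreal (\<lambda>x. F x k)) \<Longrightarrow> continuous_map X euclideanreal (\<lambda>x. cmin d (F x))"
  unfolding cmin_def by (intro continuous_intros continuous_map_cmax)

theorem symmetric_cube_periodic_trivial:
  fixes p d :: nat
  defines "X \<equiv> subtopology (Euclidean_space (Suc d)) {s. \<forall>k\<le>d. \<bar>s k\<bar> \<le> 1}"
  assumes p: "prime p" and H: "continuous_map X X H" "\<And>s. s \<in> topspace X \<Longrightarrow> (H ^^ p) s = s"
    and fx: "\<And>s k. s \<in> topspace X \<Longrightarrow> k \<le> d \<Longrightarrow> \<bar>s k\<bar> = 1 \<Longrightarrow> H s = s"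
    and y: "y \<in> topspace X"
  shows "H y = y"
proof -
  let ?N = "\<lambda>s. cmax d (\<lambda>k. \<bar>s k\<bar>)"
  have X: "X = subtopology (Euclidean_space (Suc d)) {s. ?N s \<le> 1}" by (simp add: X_def cmax_le)
  show ?thesis
  proof (rule gauge_ball_periodic_trivial[OF p, of d ?N H y], goal_cases)
    case 1
    show ?case by (intro continuous_map_cmax continuous_map_real_abs continuous_map_Euclidean_space_projection)
  next
    case (2 x c)
    then show ?case using cmax_scale[of c d "\<lambda>k. \<bar>x k\<bar>"] by (simp add: abs_mult)
  next
    case (3 x i)
    have "i \<le> d" using 3 by (auto simp: topspace_Euclidean_space not_less_eq_eq)
    then have "\<bar>x i\<bar> \<le> ?N x" using cmax_le[of d "\<lambda>k. \<bar>x k\<bar>" "?N x"] by simp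
    then show ?case using 3 by linarith
  next
    case 4 then show ?case using H(1) unfolding X .
  next
    case (5 x) then show ?case using H(2) unfolding X by blast
  next
    case (6 x)
    obtain k where "k \<le> d" "?N x = \<bar>x k\<bar>" using cmax_attained[of d "\<lambda>k. \<bar>x k\<bar>"] by blast
    then show ?case using fx[of x k] 6 unfolding X by simp
  next
    case 7 then show ?case using y unfolding X .
  qed
qed

text \<open>Only the faces with a coordinate 1 are known to be fixed. Invariance of domain shows
  that the union of the faces with a coordinate 0 is at least mapped into itself. Hence
  \<open>H\<close> extends to the double of the cube along this union, and the double is a ball
  whose whole boundary is fixed.\<close>

theorem corner_cube_periodic_trivial:
  fixes p d :: nat
  defines "X \<equiv> subtopology (Euclidean_space (Suc d)) {s. \<forall>k\<le>d. 0 \<le> s k \<and> s k \<le> 1}"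
  assumes p: "prime p" and H: "continuous_map X X H" "\<And>s. s \<in> topspace X \<Longrightarrow> (H ^^ p) s = s"
    and fx: "\<And>s k. s \<in> topspace X \<Longrightarrow> k \<le> d \<Longrightarrow> s k = 1 \<Longrightarrow> H s = s"
    and y: "y \<in> topspace X"
  shows "H y = y"
proof -
  let ?E = "Euclidean_space (Suc d)"
  have E: "topspace ?E = {s. \<forall>k>d. s k = 0}" by (auto simp: topspace_Euclidean_space Suc_le_eq)
  have p1: "Suc (p - 1) = p" using prime_gt_0_nat[OF p] by simp
  have tX: "topspace X = {s \<in> topspace ?E. 0 \<le> cmin d s \<and> cmax d s \<le> 1}"
    by (auto simp: X_def cmax_le cmin_ge)
  have XE: "continuous_map X ?E id" by (simp add: X_def continuous_map_from_subtopology)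
  have HX: "H s \<in> topspace X" if "s \<in> topspace X" for s
    using continuous_map_image_subset_topspace[OF H(1)] that by blast
  have HjX: "(H ^^ j) s \<in> topspace X" if "s \<in> topspace X" for s j
    using that by (induction j) (auto intro: HX)
  have proj: "continuous_map Z euclideanreal (\<lambda>z. F z i)" if "continuous_map Z ?E F" for Z :: "'z topology" and F i
    using continuous_map_compose[OF that continuous_map_Euclidean_space_projection] by (simp add: o_def)
  have into: "continuous_map Z ?E F" if "\<And>i. continuous_map Z euclideanreal (\<lambda>z. F z i)"
    "\<And>z i. z \<in> topspace Z \<Longrightarrow> d < i \<Longrightarrow> F z i = 0" for Z :: "'z topology" and F
    using that by (auto simp: Euclidean_space_def continuous_map_in_subtopology continuous_map_componentwise_UNIV)
  have injH: "inj_on H (topspace X)"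
  proof (rule inj_onI)
    fix s t assume s: "s \<in> topspace X" and t: "t \<in> topspace X" and eq: "H s = H t"
    have "(H ^^ Suc (p - 1)) s = (H ^^ Suc (p - 1)) t" using eq unfolding funpow_Suc_right o_def by simp
    then show "s = t" using H(2)[OF s] H(2)[OF t] unfolding p1 by simp
  qed
  \<comment> \<open>The image of such a point has no coordinate 1, because points with a coordinate
    1 are fixed and \<open>H\<close> is injective. If it had no coordinate 0 either, the inverse
    \<open>H ^^ (p - 1)\<close> would be open near it and the cube would contain a full
    neighbourhood of \<open>s\<close>.\<close>
  have bottom: "cmin d (H s) = 0" if s: "s \<in> topspace X" "cmin d s = 0" for s
  proof (rule ccontr)
    assume "cmin d (H s) \<noteq> 0"
    then have pos: "0 < cmin d (H s)" using HX[OF s(1)] by (simp add: tX)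
    have lt: "H s k < 1" if "k \<le> d" for k
    proof (rule ccontr)
      assume "\<not> H s k < 1"
      moreover have "H s k \<le> 1" using HX[OF s(1)] that by (simp add: X_def)
      ultimately have "H (H s) = H s" using fx[OF HX[OF s(1)] that] by simp
      then have "H s = s" using inj_onD[OF injH _ HX[OF s(1)] s(1)] by blast
      then show False using pos s(2) by simp
    qed
    define O' where "O' = {u \<in> topspace ?E. \<forall>k\<in>{..d}. u k \<in> {0<..<1}}"
    have "openin ?E {u \<in> topspace ?E. u k \<in> {0<..<1}}" for k
      by (rule openin_continuous_map_preimage[OF continuous_map_Euclidean_space_projection]) (simp add: open_openin[symmetric])
    then have "openin ?E (\<Inter>k\<in>{..d}. {u \<in> topspace ?E. u k \<in> {0<..<1}})" by (intro openin_INT2) auto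
    moreover have "(\<Inter>k\<in>{..d}. {u \<in> topspace ?E. u k \<in> {0<..<1}}) = O'" by (auto simp: O'_def)
    ultimately have op: "openin ?E O'" by simp
    have OX: "O' \<subseteq> topspace X" by (auto simp: O'_def X_def less_imp_le)
    have Gc: "continuous_map X X (H ^^ (p - 1))" by (rule continuous_map_funpow[OF H(1)])
    have sub: "subtopology ?E O' = subtopology X O'"
    proof -
      have "{s. \<forall>k\<le>d. 0 \<le> s k \<and> s k \<le> 1} \<inter> O' = O'" by (auto simp: O'_def less_imp_le)
      then show ?thesis by (simp add: X_def subtopology_subtopology)
    qed
    have cm: "continuous_map (subtopology ?E O') ?E (H ^^ (p - 1))"
      unfolding sub using continuous_map_compose[OF continuous_map_from_subtopology[OF Gc] XE] by (simp add: o_def id_def)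
    have GH: "(H ^^ (p - 1)) (H u) = u" if "u \<in> topspace X" for u
      using H(2)[OF that] p1 by (metis comp_apply funpow_Suc_right)
    have HG: "H ((H ^^ (p - 1)) u) = u" if "u \<in> topspace X" for u
      using H(2)[OF that] p1 by (metis comp_apply funpow.simps(2))
    have "inj_on (H ^^ (p - 1)) O'"
      by (rule inj_on_inverseI[of _ H]) (use HG OX in auto)
    from invariance_of_domain_Euclidean_space[OF op cm this]
    have opG: "openin ?E ((H ^^ (p - 1)) ` O')" .
    have "0 < H s k" if "k \<le> d" for k
      using pos cmin_ge[of "cmin d (H s)" d "H s"] that by (auto intro: less_le_trans)
    then have "H s \<in> O'" using lt HX[OF s(1)] by (auto simp: O'_def X_def)
    then have sG: "s \<in> (H ^^ (p - 1)) ` O'" using GH[OF s(1)] by (metis imageI)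
    obtain k where k: "k \<le> d" "s k = 0" using cmin_attained[of d s] s(2) by auto
    have sE: "s \<in> topspace ?E" using s(1) by (simp add: tX)
    \<comment> \<open>Pushing the zero coordinate \<open>k\<close> of \<open>s\<close> slightly
      below 0 leaves the cube.\<close>
    let ?f = "\<lambda>t i. s i + (if i = k then t else 0)"
    have "continuous_on UNIV (\<lambda>t. s i + (if i = k then t else 0))" for i
      by (cases "i = k") (auto intro!: continuous_intros)
    then have "continuous_map euclideanreal ?E ?f"
      by (intro into) (use sE k in \<open>auto simp: E\<close>)
    then have "openin euclideanreal {t \<in> topspace euclideanreal. ?f t \<in> (H ^^ (p - 1)) ` O'}"
      using opG by (rule openin_continuous_map_preimage)
    then have "open {t. ?f t \<in> (H ^^ (p - 1)) ` O'}" by (simp add: open_openin[symmetric])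
    moreover have "0 \<in> {t. ?f t \<in> (H ^^ (p - 1)) ` O'}" using sG by simp
    ultimately obtain \<epsilon> where \<epsilon>: "0 < \<epsilon>" "ball 0 \<epsilon> \<subseteq> {t. ?f t \<in> (H ^^ (p - 1)) ` O'}" using openE by blast
    have "- \<epsilon> / 2 \<in> ball 0 \<epsilon>" using \<epsilon>(1) by simp
    then have "?f (- \<epsilon> / 2) \<in> (H ^^ (p - 1)) ` O'" using \<epsilon>(2) by blast
    moreover have "(H ^^ (p - 1)) ` O' \<subseteq> topspace X" using HjX subsetD[OF OX] by (rule_tac image_subsetI) simp
    ultimately have "?f (- \<epsilon> / 2) \<in> topspace X" by (rule rev_subsetD)
    then have "\<forall>m\<le>d. 0 \<le> ?f (- \<epsilon> / 2) m" unfolding X_def by simp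
    then have "0 \<le> ?f (- \<epsilon> / 2) k" using k(1) by blast
    then show False using k \<epsilon>(1) by simp
  qed
  \<comment> \<open>A reflection along the diagonal: all coordinates are shifted equally so that the
    minimum changes sign. It is an involution that fixes the points with minimum 0, along which the
    cube is doubled.\<close>
  define R where "R = (\<lambda>s k. if k \<le> d then s k - 2 * cmin d s else 0 :: real)"
  have Rmax: "cmax d (R s) = cmax d s - 2 * cmin d s" for s
    using cmax_cong[of d "R s" "\<lambda>k. s k + - 2 * cmin d s"] cmax_add[of d s "- 2 * cmin d s"] by (simp add: R_def)
  have Rmin: "cmin d (R s) = - cmin d s" for s
  proof -
    have "cmax d (\<lambda>k. - R s k) = cmax d (\<lambda>k. - s k + 2 * cmin d s)" by (rule cmax_cong) (simp add: R_def)
    also have "\<dots> = cmax d (\<lambda>k. - s k) + 2 * cmin d s" by (rule cmax_add)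
    finally show ?thesis by (simp add: cmin_def)
  qed
  have Rk: "R s k = (if k \<le> d then s k - 2 * cmin d s else 0)" for s k by (simp add: R_def)
  have RE: "R s \<in> topspace ?E" for s by (simp add: R_def E)
  have RR: "R (R s) = s" if "s \<in> topspace ?E" for s
  proof
    fix k show "R (R s) k = s k"
      using that unfolding Rk[of "R s"] Rmin Rk[of s] by (simp add: E)
  qed
  have R0: "R s = s" if "s \<in> topspace ?E" "cmin d s = 0" for s
    using that by (auto simp: R_def E fun_eq_iff)
  have Rc: "continuous_map Z ?E (\<lambda>z. R (F z))" if F: "continuous_map Z ?E F" for Z :: "'z topology" and F
  proof (rule into)
    have "continuous_map Z euclideanreal (\<lambda>z. F z i - 2 * cmin d (F z))" for i
      by (intro continuous_intros continuous_map_cmin proj F)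
    then show "continuous_map Z euclideanreal (\<lambda>z. R (F z) i)" for i
      by (cases "i \<le> d") (simp_all add: R_def)
  qed (simp add: R_def)
  \<comment> \<open>The gauge of the double: \<open>cmax d s\<close> where the minimum is
    nonnegative and \<open>cmax d (R s)\<close> where it is nonpositive.\<close>
  define N where "N = (\<lambda>s. cmax d s - 2 * min (cmin d s) 0)"
  define B where "B = subtopology ?E {s. N s \<le> 1}"
  have tB: "topspace B = {s \<in> topspace ?E. N s \<le> 1}" by (auto simp: B_def)
  have BE: "continuous_map B ?E id" by (simp add: B_def continuous_map_from_subtopology)
  have XB: "s \<in> topspace B" if "s \<in> topspace X" for s using that by (simp add: tX tB N_def)
  have RXB: "R s \<in> topspace B" if "s \<in> topspace X" for s
    using that RE by (simp add: tX tB N_def Rmax Rmin)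
  have BX: "s \<in> topspace X" if "s \<in> topspace B" "0 \<le> cmin d s" for s
    using that by (simp add: tX tB N_def)
  have RBX: "R s \<in> topspace X" if "s \<in> topspace B" "cmin d s \<le> 0" for s
    using that RE by (simp add: tX tB N_def Rmax Rmin)
  have intoX: "continuous_map Z X F" if "continuous_map Z ?E F" "\<And>z. z \<in> topspace Z \<Longrightarrow> F z \<in> topspace X" for Z :: "'z topology" and F
    using that by (auto simp: X_def continuous_map_in_subtopology)
  have intoB: "continuous_map Z B F" if "continuous_map Z ?E F" "\<And>z. z \<in> topspace Z \<Longrightarrow> F z \<in> topspace B" for Z :: "'z topology" and F
    using that by (auto simp: B_def continuous_map_in_subtopology)
  \<comment> \<open>\<open>H\<close> on the cube and its conjugate by the reflection on the other
    half; \<open>bottom\<close> makes the two agree where the minimum is 0.\<close>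
  define G where "G = (\<lambda>s. if 0 \<le> cmin d s then H s else R (H (R s)))"
  have Gc: "continuous_map B B G"
    unfolding G_def
  proof (rule continuous_map_cases_le)
    show "continuous_map B euclideanreal (cmin d)"
      using continuous_map_cmin[of B "\<lambda>s. s" d] proj[OF BE] by simp
    let ?P = "subtopology B {s \<in> topspace B. 0 \<le> cmin d s}" and ?M = "subtopology B {s \<in> topspace B. cmin d s \<le> 0}"
    have P: "continuous_map ?P X (\<lambda>s. s)"
      by (rule intoX) (use BX continuous_map_from_subtopology[OF BE] in \<open>auto simp: id_def\<close>)
    have XEH: "continuous_map ?P ?E H"
      using continuous_map_compose[OF continuous_map_compose[OF P H(1)] XE] by (simp add: o_def id_def)
    show "continuous_map ?P B H" by (rule intoB[OF XEH]) (use BX HX XB in auto)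
    have M: "continuous_map ?M X R"
      by (rule intoX) (use RBX Rc[OF continuous_map_from_subtopology[OF BE]] in auto)
    have "continuous_map ?M ?E (\<lambda>s. H (R s))"
      using continuous_map_compose[OF continuous_map_compose[OF M H(1)] XE] by (simp add: o_def id_def)
    then have "continuous_map ?M ?E (\<lambda>s. R (H (R s)))" by (rule Rc)
    then show "continuous_map ?M B (\<lambda>s. R (H (R s)))" by (rule intoB) (use RBX HX RXB in auto)
    fix s assume s: "s \<in> topspace B" "0 = cmin d s"
    then have sX: "s \<in> topspace X" using BX by simp
    have "R s = s" using R0 s tB by simp
    moreover have "R (H s) = H s" using R0[of "H s"] bottom[OF sX] HX[OF sX] s tX by simp
    ultimately show "H s = R (H (R s))" by simp
  qed simp
  have GR: "G (R u) = R (H u)" if u: "u \<in> topspace X" for u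
  proof (cases "cmin d u = 0")
    case True
    then have "R u = u" using R0 u tX by simp
    moreover have "R (H u) = H u" using R0[of "H u"] bottom[OF u True] HX[OF u] tX by simp
    ultimately show ?thesis using True by (simp add: G_def)
  next
    case False
    then have "\<not> 0 \<le> cmin d (R u)" using u by (simp add: Rmin tX)
    then show ?thesis using RR[of u] u tX by (simp add: G_def)
  qed
  have Gj: "(G ^^ j) u = (H ^^ j) u" "(G ^^ j) (R u) = R ((H ^^ j) u)" if u: "u \<in> topspace X" for u j
  proof -
    have "G v = H v" if "v \<in> topspace X" for v using that by (simp add: G_def tX)
    then show "(G ^^ j) u = (H ^^ j) u" using HjX[OF u] by (induction j) auto
    show "(G ^^ j) (R u) = R ((H ^^ j) u)" using HjX[OF u] GR by (induction j) auto
  qed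
  have Gp: "(G ^^ p) s = s" if s: "s \<in> topspace B" for s
  proof (cases "0 \<le> cmin d s")
    case True
    then show ?thesis using Gj(1)[OF BX[OF s True]] H(2)[OF BX[OF s True]] by simp
  next
    case False
    then have RX: "R s \<in> topspace X" using RBX[OF s] by simp
    have "R (R s) = s" using RR s tB by simp
    then show ?thesis using Gj(2)[OF RX, of p] H(2)[OF RX] by simp
  qed
  have "G y = y"
  proof (rule gauge_ball_periodic_trivial[OF p, of d N G y], goal_cases)
    case 1
    have "continuous_map ?E euclideanreal (cmax d)" "continuous_map ?E euclideanreal (cmin d)"
      using continuous_map_cmax[of ?E "\<lambda>s. s" d] continuous_map_cmin[of ?E "\<lambda>s. s" d] continuous_map_Euclidean_space_projection by auto
    then show ?case unfolding N_def by (intro continuous_intros continuous_map_real_min) auto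
  next
    case (2 x c)
    have "min (c * cmin d x) 0 = c * min (cmin d x) 0" using 2(2) by (auto simp: min_def mult_le_0_iff zero_le_mult_iff)
    then show ?case using cmax_scale[OF 2(2), of d x] cmin_scale[OF 2(2), of d x] by (simp add: N_def algebra_simps)
  next
    case (3 x i)
    have i: "i \<le> d" using 3 by (auto simp: E not_less[symmetric])
    have "cmin d x \<le> x i" "x i \<le> cmax d x" using cmin_ge[of "cmin d x" d x] cmax_le[of d x "cmax d x"] i by auto
    then show ?case using 3(2) cmin_le_cmax[of d x] by (auto simp: N_def min_def)
  next
    case 4 then show ?case using Gc unfolding B_def .
  next
    case (5 x) then show ?case using Gp unfolding B_def by blast
  next
    case (6 x)
    then have xB: "x \<in> topspace B" by (simp add: B_def)
    show ?case
    proof (cases "0 \<le> cmin d x")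
      case True
      then have "cmax d x = 1" using 6 by (simp add: N_def)
      then obtain k where "k \<le> d" "x k = 1" using cmax_attained[of d x] by auto
      then have "H x = x" using fx BX[OF xB True] by blast
      then show ?thesis using True by (simp add: G_def)
    next
      case False
      then have RX: "R x \<in> topspace X" using RBX[OF xB] by simp
      have "cmax d (R x) = 1" using 6 False by (simp add: N_def Rmax)
      then obtain k where "k \<le> d" "R x k = 1" using cmax_attained[of d "R x"] by auto
      then have "H (R x) = R x" using fx RX by blast
      then show ?thesis using False RR xB tB by (simp add: G_def)
    qed
  next
    case 7 then show ?case using XB[OF y] unfolding B_def .
  qed
  then show ?thesis using y by (simp add: G_def tX)
qed

section \<open>Closed unbounded sets of countable ordinals\<close>

definition omega0 :: omega1 where "omega0 = (LEAST a. True)"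

lemma omega0_le [simp]: "omega0 \<le> a"
  unfolding omega0_def by (rule Least_le) simp

text \<open>Countably many countable initial segments cannot exhaust an uncountable order.\<close>

lemma omega1_bounded:
  assumes "countable A" obtains b :: omega1 where "\<And>a. a \<in> A \<Longrightarrow> a < b"
proof -
  have "countable (\<Union>a\<in>A. insert a {y. y < a})"
    using assms countable_omega1_below by (intro countable_UN) auto
  then obtain b where b: "b \<notin> (\<Union>a\<in>A. insert a {y. y < a})"
    using uncountable_omega1 by (metis UNIV_eq_I)
  show thesis by (rule that[of b]) (use b in \<open>auto simp: not_less_iff_gr_or_eq\<close>)
qed

lemma omega1_no_max: "\<exists>b. (a::omega1) < b"
  using omega1_bounded[of "{a}"] by auto

text \<open>Close off \<open>\<beta>\<close> countably often and take the least strict upper bound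
  of the stages: whatever lies below it lies below a stage, and the next stage exceeds its
  image.\<close>

lemma omega1_closed_point:
  fixes \<eta> :: "omega1 \<Rightarrow> omega1"
  obtains r where "\<beta> < r" "\<And>b. b < r \<Longrightarrow> \<eta> b < r"
proof -
  have "\<exists>c. a < c \<and> (\<forall>b\<le>a. \<eta> b < c)" for a
  proof -
    have "{b. b \<le> a} = insert a {b. b < a}" by auto
    then have "countable (insert a (\<eta> ` {b. b \<le> a}))" using countable_omega1_below[of a] by auto
    then obtain c where "\<And>x. x \<in> insert a (\<eta> ` {b. b \<le> a}) \<Longrightarrow> x < c" using omega1_bounded by blast
    then show ?thesis by blast
  qed
  then obtain nx where nx: "\<And>a. a < nx a" "\<And>a b. b \<le> a \<Longrightarrow> \<eta> b < nx a" by metis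
  define s where "s = (\<lambda>k. (nx ^^ k) \<beta>)"
  have "countable (range s)" by simp
  then obtain b where b: "\<And>x. x \<in> range s \<Longrightarrow> x < b" using omega1_bounded by blast
  define r where "r = (LEAST b. \<forall>k. s k < b)"
  have r: "\<forall>k. s k < r" unfolding r_def by (rule LeastI[of _ b]) (use b in auto)
  show thesis
  proof
    show "\<beta> < r" using r[rule_format, of 0] by (simp add: s_def)
    fix c assume "c < r"
    then have "\<not> (\<forall>k. s k < c)" unfolding r_def using not_less_Least by blast
    then obtain k where "c \<le> s k" by (auto simp: not_less)
    then have "\<eta> c < s (Suc k)" using nx(2) by (simp add: s_def)
    then show "\<eta> c < r" using r less_trans by blast
  qed
qed

text \<open>The closed unbounded filter, with closure under a function in place of a closed unbounded set.\<close>

definition club :: "omega1 filter" where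
  "club = Abs_filter (\<lambda>P. \<exists>\<eta>. \<forall>r>omega0. (\<forall>b<r. \<eta> b < r) \<longrightarrow> P r)"

text \<open>Two closure functions combine by their maximum, so this is a filter. The condition
  \<open>r > omega0\<close> excludes the first ordinal, which is closed under every function
  vacuously.\<close>

lemma eventually_club: "eventually P club \<longleftrightarrow> (\<exists>\<eta>. \<forall>r>omega0. (\<forall>b<r. \<eta> b < r) \<longrightarrow> P r)"
  unfolding club_def
proof (rule eventually_Abs_filter, rule is_filter.intro)
  fix P Q
  assume "\<exists>\<eta>. \<forall>r>omega0. (\<forall>b<r. \<eta> b < r) \<longrightarrow> P r" "\<exists>\<eta>. \<forall>r>omega0. (\<forall>b<r. \<eta> b < r) \<longrightarrow> Q r"
  then obtain \<eta> \<theta> where "\<forall>r>omega0. (\<forall>b<r. \<eta> b < r) \<longrightarrow> P r" "\<forall>r>omega0. (\<forall>b<r. \<theta> b < r) \<longrightarrow> Q r" by blast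
  then show "\<exists>\<eta>. \<forall>r>omega0. (\<forall>b<r. \<eta> b < r) \<longrightarrow> P r \<and> Q r"
    by (intro exI[of _ "\<lambda>b. max (\<eta> b) (\<theta> b)"]) auto
qed blast+

lemma eventually_club_gt: "eventually (\<lambda>r. b < r) club"
  unfolding eventually_club by (rule exI[of _ "\<lambda>_. b"]) auto

lemma club_frequently:
  assumes "eventually P club" shows "\<exists>r>b. P r"
proof -
  obtain \<eta> where \<eta>: "\<forall>r>omega0. (\<forall>b<r. \<eta> b < r) \<longrightarrow> P r" using assms by (auto simp: eventually_club)
  obtain r where r: "b < r" "\<And>b. b < r \<Longrightarrow> \<eta> b < r" using omega1_closed_point by blast
  then have "omega0 < r" using omega0_le[of b] by (rule_tac le_less_trans)
  then show ?thesis using \<eta> r by blast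
qed

lemma eventually_club_closed:
  assumes "\<And>b. \<exists>c. R b c" shows "eventually (\<lambda>r. \<forall>b<r. \<exists>c<r. R b c) club"
proof -
  obtain \<eta> where "\<And>b. R b (\<eta> b)" using assms by metis
  then show ?thesis unfolding eventually_club by blast
qed

lemma eventually_club_limit: "eventually (\<lambda>r. \<forall>b<r. \<exists>c<r. b < c) club"
  by (rule eventually_club_closed) (rule omega1_no_max)

section \<open>The half-long line as a linear continuum\<close>

definition ordinal_part :: "half_long_line \<Rightarrow> omega1" where "ordinal_part x = fst (Rep_half_long_line x)"
definition real_part :: "half_long_line \<Rightarrow> real" where "real_part x = snd (Rep_half_long_line x)"
definition hpoint :: "omega1 \<Rightarrow> real \<Rightarrow> half_long_line" where "hpoint a s = Abs_half_long_line (a, s)"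

lemma real_part_bounds: "0 \<le> real_part x" "real_part x < 1"
  using Rep_half_long_line[of x] by (auto simp: real_part_def)

lemma hpoint_parts [simp]:
  "0 \<le> s \<Longrightarrow> s < 1 \<Longrightarrow> ordinal_part (hpoint a s) = a"
  "0 \<le> s \<Longrightarrow> s < 1 \<Longrightarrow> real_part (hpoint a s) = s"
  by (simp_all add: hpoint_def ordinal_part_def real_part_def Abs_half_long_line_inverse)

lemma hl_le_iff: "x \<le> y \<longleftrightarrow> ordinal_part x < ordinal_part y \<or> ordinal_part x = ordinal_part y \<and> real_part x \<le> real_part y"
  by (simp add: less_eq_half_long_line.rep_eq ordinal_part_def real_part_def case_prod_unfold)

lemma hl_less_iff: "x < y \<longleftrightarrow> ordinal_part x < ordinal_part y \<or> ordinal_part x = ordinal_part y \<and> real_part x < real_part y"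
  by (simp add: less_half_long_line.rep_eq ordinal_part_def real_part_def case_prod_unfold)

lemma hl_zero [simp]: "ordinal_part 0 = omega0" "real_part 0 = 0"
  by (simp_all add: zero_half_long_line.rep_eq ordinal_part_def real_part_def omega0_def)

text \<open>The least ordinal part in \<open>S\<close> is attained, and the points with this part
  have an infimum of real parts. It stays below 1 because it is at most the real part of an actual
  point.\<close>

lemma hl_glb:
  fixes S :: "half_long_line set"
  assumes "S \<noteq> {}"
  shows "\<exists>z. (\<forall>x\<in>S. z \<le> x) \<and> (\<forall>w. (\<forall>x\<in>S. w \<le> x) \<longrightarrow> w \<le> z)"
proof -
  define a where "a = (LEAST a. \<exists>x\<in>S. ordinal_part x = a)"
  have "\<exists>x\<in>S. ordinal_part x = a" unfolding a_def by (rule LeastI_ex) (use assms in auto)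
  then obtain x0 where x0: "x0 \<in> S" "ordinal_part x0 = a" by blast
  have a: "a \<le> ordinal_part x" if "x \<in> S" for x unfolding a_def by (rule Least_le) (use that in auto)
  define R where "R = real_part ` {x \<in> S. ordinal_part x = a}"
  have R: "R \<noteq> {}" "bdd_below R" using x0 real_part_bounds by (auto simp: R_def intro!: bdd_belowI[of _ 0])
  define s where "s = Inf R"
  have s0: "0 \<le> s" unfolding s_def by (rule cInf_greatest[OF R(1)]) (auto simp: R_def real_part_bounds)
  have sle: "s \<le> real_part x" if "x \<in> S" "ordinal_part x = a" for x
    unfolding s_def by (rule cInf_lower) (use R that in \<open>auto simp: R_def\<close>)
  have s1: "s < 1" using sle[OF x0] real_part_bounds[of x0] by simp
  show ?thesis
  proof (intro exI[of _ "hpoint a s"] conjI ballI allI impI)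
    fix x assume "x \<in> S"
    then show "hpoint a s \<le> x" using a[of x] sle[of x] s0 s1 by (auto simp: hl_le_iff order_le_less)
  next
    fix w assume w: "\<forall>x\<in>S. w \<le> x"
    show "w \<le> hpoint a s"
    proof (cases "ordinal_part w < a")
      case False
      then have "ordinal_part w = a" using w x0 by (auto simp: hl_le_iff)
      moreover have "real_part w \<le> s"
        unfolding s_def by (rule cInf_greatest[OF R(1)]) (use w calculation in \<open>auto simp: R_def hl_le_iff\<close>)
      ultimately show ?thesis using s0 s1 by (simp add: hl_le_iff)
    qed (use s0 s1 in \<open>simp add: hl_le_iff\<close>)
  qed
qed

instantiation half_long_line :: linear_continuum_topology
begin

definition inf_half_long_line :: "half_long_line \<Rightarrow> half_long_line \<Rightarrow> half_long_line" where "inf_half_long_line = min"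
definition sup_half_long_line :: "half_long_line \<Rightarrow> half_long_line \<Rightarrow> half_long_line" where "sup_half_long_line = max"
definition Inf_half_long_line :: "half_long_line set \<Rightarrow> half_long_line"
  where "Inf (S :: half_long_line set) = (SOME z. (\<forall>x\<in>S. z \<le> x) \<and> (\<forall>w. (\<forall>x\<in>S. w \<le> x) \<longrightarrow> w \<le> z))"
definition Sup_half_long_line :: "half_long_line set \<Rightarrow> half_long_line"
  where "Sup (S :: half_long_line set) = Inf {u. \<forall>x\<in>S. x \<le> u}"

instance
proof
  fix x y z :: half_long_line and S :: "half_long_line set"
  have I: "(\<forall>x\<in>S. Inf S \<le> x) \<and> (\<forall>w. (\<forall>x\<in>S. w \<le> x) \<longrightarrow> w \<le> Inf S)" if "S \<noteq> {}" for S :: "half_long_line set"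
    unfolding Inf_half_long_line_def by (rule someI_ex[OF hl_glb[OF that]])
  show "inf x y \<le> x" "inf x y \<le> y" "x \<le> y \<Longrightarrow> x \<le> z \<Longrightarrow> x \<le> inf y z"
    "x \<le> sup x y" "y \<le> sup x y" "y \<le> x \<Longrightarrow> z \<le> x \<Longrightarrow> sup y z \<le> x"
    by (auto simp: inf_half_long_line_def sup_half_long_line_def)
  show "Inf S \<le> x" if "x \<in> S" "bdd_below S" using I[of S] that by blast
  show "z \<le> Inf S" if "S \<noteq> {}" "\<And>x. x \<in> S \<Longrightarrow> z \<le> x" using I[of S] that by blast
  show "x \<le> Sup S" if "x \<in> S" "bdd_above S"
  proof -
    have "{u. \<forall>x\<in>S. x \<le> u} \<noteq> {}" using that by (auto simp: bdd_above_def)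
    from I[OF this] have "(\<forall>z\<in>{u. \<forall>x\<in>S. x \<le> u}. x \<le> z) \<longrightarrow> x \<le> Inf {u. \<forall>x\<in>S. x \<le> u}" by blast
    then show ?thesis unfolding Sup_half_long_line_def using that(1) by blast
  qed
  show "Sup S \<le> z" if "S \<noteq> {}" "\<And>x. x \<in> S \<Longrightarrow> x \<le> z"
  proof -
    have z: "z \<in> {u. \<forall>x\<in>S. x \<le> u}" using that by blast
    then have "{u. \<forall>x\<in>S. x \<le> u} \<noteq> {}" by blast
    from I[OF this] z show ?thesis unfolding Sup_half_long_line_def by blast
  qed
  show "\<exists>z. x < z \<and> z < y" if xy: "x < y"
  proof (cases "ordinal_part x < ordinal_part y")
    case True
    let ?z = "hpoint (ordinal_part x) ((real_part x + 1) / 2)"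
    have "x < ?z" "?z < y" using True real_part_bounds[of x] by (simp_all add: hl_less_iff)
    then show ?thesis by blast
  next
    case False
    let ?z = "hpoint (ordinal_part x) ((real_part x + real_part y) / 2)"
    have "x < ?z" "?z < y" using False xy real_part_bounds[of x] real_part_bounds[of y] by (simp_all add: hl_less_iff)
    then show ?thesis by blast
  qed
  obtain a where "omega0 < a" using omega1_no_max by blast
  then have "hpoint omega0 0 \<noteq> hpoint a 0" by (metis hpoint_parts(1) less_irrefl order_refl zero_less_one)
  then show "\<exists>a b :: half_long_line. a \<noteq> b" by blast
qed

end

abbreviation opoint :: "omega1 \<Rightarrow> half_long_line" where "opoint a \<equiv> hpoint a 0"

lemma opoint_mono: "opoint a \<le> opoint b \<longleftrightarrow> a \<le> b" "opoint a < opoint b \<longleftrightarrow> a < b"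
  by (auto simp: hl_le_iff hl_less_iff)

lemma opoint_0: "opoint omega0 = 0"
  by (rule antisym) (simp_all add: hl_le_iff)

lemma opoint_cofinal: "\<exists>a. x < opoint a"
  using omega1_no_max[of "ordinal_part x"] by (auto simp: hl_less_iff)

lemma opoint_limit:
  assumes r: "\<forall>b<r. \<exists>c<r. b < c" and x: "x < opoint r" obtains b where "b < r" "x < opoint b"
proof -
  have "ordinal_part x < r" using x real_part_bounds[of x] by (auto simp: hl_less_iff)
  then obtain c where "c < r" "ordinal_part x < c" using r by blast
  then show thesis using that[of c] by (simp add: hl_less_iff)
qed

section \<open>Real functions on the half-long line\<close>

lemma continuous_on_order_preimages:
  fixes f :: "'a::topological_space \<Rightarrow> 'b::linorder_topology"
  assumes "\<And>c. open {x. f x < c}" "\<And>c. open {x. c < f x}"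
  shows "continuous_on UNIV f"
proof (rule continuous_on_generate_topology[OF open_generated_order])
  fix B :: "'b set" assume "B \<in> range (\<lambda>a. {..<a}) \<union> range greaterThan"
  then consider a where "B = {..<a}" | a where "B = {a<..}" by auto
  then show "\<exists>C. open C \<and> C \<inter> UNIV = f -` B \<inter> UNIV"
  proof cases
    case 1 then show ?thesis using assms(1)[of a] by (intro exI[of _ "{x. f x < a}"]) auto
  next
    case 2 then show ?thesis using assms(2)[of a] by (intro exI[of _ "{x. a < f x}"]) auto
  qed
qed

definition ramp :: "omega1 \<Rightarrow> half_long_line \<Rightarrow> real" where
  "ramp a x = (if ordinal_part x < a then 0 else if ordinal_part x = a then real_part x else 1)"

lemma ramp_bounds: "0 \<le> ramp a x" "ramp a x \<le> 1"
  using real_part_bounds[of x] by (auto simp: ramp_def)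

lemma ramp_mono: "x \<le> y \<Longrightarrow> ramp a x \<le> ramp a y"
  using real_part_bounds[of x] real_part_bounds[of y] by (auto simp: ramp_def hl_le_iff)

lemma ramp_strict: "x < y \<Longrightarrow> ramp (ordinal_part x) x < ramp (ordinal_part x) y"
  using real_part_bounds[of x] by (auto simp: ramp_def hl_less_iff)

lemma ramp_eq_1: "opoint b \<le> x \<Longrightarrow> a < b \<Longrightarrow> ramp a x = 1"
  by (auto simp: ramp_def hl_le_iff)

lemma ramp_0 [simp]: "ramp a 0 = 0"
  using omega0_le[of a] by (auto simp: ramp_def order_le_less)

lemma ramp_greater: "0 \<le> c \<Longrightarrow> c < 1 \<Longrightarrow> c < ramp a x \<longleftrightarrow> hpoint a c < x"
  using real_part_bounds[of x] by (auto simp: ramp_def hl_less_iff)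

lemma ramp_less: "0 \<le> c \<Longrightarrow> c < 1 \<Longrightarrow> ramp a x < c \<longleftrightarrow> x < hpoint a c \<and> 0 < c"
  using real_part_bounds[of x] by (auto simp: ramp_def hl_less_iff)

lemma continuous_ramp: "continuous_on UNIV (ramp a)"
proof (rule continuous_on_order_preimages)
  have low: "open {x. ramp a x < c}" if "0 \<le> c" "c < 1" for c
    using that by (cases "0 < c") (simp_all add: ramp_less lessThan_def[symmetric])
  fix c :: real
  consider "c < 0" | "0 \<le> c" "c < 1" | "c = 1" | "1 < c" by linarith
  then show "open {x. ramp a x < c}"
  proof cases
    case 1
    then have "{x. ramp a x < c} = {}" using ramp_bounds(1)[of a] by (auto simp: not_less intro: order_trans[of c 0])
    then show ?thesis by simp
  next
    case 3
    \<comment> \<open>There is no point \<open>hpoint a 1\<close> to bound this set, so it is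
      exhausted by smaller thresholds.\<close>
    have "{x. ramp a x < c} = (\<Union>b\<in>{0..<1}. {x. ramp a x < b})"
    proof (intro equalityI subsetI)
      fix x assume "x \<in> {x. ramp a x < c}"
      then have "(ramp a x + 1) / 2 \<in> {0..<1}" "ramp a x < (ramp a x + 1) / 2"
        using 3 ramp_bounds[of a x] by auto
      then show "x \<in> (\<Union>b\<in>{0..<1}. {x. ramp a x < b})" by blast
    qed (use 3 in auto)
    then show ?thesis using low by auto
  next
    case 4
    then have "{x. ramp a x < c} = UNIV" using ramp_bounds(2)[of a] by (auto intro: le_less_trans)
    then show ?thesis by simp
  qed (use low in simp)
  consider "c < 0" | "0 \<le> c" "c < 1" | "1 \<le> c" by linarith
  then show "open {x. c < ramp a x}"
  proof cases
    case 1
    then have "{x. c < ramp a x} = UNIV" using ramp_bounds(1)[of a] by (auto intro: less_le_trans)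
    then show ?thesis by simp
  next
    case 2
    then show ?thesis by (simp add: ramp_greater greaterThan_def[symmetric])
  next
    case 3
    then have "{x. c < ramp a x} = {}" using ramp_bounds(2)[of a] by (auto simp: not_less intro: order_trans)
    then show ?thesis by simp
  qed
qed

text \<open>Only countably many unit intervals lie below \<open>g\<close>, so their ramps can be
  added with weights 2^-n. For \<open>x < y\<close> the ramp of the interval containing
  \<open>x\<close> gives strictness, and all these ramps are constant from \<open>opoint g\<close>
  on.\<close>

lemma half_long_line_real_map:
  assumes g: "omega0 < g"
  shows "\<exists>u :: half_long_line \<Rightarrow> real. continuous_on UNIV u \<and> u 0 = 0 \<and> (\<forall>x y. x \<le> y \<longrightarrow> u x \<le> u y) \<and>
    (\<forall>x y. x < y \<longrightarrow> y \<le> opoint g \<longrightarrow> u x < u y) \<and> (\<forall>x. opoint g \<le> x \<longrightarrow> u x = u (opoint g))"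
proof -
  let ?C = "{a. a < g}"
  have C: "countable ?C" "?C \<noteq> {}" using countable_omega1_below g by auto
  define e where "e = from_nat_into ?C"
  have eC: "e n < g" for n using from_nat_into[OF C(2), of n] by (simp add: e_def)
  have es: "\<exists>n. e n = a" if "a < g" for a using from_nat_into_surj[OF C(1), of a] that by (simp add: e_def)
  define F where "F = (\<lambda>n x. (1/2)^n * ramp (e n) x)"
  define u where "u = (\<lambda>x. suminf (\<lambda>n. F n x))"
  have F: "0 \<le> F n x" "F n x \<le> (1/2)^n" "norm (F n x) \<le> (1/2)^n" for n x
    using ramp_bounds[of "e n" x] by (auto simp: F_def abs_mult mult_left_le)
  have sm: "summable (\<lambda>n. (1/2)^n :: real)" by (rule summable_geometric) simp
  have sF: "summable (\<lambda>n. F n x)" for x by (rule summable_comparison_test'[OF sm]) (use F in auto)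
  have Fm: "F n x \<le> F n y" if "x \<le> y" for n x y
    unfolding F_def using ramp_mono[OF that] by (intro mult_left_mono) auto
  show ?thesis
  proof (intro exI[of _ u] conjI allI impI)
    have "uniform_limit UNIV (\<lambda>n x. \<Sum>i<n. F i x) u sequentially"
      unfolding u_def by (rule Weierstrass_m_test[OF _ sm]) (use F in auto)
    then show "continuous_on UNIV u"
      by (rule uniform_limit_theorem[rotated])
        (auto simp: F_def intro!: always_eventually continuous_on_sum continuous_on_mult continuous_ramp)
    show "u 0 = 0" by (simp add: u_def F_def)
    show "u x \<le> u y" if "x \<le> y" for x y
      unfolding u_def by (rule suminf_le[OF Fm[OF that] sF sF])
    show "u x < u y" if xy: "x < y" "y \<le> opoint g" for x y
    proof -
      have "x < opoint g" using xy by (rule less_le_trans)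
      then have "ordinal_part x < g" using real_part_bounds[of x] by (auto simp: hl_less_iff)
      then obtain n where n: "e n = ordinal_part x" using es by blast
      have "0 < suminf (\<lambda>n. F n y - F n x)"
      proof (rule suminf_pos2)
        show "summable (\<lambda>n. F n y - F n x)" using sF by (intro summable_diff)
        show "0 \<le> F m y - F m x" for m using Fm xy by simp
        show "0 < F n y - F n x" using ramp_strict[OF xy(1)] by (simp add: F_def n)
      qed
      also have "\<dots> = u y - u x" unfolding u_def by (rule suminf_diff[symmetric, OF sF sF])
      finally show ?thesis by simp
    qed
    show "u x = u (opoint g)" if "opoint g \<le> x" for x
      using ramp_eq_1[OF that eC] ramp_eq_1[OF order_refl eC] by (simp add: u_def F_def)
  qed
qed

definition hl_map :: "omega1 \<Rightarrow> half_long_line \<Rightarrow> real" where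
  "hl_map g = (SOME u. continuous_on UNIV u \<and> u 0 = 0 \<and> (\<forall>x y. x \<le> y \<longrightarrow> u x \<le> u y) \<and>
    (\<forall>x y. x < y \<longrightarrow> y \<le> opoint g \<longrightarrow> u x < u y) \<and> (\<forall>x. opoint g \<le> x \<longrightarrow> u x = u (opoint g)))"

lemma hl_map:
  assumes "omega0 < g"
  shows "continuous_on UNIV (hl_map g)" "hl_map g 0 = 0" "x \<le> y \<Longrightarrow> hl_map g x \<le> hl_map g y"
    "x < y \<Longrightarrow> y \<le> opoint g \<Longrightarrow> hl_map g x < hl_map g y"
    "opoint g \<le> x \<Longrightarrow> hl_map g x = hl_map g (opoint g)"
proof -
  note * = someI_ex[OF half_long_line_real_map[OF assms], folded hl_map_def]
  show "continuous_on UNIV (hl_map g)" "hl_map g 0 = 0" using * by blast+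
  show "x \<le> y \<Longrightarrow> hl_map g x \<le> hl_map g y" using * by blast
  show "x < y \<Longrightarrow> y \<le> opoint g \<Longrightarrow> hl_map g x < hl_map g y" using * by blast
  show "opoint g \<le> x \<Longrightarrow> hl_map g x = hl_map g (opoint g)" using * by blast
qed

text \<open>
  The half-long line (\<open>E = {1}\<close>) and the long line (\<open>E = {1, -1}\<close>) with the parametrization \<open>\<iota> e\<close> of
  the half in direction \<open>e\<close>.
\<close>

locale long_space =
  fixes E :: "int set" and \<iota> :: "int \<Rightarrow> half_long_line \<Rightarrow> 'x::linear_continuum_topology"
  assumes E: "E = {1} \<or> E = {1, -1}"
    and end_continuous: "e \<in> E \<Longrightarrow> continuous_on UNIV (\<iota> e)"
    and end_mono: "s < t \<Longrightarrow> \<iota> 1 s < \<iota> 1 t"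
    and end_antimono: "-1 \<in> E \<Longrightarrow> s < t \<Longrightarrow> \<iota> (-1) t < \<iota> (-1) s"
    and end_0: "e \<in> E \<Longrightarrow> \<iota> e 0 = \<iota> 1 0"
    and end_bot: "-1 \<notin> E \<Longrightarrow> \<iota> 1 0 \<le> x"
    and end_cover: "\<exists>e\<in>E. \<exists>s. x = \<iota> e s"
    and end_real_map: "omega0 < g \<Longrightarrow> \<exists>U :: 'x \<Rightarrow> real. continuous_on UNIV U \<and> (\<forall>x y. x \<le> y \<longrightarrow> U x \<le> U y) \<and>
      (\<forall>x y. (if -1 \<in> E then \<iota> (-1) (opoint g) else \<iota> 1 0) \<le> x \<longrightarrow> x < y \<longrightarrow> y \<le> \<iota> 1 (opoint g) \<longrightarrow> U x < U y) \<and>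
      (\<forall>x \<ge> \<iota> 1 (opoint g). U x = U (\<iota> 1 (opoint g))) \<and>
      (-1 \<in> E \<longrightarrow> (\<forall>x \<le> \<iota> (-1) (opoint g). U x = U (\<iota> (-1) (opoint g))))"

interpretation half_long: long_space "{1}" "\<lambda>_ x. x :: half_long_line"
proof
  fix g assume g: "omega0 < g"
  define u where "u = hl_map g"
  note u = hl_map[OF g, folded u_def]
  have 1: "\<forall>x\<ge>opoint g. u x = u (opoint g)" "\<forall>x y. x \<le> y \<longrightarrow> u x \<le> u y"
    "\<forall>x y. (if -1 \<in> {1::int} then opoint g else 0) \<le> x \<longrightarrow> x < y \<longrightarrow> y \<le> opoint g \<longrightarrow> u x < u y"
    using u by blast+
  have 2: "-1 \<in> {1::int} \<longrightarrow> (\<forall>x \<le> opoint g. u x = u (opoint g))" by simp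
  show "\<exists>U :: half_long_line \<Rightarrow> real. continuous_on UNIV U \<and> (\<forall>x y. x \<le> y \<longrightarrow> U x \<le> U y) \<and>
      (\<forall>x y. (if -1 \<in> {1::int} then opoint g else 0) \<le> x \<longrightarrow> x < y \<longrightarrow> y \<le> opoint g \<longrightarrow> U x < U y) \<and>
      (\<forall>x \<ge> opoint g. U x = U (opoint g)) \<and>
      (-1 \<in> {1::int} \<longrightarrow> (\<forall>x \<le> opoint g. U x = U (opoint g)))"
    by (rule exI[of _ u]) (intro conjI u(1) 1 2)
qed (auto simp: zero_half_long_line_le)

section \<open>The long line as a linear continuum\<close>

definition pos_end :: "half_long_line \<Rightarrow> long_line" where "pos_end s = abs_long_line (Inr s)"
definition neg_end :: "half_long_line \<Rightarrow> long_line" where "neg_end s = abs_long_line (Inl s)"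

lemma long_line_cases: obtains s where "x = pos_end s" | s where "x = neg_end s"
proof -
  obtain u where "x = abs_long_line u" by (induction x rule: long_line.abs_induct) blast
  then show thesis using that by (cases u) (auto simp: pos_end_def neg_end_def)
qed

lemma long_le_simps [simp]:
  "pos_end s \<le> pos_end t \<longleftrightarrow> s \<le> t" "neg_end s \<le> neg_end t \<longleftrightarrow> t \<le> s"
  "neg_end s \<le> pos_end t" "pos_end s \<le> neg_end t \<longleftrightarrow> s = 0 \<and> t = 0"
  by (simp_all add: pos_end_def neg_end_def less_eq_long_line.abs_eq)

lemma long_less_simps [simp]:
  "pos_end s < pos_end t \<longleftrightarrow> s < t" "neg_end s < neg_end t \<longleftrightarrow> t < s"
  "neg_end s < pos_end t \<longleftrightarrow> s \<noteq> 0 \<or> t \<noteq> 0" "\<not> pos_end s < neg_end t"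
  by (auto simp: less_le_not_le)

lemma neg_end_0: "neg_end 0 = pos_end 0"
  by (rule antisym) auto

lemma hl_pos_iff: "0 < (s :: half_long_line) \<longleftrightarrow> s \<noteq> 0"
  using zero_half_long_line_le[of s] by (auto simp: order_le_less)

text \<open>Points of the reversed half lie below all others, so if \<open>S\<close> has any of them
  they decide the infimum, which is then a supremum in the half-long line.\<close>

lemma long_glb:
  fixes S :: "long_line set"
  assumes "S \<noteq> {}" "bdd_below S"
  shows "\<exists>z. (\<forall>x\<in>S. z \<le> x) \<and> (\<forall>w. (\<forall>x\<in>S. w \<le> x) \<longrightarrow> w \<le> z)"
proof (cases "\<exists>a. neg_end a \<in> S")
  case False
  let ?A = "{a. pos_end a \<in> S}"
  have S: "\<exists>a\<in>?A. x = pos_end a" if "x \<in> S" for x using that False by (cases x rule: long_line_cases) auto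
  have A: "?A \<noteq> {}" "bdd_below ?A" using S assms(1) zero_half_long_line_le by (blast, auto intro: bdd_belowI[of _ 0])
  show ?thesis
  proof (intro exI[of _ "pos_end (Inf ?A)"] conjI ballI allI impI)
    fix x assume "x \<in> S"
    then show "pos_end (Inf ?A) \<le> x" using S[of x] A by (auto intro: cInf_lower)
  next
    fix w assume w: "\<forall>x\<in>S. w \<le> x"
    show "w \<le> pos_end (Inf ?A)"
    proof (cases w rule: long_line_cases)
      case (1 s)
      have "s \<le> Inf ?A" by (rule cInf_greatest[OF A(1)]) (use w 1 in auto)
      then show ?thesis using 1 by simp
    qed simp
  qed
next
  case True
  let ?A = "{a. neg_end a \<in> S}"
  obtain b where b: "\<forall>x\<in>S. b \<le> x" using assms(2) by (auto simp: bdd_below_def)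
  obtain c where c: "neg_end c \<le> b" by (cases b rule: long_line_cases) auto
  have bdd: "bdd_above ?A" using b c by (auto simp: bdd_above_def intro!: exI[of _ c] dest: order_trans)
  show ?thesis
  proof (intro exI[of _ "neg_end (Sup ?A)"] conjI ballI allI impI)
    fix x assume "x \<in> S"
    then show "neg_end (Sup ?A) \<le> x" using bdd by (cases x rule: long_line_cases) (auto intro: cSup_upper)
  next
    fix w assume w: "\<forall>x\<in>S. w \<le> x"
    have neg: "neg_end s \<le> neg_end (Sup ?A)" if "\<forall>x\<in>S. neg_end s \<le> x" for s
    proof -
      have "Sup ?A \<le> s" by (rule cSup_least) (use True that in auto)
      then show ?thesis by simp
    qed
    show "w \<le> neg_end (Sup ?A)"
    proof (cases w rule: long_line_cases)
      case (1 s)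
      obtain a where "neg_end a \<in> S" using True by blast
      then have "s = 0" using w 1 by force
      then show ?thesis using neg[of 0] w 1 by (simp add: neg_end_0)
    next
      case (2 s)
      then show ?thesis using neg w by simp
    qed
  qed
qed

instantiation long_line :: linear_continuum_topology
begin

definition inf_long_line :: "long_line \<Rightarrow> long_line \<Rightarrow> long_line" where "inf_long_line = min"
definition sup_long_line :: "long_line \<Rightarrow> long_line \<Rightarrow> long_line" where "sup_long_line = max"
definition Inf_long_line :: "long_line set \<Rightarrow> long_line"
  where "Inf (S :: long_line set) = (SOME z. (\<forall>x\<in>S. z \<le> x) \<and> (\<forall>w. (\<forall>x\<in>S. w \<le> x) \<longrightarrow> w \<le> z))"
definition Sup_long_line :: "long_line set \<Rightarrow> long_line"
  where "Sup (S :: long_line set) = Inf {u. \<forall>x\<in>S. x \<le> u}"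

instance
proof
  fix x y z :: long_line and S :: "long_line set"
  have I: "(\<forall>x\<in>S. Inf S \<le> x) \<and> (\<forall>w. (\<forall>x\<in>S. w \<le> x) \<longrightarrow> w \<le> Inf S)" if "S \<noteq> {}" "bdd_below S" for S :: "long_line set"
    unfolding Inf_long_line_def by (rule someI_ex[OF long_glb[OF that]])
  show "inf x y \<le> x" "inf x y \<le> y" "x \<le> y \<Longrightarrow> x \<le> z \<Longrightarrow> x \<le> inf y z"
    "x \<le> sup x y" "y \<le> sup x y" "y \<le> x \<Longrightarrow> z \<le> x \<Longrightarrow> sup y z \<le> x"
    by (auto simp: inf_long_line_def sup_long_line_def)
  show "Inf S \<le> x" if "x \<in> S" "bdd_below S" using I[of S] that by blast
  show "z \<le> Inf S" if "S \<noteq> {}" "\<And>x. x \<in> S \<Longrightarrow> z \<le> x"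
  proof -
    have "bdd_below S" using that(2) by (auto simp: bdd_below_def)
    from I[OF that(1) this] show ?thesis using that(2) by blast
  qed
  have bd: "bdd_below {u. \<forall>x\<in>S. x \<le> u}" if "S \<noteq> {}" using that by (auto simp: bdd_below_def)
  show "x \<le> Sup S" if "x \<in> S" "bdd_above S"
  proof -
    have "{u. \<forall>x\<in>S. x \<le> u} \<noteq> {}" using that by (auto simp: bdd_above_def)
    from I[OF this bd] that(1) have "(\<forall>z\<in>{u. \<forall>x\<in>S. x \<le> u}. x \<le> z) \<longrightarrow> x \<le> Inf {u. \<forall>x\<in>S. x \<le> u}" by blast
    then show ?thesis unfolding Sup_long_line_def using that(1) by blast
  qed
  show "Sup S \<le> z" if "S \<noteq> {}" "\<And>x. x \<in> S \<Longrightarrow> x \<le> z"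
  proof -
    have z: "z \<in> {u. \<forall>x\<in>S. x \<le> u}" using that by blast
    then have "{u. \<forall>x\<in>S. x \<le> u} \<noteq> {}" by blast
    from I[OF this bd[OF that(1)]] z show ?thesis unfolding Sup_long_line_def by blast
  qed
  show "\<exists>z. x < z \<and> z < y" if xy: "x < y"
  proof (cases x rule: long_line_cases)
    case (1 s)
    note x = 1
    show ?thesis
    proof (cases y rule: long_line_cases)
      case (1 t)
      then obtain m where "s < m" "m < t" using dense[of s t] xy x by auto
      then show ?thesis using x 1 by (intro exI[of _ "pos_end m"]) simp
    qed (use x xy in simp)
  next
    case (2 s)
    note x = 2
    show ?thesis
    proof (cases y rule: long_line_cases)
      case (1 t)
      show ?thesis
      proof (cases "t = 0")
        case True
        then have "0 < s" using x 1 xy by (simp add: hl_pos_iff)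
        then obtain m where "0 < m" "m < s" using dense by blast
        then show ?thesis using x 1 True by (intro exI[of _ "neg_end m"]) auto
      next
        case False
        then have "0 < t" by (simp add: hl_pos_iff)
        then obtain m where "0 < m" "m < t" using dense by blast
        then show ?thesis using x 1 by (intro exI[of _ "pos_end m"]) auto
      qed
    next
      case (2 t)
      then obtain m where "t < m" "m < s" using dense[of t s] xy x by auto
      then show ?thesis using x 2 by (intro exI[of _ "neg_end m"]) simp
    qed
  qed
  obtain a where "omega0 < a" using omega1_no_max by blast
  then have "pos_end 0 < pos_end (opoint a)" using opoint_mono(2)[of omega0 a] by (simp add: opoint_0)
  then show "\<exists>a b :: long_line. a \<noteq> b" using less_imp_neq by blast
qed

end

text \<open>The default 0 collapses the other half to the origin, which makes this a continuous
  retraction; likewise for \<open>neg_part\<close>.\<close>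

definition pos_part :: "long_line \<Rightarrow> half_long_line" where "pos_part x = (if \<exists>s. x = pos_end s then (THE s. x = pos_end s) else 0)"
definition neg_part :: "long_line \<Rightarrow> half_long_line" where "neg_part x = (if \<exists>s. x = neg_end s then (THE s. x = neg_end s) else 0)"

lemma end_inject [simp]: "pos_end s = pos_end t \<longleftrightarrow> s = t" "neg_end s = neg_end t \<longleftrightarrow> s = t"
  "pos_end s = neg_end t \<longleftrightarrow> s = 0 \<and> t = 0" "neg_end s = pos_end t \<longleftrightarrow> s = 0 \<and> t = 0"
  by (auto simp: order_eq_iff)

lemma parts_simps [simp]: "pos_part (pos_end s) = s" "pos_part (neg_end s) = 0"
  "neg_part (neg_end s) = s" "neg_part (pos_end s) = 0"
  by (auto simp: pos_part_def neg_part_def)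

lemma hl_not_neg [simp]: "\<not> (s :: half_long_line) < 0"
  using zero_half_long_line_le[of s] by (simp add: not_less)

lemma continuous_pos_part: "continuous_on UNIV pos_part"
proof (rule continuous_on_order_preimages)
  fix c
  have "pos_part x < c \<longleftrightarrow> c \<noteq> 0 \<and> x < pos_end c" for x
    by (cases x rule: long_line_cases) (auto simp: hl_pos_iff)
  then show "open {x. pos_part x < c}" by (cases "c = 0") (simp_all add: lessThan_def[symmetric])
  have "c < pos_part x \<longleftrightarrow> pos_end c < x" for x
    by (cases x rule: long_line_cases) auto
  then show "open {x. c < pos_part x}" by (simp add: greaterThan_def[symmetric])
qed

lemma continuous_neg_part: "continuous_on UNIV neg_part"
proof (rule continuous_on_order_preimages)
  fix c
  have "neg_part x < c \<longleftrightarrow> c \<noteq> 0 \<and> neg_end c < x" for x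
    by (cases x rule: long_line_cases) (auto simp: hl_pos_iff)
  then show "open {x. neg_part x < c}" by (cases "c = 0") (simp_all add: greaterThan_def[symmetric])
  have "c < neg_part x \<longleftrightarrow> x < neg_end c" for x
    by (cases x rule: long_line_cases) auto
  then show "open {x. c < neg_part x}" by (simp add: lessThan_def[symmetric])
qed

lemma continuous_pos_end: "continuous_on UNIV pos_end"
proof (rule continuous_on_order_preimages)
  fix c
  show "open {x. pos_end x < c}"
    by (cases c rule: long_line_cases) (simp_all add: lessThan_def[symmetric])
  have "open {x. neg_end b < pos_end x}" for b
    by (cases "b = 0") (simp_all add: greaterThan_def[symmetric] flip: hl_pos_iff)
  then show "open {x. c < pos_end x}"
    by (cases c rule: long_line_cases) (simp_all add: greaterThan_def[symmetric])
qed

lemma continuous_neg_end: "continuous_on UNIV neg_end"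
proof (rule continuous_on_order_preimages)
  fix c
  show "open {x. c < neg_end x}"
    by (cases c rule: long_line_cases) (simp_all add: lessThan_def[symmetric])
  have "open {x. neg_end x < pos_end b}" for b
    by (cases "b = 0") (simp_all add: greaterThan_def[symmetric] flip: hl_pos_iff)
  then show "open {x. neg_end x < c}"
    by (cases c rule: long_line_cases) (simp_all add: greaterThan_def[symmetric])
qed

interpretation long: long_space "{1, -1}" "\<lambda>e. if e = 1 then pos_end else neg_end"
proof
  fix g assume g: "omega0 < g"
  define u where "u = hl_map g"
  note u = hl_map[OF g, folded u_def]
  have g0: "opoint g \<noteq> 0" using g opoint_mono(2)[of omega0 g] by (auto simp: opoint_0)
  have u0: "0 \<le> u s" for s using u(3)[OF zero_half_long_line_le] u(2) by metis
  have u1: "0 < u s" if "s \<noteq> 0" "s \<le> opoint g" for s using u(4)[of 0 s] u(2) that by (simp add: hl_pos_iff)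
  \<comment> \<open>The odd extension of \<open>u\<close>: one of the two parts is always 0, where
    \<open>u\<close> vanishes.\<close>
  define U where "U = (\<lambda>x. u (pos_part x) - u (neg_part x))"
  have "continuous_on UNIV U"
    unfolding U_def
    by (intro continuous_on_diff continuous_on_compose2[OF u(1) continuous_pos_part] continuous_on_compose2[OF u(1) continuous_neg_part]) auto
  moreover have "U x \<le> U y" if "x \<le> y" for x y
    using that u(2) u(3) u0 by (cases x rule: long_line_cases; cases y rule: long_line_cases) (auto simp: U_def intro: order_trans[of _ 0])
  moreover have "U x < U y" if xy: "neg_end (opoint g) \<le> x" "x < y" "y \<le> pos_end (opoint g)" for x y
  proof (cases x rule: long_line_cases)
    case (1 s)
    then obtain t where "y = pos_end t" using xy by (cases y rule: long_line_cases) auto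
    then show ?thesis using that 1 u(4) by (simp add: U_def)
  next
    case (2 s)
    note x = 2
    show ?thesis
    proof (cases y rule: long_line_cases)
      case (1 t)
      then show ?thesis using x that u0[of s] u0[of t] u1[of s] u1[of t] u(2) by (auto simp: U_def)
    next
      case (2 t)
      then show ?thesis using x that u(2) u(4)[of t s] by (simp add: U_def)
    qed
  qed
  moreover have "U x = U (pos_end (opoint g))" if x: "pos_end (opoint g) \<le> x" for x
  proof -
    obtain s where "x = pos_end s" "opoint g \<le> s" using x g0 by (cases x rule: long_line_cases) auto
    then show ?thesis using u(5)[of s] by (simp add: U_def)
  qed
  moreover have "U x = U (neg_end (opoint g))" if x: "x \<le> neg_end (opoint g)" for x
  proof -
    obtain s where "x = neg_end s" "opoint g \<le> s" using x g0 by (cases x rule: long_line_cases) auto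
    then show ?thesis using u(5)[of s] by (simp add: U_def)
  qed
  ultimately have U: "continuous_on UNIV U \<and> (\<forall>x y. x \<le> y \<longrightarrow> U x \<le> U y) \<and>
      (\<forall>x y. neg_end (opoint g) \<le> x \<longrightarrow> x < y \<longrightarrow> y \<le> pos_end (opoint g) \<longrightarrow> U x < U y) \<and>
      (\<forall>x \<ge> pos_end (opoint g). U x = U (pos_end (opoint g))) \<and>
      (True \<longrightarrow> (\<forall>x \<le> neg_end (opoint g). U x = U (neg_end (opoint g))))" by blast
  have e: "(-1 \<in> {1, -1::int}) = True" "(-1 = (1::int)) = False" "((1::int) = 1) = True" by simp_all
  show "\<exists>U :: long_line \<Rightarrow> real. continuous_on UNIV U \<and> (\<forall>x y. x \<le> y \<longrightarrow> U x \<le> U y) \<and>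
      (\<forall>x y. (if -1 \<in> {1, -1::int} then (if -1 = (1::int) then pos_end else neg_end) (opoint g) else (if 1 = (1::int) then pos_end else neg_end) 0) \<le> x
          \<longrightarrow> x < y \<longrightarrow> y \<le> (if 1 = (1::int) then pos_end else neg_end) (opoint g) \<longrightarrow> U x < U y) \<and>
      (\<forall>x \<ge> (if 1 = (1::int) then pos_end else neg_end) (opoint g). U x = U ((if 1 = (1::int) then pos_end else neg_end) (opoint g))) \<and>
      (-1 \<in> {1, -1::int} \<longrightarrow> (\<forall>x \<le> (if -1 = (1::int) then pos_end else neg_end) (opoint g). U x = U ((if -1 = (1::int) then pos_end else neg_end) (opoint g))))"
    unfolding e if_True if_False by (rule exI[of _ U]) (rule U)
next
  fix x :: long_line
  show "\<exists>e\<in>{1, -1::int}. \<exists>s. x = (if e = 1 then pos_end else neg_end) s"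
    by (cases x rule: long_line_cases) auto
qed (auto simp: continuous_pos_end continuous_neg_end)

section \<open>Behaviour of continuous maps at infinity\<close>

text \<open>Otherwise there are pairs arbitrarily far out whose values differ by at least
  \<open>e\<close>. Choosing each pair beyond the previous one gives two interleaved sequences with
  a common limit, since a countable set of ordinals is bounded; continuity at the limit is
  violated.\<close>

lemma real_eventually_small:
  fixes \<psi> :: "half_long_line \<Rightarrow> real"
  assumes c: "continuous_on UNIV \<psi>" and e: "0 < e"
  shows "\<exists>c. \<forall>s\<ge>opoint c. \<forall>t\<ge>opoint c. \<bar>\<psi> s - \<psi> t\<bar> < e"
proof (rule ccontr)
  assume "\<not> ?thesis"
  then have "\<forall>c. \<exists>s t. opoint c \<le> s \<and> opoint c \<le> t \<and> e \<le> \<bar>\<psi> s - \<psi> t\<bar>" by (auto simp: not_less)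
  then obtain S T where ST: "\<And>c. opoint c \<le> S c" "\<And>c. opoint c \<le> T c" "\<And>c. e \<le> \<bar>\<psi> (S c) - \<psi> (T c)\<bar>" by metis
  have "\<exists>d. S c < opoint d \<and> T c < opoint d" for c
    using opoint_cofinal[of "max (S c) (T c)"] by auto
  then obtain nx where nx: "\<And>c. S c < opoint (nx c)" "\<And>c. T c < opoint (nx c)" by metis
  define x where "x = (\<lambda>k. (nx ^^ k) omega0)"
  define X where "X = (\<lambda>k. opoint (x k))"
  have step: "X k \<le> S (x k)" "S (x k) \<le> X (Suc k)" "X k \<le> T (x k)" "T (x k) \<le> X (Suc k)" for k
    using ST(1,2)[of "x k"] nx[of "x k"] by (auto simp: X_def x_def less_imp_le)
  have inc: "incseq X" by (rule incseq_SucI) (use step order_trans in blast)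
  have "countable (range x)" by simp
  then obtain b where "\<And>a. a \<in> range x \<Longrightarrow> a < b" using omega1_bounded by blast
  then have "bdd_above (range X)" by (intro bdd_aboveI[of _ "opoint b"]) (auto simp: X_def opoint_mono less_imp_le)
  from LIMSEQ_incseq_SUP[OF this inc] obtain L where L: "X \<longlonglongrightarrow> L" by blast
  have L': "(\<lambda>k. X (Suc k)) \<longlonglongrightarrow> L" using L by (rule LIMSEQ_Suc)
  have "(\<lambda>k. S (x k)) \<longlonglongrightarrow> L" "(\<lambda>k. T (x k)) \<longlonglongrightarrow> L"
    by (rule tendsto_sandwich[OF _ _ L L']; use step in simp)+
  note lim = continuous_on_tendsto_compose[OF c this(1)] continuous_on_tendsto_compose[OF c this(2)]
  have "(\<lambda>k. \<psi> (S (x k))) \<longlonglongrightarrow> \<psi> L" "(\<lambda>k. \<psi> (T (x k))) \<longlonglongrightarrow> \<psi> L"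
    by (rule lim; simp)+
  then have "(\<lambda>k. \<bar>\<psi> (S (x k)) - \<psi> (T (x k))\<bar>) \<longlonglongrightarrow> \<bar>\<psi> L - \<psi> L\<bar>" by (intro tendsto_intros)
  then have "e \<le> \<bar>\<psi> L - \<psi> L\<bar>" by (rule LIMSEQ_le_const) (use ST(3) in auto)
  then show False using e by simp
qed

text \<open>The countably many thresholds, one for each tolerance 1/n, have a common upper
  bound.\<close>

lemma real_eventually_constant:
  fixes \<psi> :: "half_long_line \<Rightarrow> real"
  assumes c: "continuous_on UNIV \<psi>"
  shows "\<exists>c. \<forall>t\<ge>opoint c. \<psi> t = \<psi> (opoint c)"
proof -
  have "\<exists>c. \<forall>s\<ge>opoint c. \<forall>t\<ge>opoint c. \<bar>\<psi> s - \<psi> t\<bar> < 1 / real (Suc n)" for n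
    using real_eventually_small[OF c] by simp
  then obtain C where C: "\<And>n s t. opoint (C n) \<le> s \<Longrightarrow> opoint (C n) \<le> t \<Longrightarrow> \<bar>\<psi> s - \<psi> t\<bar> < 1 / real (Suc n)" by metis
  have "countable (range C)" by simp
  then obtain b where b: "\<And>a. a \<in> range C \<Longrightarrow> a < b" using omega1_bounded by blast
  have bC: "opoint (C n) \<le> opoint b" for n using b[of "C n"] by (simp add: opoint_mono less_imp_le)
  show ?thesis
  proof (intro exI[of _ b] allI impI)
    fix t assume t: "opoint b \<le> t"
    show "\<psi> t = \<psi> (opoint b)"
    proof (rule ccontr)
      assume "\<psi> t \<noteq> \<psi> (opoint b)"
      then obtain n where "1 / real (Suc n) < \<bar>\<psi> t - \<psi> (opoint b)\<bar>"
        using nat_approx_posE[of "\<bar>\<psi> t - \<psi> (opoint b)\<bar>"] by auto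
      moreover have "\<bar>\<psi> t - \<psi> (opoint b)\<bar> < 1 / real (Suc n)"
        using C[of n t "opoint b"] bC[of n] t by (meson order_trans)
      ultimately show False by simp
    qed
  qed
qed

section \<open>Boxes, ends and charts\<close>

context long_space
begin

definition hi :: "omega1 \<Rightarrow> 'x" where "hi g = \<iota> 1 (opoint g)"
definition lo :: "omega1 \<Rightarrow> 'x" where "lo g = (if -1 \<in> E then \<iota> (-1) (opoint g) else \<iota> 1 0)"
definition origin :: 'x where "origin = \<iota> 1 0"
text \<open>The interior relative to the whole space: on the half-long line it contains the least
  point (once \<open>g > omega0\<close>), so the bottom of the box does not count as
  boundary.\<close>

definition obox :: "omega1 \<Rightarrow> 'x set" where "obox g = {x. x < hi g \<and> (-1 \<in> E \<longrightarrow> lo g < x)}"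
definition beyond :: "int \<Rightarrow> omega1 \<Rightarrow> 'x set" where "beyond e g = (if e = 1 then {hi g..} else {..lo g})"

abbreviation box :: "omega1 \<Rightarrow> 'x set" where "box g \<equiv> {lo g..hi g}"

lemma one_E [simp]: "1 \<in> E" using E by auto
lemma E_cases: "e \<in> E \<Longrightarrow> e = 1 \<or> e = -1 \<and> -1 \<in> E" using E by auto
lemma zero_notin_E [simp]: "0 \<notin> E" using E by auto
lemma finite_E [simp]: "finite E" using E by auto

lemma end_le: "s \<le> t \<Longrightarrow> \<iota> 1 s \<le> \<iota> 1 t" "-1 \<in> E \<Longrightarrow> s \<le> t \<Longrightarrow> \<iota> (-1) t \<le> \<iota> (-1) s"
  using end_mono[of s t] end_antimono[of s t] by (auto simp: order_le_less)

lemma end_less_iff: "\<iota> 1 s < \<iota> 1 t \<longleftrightarrow> s < t" "-1 \<in> E \<Longrightarrow> \<iota> (-1) s < \<iota> (-1) t \<longleftrightarrow> t < s"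
  using end_mono[of s t] end_le(1)[of t s] end_antimono[of t s] end_le(2)[of s t] by (auto simp: not_less[symmetric])

lemma hi_mono: "a < b \<Longrightarrow> hi a < hi b" "a \<le> b \<Longrightarrow> hi a \<le> hi b"
  by (auto simp: hi_def opoint_mono intro: end_mono end_le)

lemma lo_anti: "-1 \<in> E \<Longrightarrow> a < b \<Longrightarrow> lo b < lo a" "a \<le> b \<Longrightarrow> lo b \<le> lo a"
  by (auto simp: lo_def opoint_mono intro: end_antimono end_le)

lemma lo_origin: "lo g \<le> origin"
  using end_le(2)[of 0 "opoint g"] end_0[of "-1"] zero_half_long_line_le by (auto simp: lo_def origin_def)

lemma hi_origin: "origin \<le> hi g"
  unfolding hi_def origin_def by (rule end_le) (rule zero_half_long_line_le)

lemma lo_hi: "omega0 < g \<Longrightarrow> origin < hi g" "-1 \<in> E \<Longrightarrow> omega0 < g \<Longrightarrow> lo g < origin"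
  using end_mono[of 0 "opoint g"] end_antimono[of 0 "opoint g"] end_0[of "-1"] opoint_mono(2)[of omega0 g]
  by (auto simp: hi_def lo_def origin_def opoint_0)

lemma lo_le_hi: "lo g \<le> hi g" using lo_origin hi_origin order_trans by blast

lemma lo_bot: "-1 \<notin> E \<Longrightarrow> lo g \<le> x" using end_bot by (simp add: lo_def)

lemma origin_box [simp]: "origin \<in> box g" using lo_origin hi_origin by simp

lemma origin_obox: "omega0 < g \<Longrightarrow> origin \<in> obox g" using lo_hi by (simp add: obox_def)

lemma obox_box: "obox g \<subseteq> box g" using lo_bot by (fastforce simp: obox_def)

lemma box_mono: "a \<le> b \<Longrightarrow> box a \<subseteq> box b"
  using hi_mono(2) lo_anti(2) by (meson atLeastatMost_subset_iff)

lemma box_obox: "a < b \<Longrightarrow> box a \<subseteq> obox b"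
  using hi_mono(1)[of a b] lo_anti(1)[of a b] by (auto simp: obox_def)

lemma obox_mono: "a \<le> b \<Longrightarrow> obox a \<subseteq> obox b"
  using obox_box box_obox by (metis order_le_less order_refl subset_trans)

lemma in_some_obox: "\<exists>g. x \<in> obox g"
proof -
  obtain e s where e: "e \<in> E" "x = \<iota> e s" using end_cover by blast
  obtain g where g: "s < opoint g" using opoint_cofinal by blast
  have "opoint omega0 < opoint g" unfolding opoint_0 by (rule le_less_trans[OF zero_half_long_line_le g])
  then have g0: "omega0 < g" by (simp only: opoint_mono)
  consider "e = 1" | "e = -1" "-1 \<in> E" using E_cases e by blast
  then have "x \<in> obox g"
  proof cases
    case 1
    have "origin \<le> x" unfolding e 1 origin_def by (rule end_le) (rule zero_half_long_line_le)
    then show ?thesis using lo_hi(2)[OF _ g0] end_mono[OF g] by (auto simp: obox_def e 1 hi_def)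
  next
    case 2
    have "x \<le> origin" unfolding e 2 origin_def using end_le(2)[OF 2(2) zero_half_long_line_le[of s]] end_0[OF 2(2)] by simp
    then show ?thesis using lo_hi(1)[OF g0] end_antimono[OF 2(2) g] by (auto simp: obox_def e 2 lo_def)
  qed
  then show ?thesis by blast
qed

lemma beyond_mono: "e \<in> E \<Longrightarrow> a \<le> b \<Longrightarrow> beyond e b \<subseteq> beyond e a"
  using hi_mono(2)[of a b] lo_anti(2)[of a b] by (auto simp: beyond_def)

lemma beyond_obox: "e \<in> E \<Longrightarrow> beyond e g \<inter> obox g = {}"
  using E_cases by (fastforce simp: beyond_def obox_def)

lemma not_obox_beyond: "x \<notin> obox g \<Longrightarrow> \<exists>e\<in>E. x \<in> beyond e g"
proof -
  assume "x \<notin> obox g"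
  then consider "hi g \<le> x" | "-1 \<in> E" "x \<le> lo g" by (auto simp: obox_def not_less)
  then show ?thesis
  proof cases
    case 1 then show ?thesis by (intro bexI[of _ 1]) (auto simp: beyond_def)
  next
    case 2 then show ?thesis by (intro bexI[of _ "-1"]) (auto simp: beyond_def)
  qed
qed

lemma obox_limit:
  assumes r: "\<forall>b<r. \<exists>c<r. b < c" "omega0 < r" and x: "x \<in> obox r"
  shows "\<exists>b<r. omega0 < b \<and> x \<in> box b"
proof -
  obtain e s where e: "e \<in> E" "x = \<iota> e s" using end_cover by blast
  have "s < opoint r"
    using E_cases[OF e(1)] x end_less_iff by (auto simp: e obox_def hi_def lo_def)
  then obtain b0 where b0: "b0 < r" "s < opoint b0" by (rule opoint_limit[OF r(1)])
  obtain b1 where b1: "b1 < r" "omega0 < b1" using r by blast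
  define b where "b = max b0 b1"
  have b: "b < r" "omega0 < b" "s < opoint b"
    using b0 b1 by (auto simp: b_def max_def opoint_mono less_le_trans not_le intro: less_trans)
  consider "e = 1" | "e = -1" "-1 \<in> E" using E_cases e by blast
  then have "x \<in> box b"
  proof cases
    case 1
    have "origin \<le> x" unfolding e 1 origin_def by (rule end_le) (rule zero_half_long_line_le)
    then show ?thesis using lo_origin[of b] end_mono[OF b(3)] by (auto simp: e 1 hi_def)
  next
    case 2
    have "x \<le> origin" unfolding e 2 origin_def using end_le(2)[OF 2(2) zero_half_long_line_le[of s]] end_0[OF 2(2)] by simp
    then show ?thesis using hi_origin[of b] end_antimono[OF 2(2) b(3)] 2 by (auto simp: e 2 lo_def)
  qed
  then show ?thesis using b by blast
qed

lemma beyond_limit: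
  assumes r: "\<forall>b<r. \<exists>c<r. b < c" "omega0 < r" and e: "e \<in> E" and x: "x \<in> box r" "\<And>b. b < r \<Longrightarrow> x \<in> beyond e b"
  shows "x = \<iota> e (opoint r)"
proof -
  have "x \<notin> obox r"
  proof
    assume "x \<in> obox r"
    then obtain b c where "b < r" "x \<in> box b" "c < r" "b < c" using obox_limit r by blast
    then show False using box_obox[of b c] beyond_obox[OF e, of c] x(2)[of c] by blast
  qed
  then have "x = hi r \<or> -1 \<in> E \<and> x = lo r" using x(1) by (auto simp: obox_def)
  moreover obtain b where b: "b < r" "omega0 < b" using r by blast
  consider "e = 1" | "e = -1" "-1 \<in> E" using E_cases e by blast
  then show ?thesis
  proof cases
    case 1
    have "lo r \<noteq> x" using x(2)[OF b(1)] lo_hi(1)[OF b(2)] lo_origin[of r] 1 by (auto simp: beyond_def)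
    then show ?thesis using calculation 1 by (auto simp: hi_def)
  next
    case 2
    have "hi r \<noteq> x" using x(2)[OF b(1)] lo_hi(2)[OF 2(2) b(2)] hi_origin[of r] 2 by (auto simp: beyond_def)
    then show ?thesis using calculation 2 by (auto simp: lo_def)
  qed
qed

definition chart :: "omega1 \<Rightarrow> 'x \<Rightarrow> real" where
  "chart g = (SOME U. continuous_on UNIV U \<and> (\<forall>x y. x \<le> y \<longrightarrow> U x \<le> U y) \<and>
      (\<forall>x y. lo g \<le> x \<longrightarrow> x < y \<longrightarrow> y \<le> hi g \<longrightarrow> U x < U y) \<and>
      (\<forall>x \<ge> hi g. U x = U (hi g)) \<and> (-1 \<in> E \<longrightarrow> (\<forall>x \<le> lo g. U x = U (lo g))))"

lemma chart:
  assumes "omega0 < g"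
  shows "continuous_on UNIV (chart g)" "x \<le> y \<Longrightarrow> chart g x \<le> chart g y"
    "lo g \<le> x \<Longrightarrow> x < y \<Longrightarrow> y \<le> hi g \<Longrightarrow> chart g x < chart g y"
    "hi g \<le> x \<Longrightarrow> chart g x = chart g (hi g)" "-1 \<in> E \<Longrightarrow> x \<le> lo g \<Longrightarrow> chart g x = chart g (lo g)"
proof -
  have "\<exists>U :: 'x \<Rightarrow> real. continuous_on UNIV U \<and> (\<forall>x y. x \<le> y \<longrightarrow> U x \<le> U y) \<and>
      (\<forall>x y. lo g \<le> x \<longrightarrow> x < y \<longrightarrow> y \<le> hi g \<longrightarrow> U x < U y) \<and>
      (\<forall>x \<ge> hi g. U x = U (hi g)) \<and> (-1 \<in> E \<longrightarrow> (\<forall>x \<le> lo g. U x = U (lo g)))"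
    using end_real_map[OF assms] unfolding lo_def hi_def by (elim exE, rule_tac exI) (cases "-1 \<in> E"; simp only: if_True if_False; blast)
  note * = someI_ex[OF this, folded chart_def]
  show "continuous_on UNIV (chart g)" using * by blast
  show "x \<le> y \<Longrightarrow> chart g x \<le> chart g y" using * by blast
  show "lo g \<le> x \<Longrightarrow> x < y \<Longrightarrow> y \<le> hi g \<Longrightarrow> chart g x < chart g y" using * by blast
  show "hi g \<le> x \<Longrightarrow> chart g x = chart g (hi g)" using * by blast
  show "-1 \<in> E \<Longrightarrow> x \<le> lo g \<Longrightarrow> chart g x = chart g (lo g)" using * by blast
qed

lemma chart_hi_iff: assumes "omega0 < g" shows "chart g x < chart g (hi g) \<longleftrightarrow> x < hi g"
proof
  assume "chart g x < chart g (hi g)"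
  then show "x < hi g" using chart(4)[OF assms, of x] by (metis not_less less_irrefl)
next
  assume x: "x < hi g"
  show "chart g x < chart g (hi g)"
  proof (cases "lo g \<le> x")
    case True then show ?thesis using chart(3)[OF assms _ x] by simp
  next
    case False
    then have "-1 \<in> E" using lo_bot by blast
    then have "chart g x = chart g (lo g)" using chart(5)[OF assms, of x] False by simp
    moreover have "lo g < hi g" using lo_origin[of g] lo_hi(1)[OF assms] by simp
    ultimately show ?thesis using chart(3)[OF assms, of "lo g" "hi g"] by simp
  qed
qed

lemma chart_lo_iff: assumes "omega0 < g" "-1 \<in> E" shows "chart g (lo g) < chart g x \<longleftrightarrow> lo g < x"
proof
  assume "chart g (lo g) < chart g x"
  then show "lo g < x" using chart(5)[OF assms, of x] by (metis not_less less_irrefl)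
next
  assume x: "lo g < x"
  show "chart g (lo g) < chart g x"
  proof (cases "x \<le> hi g")
    case True then show ?thesis using chart(3)[OF assms(1) _ x] by simp
  next
    case False
    then have "chart g x = chart g (hi g)" using chart(4)[OF assms(1), of x] by simp
    moreover have "lo g < hi g" using lo_origin[of g] lo_hi(1)[OF assms(1)] by simp
    ultimately show ?thesis using chart(3)[OF assms(1), of "lo g" "hi g"] by simp
  qed
qed

text \<open>The chart is injective on the box and collapses each unbounded end to an extreme value.
  Hence its value decides whether the point is inside, which point it is then, and beyond which end
  it lies otherwise. This carries eventual constancy over from real functions to maps into the long
  space.\<close>

lemma chart_eq:
  assumes g: "omega0 < g" and eq: "chart g x = chart g y"
  shows "x \<in> obox g \<longleftrightarrow> y \<in> obox g" "x \<in> obox g \<Longrightarrow> x = y" "e \<in> E \<Longrightarrow> x \<in> beyond e g \<longleftrightarrow> y \<in> beyond e g"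
proof -
  have hi: "x < hi g \<longleftrightarrow> y < hi g" using chart_hi_iff[OF g, of x] chart_hi_iff[OF g, of y] eq by simp
  have lo: "lo g < x \<longleftrightarrow> lo g < y" if "-1 \<in> E" using chart_lo_iff[OF g that, of x] chart_lo_iff[OF g that, of y] eq by simp
  show 1: "x \<in> obox g \<longleftrightarrow> y \<in> obox g" using hi lo by (auto simp: obox_def)
  show "x = y" if x: "x \<in> obox g"
  proof (rule ccontr)
    assume "x \<noteq> y"
    moreover have "x \<in> box g" "y \<in> box g" using x 1 obox_box by blast+
    ultimately have "chart g x < chart g y \<or> chart g y < chart g x"
      using chart(3)[OF g, of x y] chart(3)[OF g, of y x] by (cases "x < y") auto
    then show False using eq by simp
  qed
  show "x \<in> beyond e g \<longleftrightarrow> y \<in> beyond e g" if "e \<in> E"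
    using hi lo E_cases[OF that] by (auto simp: beyond_def not_less[symmetric])
qed


section \<open>Bounded or escaping behaviour along the half-long line\<close>

text \<open>All conditions are uniform over \<open>Q\<close>. Label 0 stands for staying bounded,
  and there a single \<open>g\<close> serves both as threshold for \<open>t\<close> and as bound for
  the values.\<close>

definition tends :: "'q topology \<Rightarrow> ('q \<times> half_long_line \<Rightarrow> 'x) \<Rightarrow> int \<Rightarrow> bool" where
  "tends Q \<phi> e \<longleftrightarrow> (if e = 0 then \<exists>g. \<forall>a\<in>topspace Q. \<forall>t\<ge>opoint g. \<phi> (a, t) \<in> obox g
     else \<forall>g. \<exists>c. \<forall>a\<in>topspace Q. \<forall>t\<ge>opoint c. \<phi> (a, t) \<in> beyond e g)"

text \<open>Evaluate at the common parameter \<open>a\<close> and a large \<open>t\<close>. Two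
  parameter spaces are allowed so that cubes of different sizes can be compared.\<close>

lemma tends_unique:
  assumes Q: "a \<in> topspace Q" "a \<in> topspace Q'" and e: "e \<in> insert 0 E" "e' \<in> insert 0 E"
    and t: "tends Q \<phi> e" "tends Q' \<phi> e'"
  shows "e = e'"
proof -
  have *: False if H: "tends Q1 \<phi> e1" "tends Q2 \<phi> e2" "e1 \<in> E" "e2 \<in> insert 0 E" "e1 \<noteq> e2" "a \<in> topspace Q1" "a \<in> topspace Q2"
    for e1 e2 Q1 Q2
  proof (cases "e2 = 0")
    case True
    have "e1 \<noteq> 0" using H(3) zero_notin_E by metis
    obtain g where g: "\<forall>a\<in>topspace Q2. \<forall>t\<ge>opoint g. \<phi> (a, t) \<in> obox g" using H(2) True by (auto simp: tends_def)
    have "\<exists>c. \<forall>a\<in>topspace Q1. \<forall>t\<ge>opoint c. \<phi> (a, t) \<in> beyond e1 g" using H(1) \<open>e1 \<noteq> 0\<close> by (simp add: tends_def)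
    then obtain c where c: "\<forall>a\<in>topspace Q1. \<forall>t\<ge>opoint c. \<phi> (a, t) \<in> beyond e1 g" ..
    have "\<phi> (a, opoint (max g c)) \<in> obox g \<inter> beyond e1 g"
      using g[rule_format, OF H(7), of "opoint (max g c)"] c[rule_format, OF H(6), of "opoint (max g c)"] by (simp add: opoint_mono)
    then show ?thesis using beyond_obox[OF H(3)] by blast
  next
    case False
    then have e: "e1 \<noteq> 0" "e2 \<noteq> 0" "e2 \<in> E" using H zero_notin_E by auto
    obtain h where h: "omega0 < h" using omega1_no_max by blast
    have "\<exists>c. \<forall>a\<in>topspace Q1. \<forall>t\<ge>opoint c. \<phi> (a, t) \<in> beyond e1 h" using H(1) e by (simp add: tends_def)
    then obtain c where c: "\<forall>a\<in>topspace Q1. \<forall>t\<ge>opoint c. \<phi> (a, t) \<in> beyond e1 h" ..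
    have "\<exists>c. \<forall>a\<in>topspace Q2. \<forall>t\<ge>opoint c. \<phi> (a, t) \<in> beyond e2 h" using H(2) e by (simp add: tends_def)
    then obtain d where d: "\<forall>a\<in>topspace Q2. \<forall>t\<ge>opoint d. \<phi> (a, t) \<in> beyond e2 h" ..
    have "\<phi> (a, opoint (max c d)) \<in> beyond e1 h \<inter> beyond e2 h"
      using c[rule_format, OF H(6), of "opoint (max c d)"] d[rule_format, OF H(7), of "opoint (max c d)"] by (simp add: opoint_mono)
    moreover have "lo h < hi h" using lo_origin[of h] lo_hi(1)[OF h] by simp
    ultimately show ?thesis using E_cases[OF H(3)] E_cases[OF e(3)] H(5) by (auto simp: beyond_def)
  qed
  show ?thesis
  proof (rule ccontr)
    assume ne: "e \<noteq> e'"
    then consider "e \<in> E" | "e' \<in> E" using e by auto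
    then show False using *[OF t] *[OF t(2,1)] e ne Q by cases blast+
  qed
qed

text \<open>Composed with a chart, the map is eventually constant in \<open>t\<close>, with one
  threshold for a countable dense set and by continuity for all of \<open>Q\<close>. So each
  parameter eventually stands still or escapes to an end. The escaping sets are closed, the set of
  stationary parameters is open and, by separability, also closed; connectedness leaves one
  case.\<close>

lemma trichotomy:
  fixes Q :: "'q topology"
  assumes conn: "connected_space Q" and ne: "topspace Q \<noteq> {}"
    and D: "countable D" "Q closure_of D = topspace Q" "D \<subseteq> topspace Q"
    and \<phi>: "continuous_map (prod_topology Q euclidean) euclidean \<phi>"
  shows "\<exists>e\<in>insert 0 E. tends Q \<phi> e"
proof -
  have cont_t: "continuous_on UNIV (\<lambda>t. \<phi> (a, t))" if "a \<in> topspace Q" for a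
  proof -
    have "continuous_map euclidean (prod_topology Q euclidean) (\<lambda>t. (a, t))"
      using that by (intro continuous_map_pairedI) auto
    from continuous_map_compose[OF this \<phi>] show ?thesis by (simp add: o_def)
  qed
  have cont_a: "continuous_map Q euclidean (\<lambda>a. \<phi> (a, t))" for t
  proof -
    have "continuous_map Q (prod_topology Q euclidean) (\<lambda>a. (a, t))"
      by (intro continuous_map_pairedI) auto
    from continuous_map_compose[OF this \<phi>] show ?thesis by (simp add: o_def)
  qed
  have "\<exists>c. \<forall>a\<in>topspace Q. \<forall>t\<ge>opoint c. chart g (\<phi> (a, t)) = chart g (\<phi> (a, opoint c))" if g: "omega0 < g" for g
  proof -
    have "\<exists>c. \<forall>t\<ge>opoint c. chart g (\<phi> (d, t)) = chart g (\<phi> (d, opoint c))" if "d \<in> D" for d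
      using D(3) that by (intro real_eventually_constant continuous_on_compose2[OF chart(1)[OF g] cont_t]) auto
    then obtain C where C: "\<And>d t. d \<in> D \<Longrightarrow> opoint (C d) \<le> t \<Longrightarrow> chart g (\<phi> (d, t)) = chart g (\<phi> (d, opoint (C d)))" by metis
    have "countable (C ` D)" using D(1) by simp
    then obtain b where b: "\<And>a. a \<in> C ` D \<Longrightarrow> a < b" using omega1_bounded by blast
    show ?thesis
    proof (intro exI[of _ b] ballI allI impI)
      fix a t assume a: "a \<in> topspace Q" and t: "opoint b \<le> t"
      have cc: "continuous_map Q euclideanreal (\<lambda>a. chart g (\<phi> (a, s)))" for s
        using continuous_map_compose[OF cont_a, of euclideanreal "chart g" s] chart(1)[OF g] by (simp add: o_def)
      show "chart g (\<phi> (a, t)) = chart g (\<phi> (a, opoint b))"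
      proof (rule forall_in_closure_of_eq[OF _ _ cc cc])
        show "a \<in> Q closure_of D" using a D(2) by simp
        show "Hausdorff_space euclideanreal" by simp
        fix d assume d: "d \<in> D"
        have bC: "opoint (C d) \<le> opoint b" using b d by (auto simp: opoint_mono less_imp_le)
        show "chart g (\<phi> (d, t)) = chart g (\<phi> (d, opoint b))"
          using C[OF d bC] C[OF d order_trans[OF bC t]] by simp
      qed
    qed
  qed
  then obtain C where C: "\<And>g a t. omega0 < g \<Longrightarrow> a \<in> topspace Q \<Longrightarrow> opoint (C g) \<le> t \<Longrightarrow>
      chart g (\<phi> (a, t)) = chart g (\<phi> (a, opoint (C g)))" by metis
  define fin where "fin = (\<lambda>a g. \<phi> (a, opoint (C g)) \<in> obox g)"
  define far where "far = (\<lambda>a e g. \<phi> (a, opoint (C g)) \<in> beyond e g)"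
  have fin_t: "\<phi> (a, t) = \<phi> (a, opoint (C g))" if "omega0 < g" "a \<in> topspace Q" "fin a g" "opoint (C g) \<le> t" for a g t
    using chart_eq(2)[OF that(1) C[OF that(1,2,4), symmetric]] that(3) by (simp add: fin_def)
  have far_t: "\<phi> (a, t) \<in> beyond e g" if "omega0 < g" "a \<in> topspace Q" "far a e g" "opoint (C g) \<le> t" "e \<in> E" for a e g t
    using chart_eq(3)[OF that(1) C[OF that(1,2,4)] that(5)] that(3) by (simp add: far_def)
  have fin_up: "fin a g' \<and> \<phi> (a, opoint (C g')) = \<phi> (a, opoint (C g))"
    if g: "omega0 < g" "g \<le> g'" and a: "a \<in> topspace Q" "fin a g" for a g g'
  proof -
    define t where "t = max (opoint (C g)) (opoint (C g'))"
    have g': "omega0 < g'" using g by simp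
    have 1: "\<phi> (a, t) = \<phi> (a, opoint (C g))" using fin_t[OF g(1) a, of t] by (simp add: t_def)
    then have "\<phi> (a, t) \<in> obox g'" using a(2) obox_mono[OF g(2)] by (auto simp: fin_def)
    moreover have ct: "chart g' (\<phi> (a, t)) = chart g' (\<phi> (a, opoint (C g')))" using C[OF g' a(1), of t] by (simp add: t_def)
    ultimately have "fin a g'" using chart_eq(1)[OF g' ct] by (simp add: fin_def)
    then show ?thesis using fin_t[OF g' a(1), of t] 1 by (simp add: t_def)
  qed
  define Of where "Of = {a \<in> topspace Q. \<exists>g. omega0 < g \<and> fin a g}"
  define F where "F = (\<lambda>e. {a \<in> topspace Q. \<forall>g. omega0 < g \<longrightarrow> far a e g})"
  have obox_open: "open (obox g)" for g
  proof -
    have "obox g = (if -1 \<in> E then {lo g<..<hi g} else {..<hi g})" by (auto simp: obox_def)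
    then show ?thesis by simp
  qed
  have beyond_closed: "closed (beyond e g)" for e g by (simp add: beyond_def)
  have O_open: "openin Q Of"
  proof -
    have "Of = (\<Union>g\<in>{g. omega0 < g}. {a \<in> topspace Q. \<phi> (a, opoint (C g)) \<in> obox g})"
      by (auto simp: Of_def fin_def)
    moreover have "openin Q {a \<in> topspace Q. \<phi> (a, opoint (C g)) \<in> obox g}" for g
      by (rule openin_continuous_map_preimage[OF cont_a]) (use obox_open in \<open>simp add: open_openin[symmetric]\<close>)
    ultimately show ?thesis by auto
  qed
  have F_closed: "closedin Q (F e)" for e
  proof -
    have cl: "closedin Q {a \<in> topspace Q. \<phi> (a, opoint (C g)) \<in> beyond e g}" for g
      by (rule closedin_continuous_map_preimage[OF cont_a]) (use beyond_closed in \<open>simp add: closed_closedin[symmetric]\<close>)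
    obtain h where "omega0 < h" using omega1_no_max by blast
    then have "F e = (\<Inter>g\<in>{g. omega0 < g}. {a \<in> topspace Q. \<phi> (a, opoint (C g)) \<in> beyond e g})"
      by (auto simp: F_def far_def)
    moreover have "closedin Q (\<Inter>g\<in>{g. omega0 < g}. {a \<in> topspace Q. \<phi> (a, opoint (C g)) \<in> beyond e g})"
      by (rule closedin_INT) (use \<open>omega0 < h\<close> cl in auto)
    ultimately show ?thesis by simp
  qed
  have "\<exists>g. omega0 < g \<and> fin d g" if "d \<in> D \<inter> Of" for d using that by (auto simp: Of_def)
  then obtain G where G: "\<And>d. d \<in> D \<inter> Of \<Longrightarrow> omega0 < G d \<and> fin d (G d)" by metis
  have "countable (insert omega0 (G ` (D \<inter> Of)))" using D(1) by auto
  then obtain g0 where g0: "\<And>a. a \<in> insert omega0 (G ` (D \<inter> Of)) \<Longrightarrow> a < g0" using omega1_bounded by blast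
  have g00: "omega0 < g0" using g0 by simp
  obtain g1 where g1: "g0 < g1" using omega1_no_max by blast
  have g10: "omega0 < g1" using g00 g1 by simp
  \<comment> \<open>The stationary points of the dense set all end up in the box of size
    \<open>g0\<close>. This is a closed condition, so it passes to all of \<open>Of\<close>.
    Conversely the closed box lies in the open box of the larger size \<open>g1\<close>, so
    \<open>K\<close> consists of stationary points.\<close>
  define K where "K = {a \<in> topspace Q. \<phi> (a, opoint (C g1)) \<in> box g0}"
  have K_closed: "closedin Q K"
    unfolding K_def by (rule closedin_continuous_map_preimage[OF cont_a]) (simp add: closed_closedin[symmetric])
  have KO: "K \<subseteq> Of" using box_obox[OF g1] g10 by (auto simp: K_def Of_def fin_def)
  have OK: "Of \<subseteq> K"
  proof -
    have "D \<inter> Of \<subseteq> K"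
    proof
      fix d assume d: "d \<in> D \<inter> Of"
      then have dQ: "d \<in> topspace Q" by (simp add: Of_def)
      have "G d < g0" using g0 d by blast
      then have 1: "fin d g0" using fin_up[of "G d" g0 d] G[OF d] dQ by simp
      then have "\<phi> (d, opoint (C g1)) = \<phi> (d, opoint (C g0))" using fin_up[OF g00 _ dQ, of g1] g1 by simp
      then have "\<phi> (d, opoint (C g1)) \<in> obox g0" using 1 by (simp add: fin_def)
      then show "d \<in> K" using dQ subsetD[OF obox_box] unfolding K_def by blast
    qed
    then have "Q closure_of (Of \<inter> D) \<subseteq> K" using K_closed by (intro closure_of_minimal) auto
    moreover have "Of \<inter> Q closure_of D = Of \<inter> Q closure_of (Of \<inter> D)" by (rule openin_Int_closure_of_eq[OF O_open])
    ultimately show ?thesis using D(2) by (auto simp: Of_def)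
  qed
  have O_closed: "closedin Q Of" using K_closed KO OK by (metis subset_antisym)
  have cover: "topspace Q \<subseteq> Of \<union> (F 1 \<union> (if -1 \<in> E then F (-1) else {}))"
  proof
    fix a assume a: "a \<in> topspace Q"
    show "a \<in> Of \<union> (F 1 \<union> (if -1 \<in> E then F (-1) else {}))"
    proof (cases "a \<in> Of")
      case False
      have ex: "\<exists>e\<in>E. far a e g" if "omega0 < g" for g
        using not_obox_beyond[of "\<phi> (a, opoint (C g))" g] False that a by (auto simp: Of_def fin_def far_def)
      obtain e where e: "e \<in> E" "far a e g0" using ex[OF g00] by blast
      have "far a e g" if g: "omega0 < g" for g
      proof -
        obtain e' where e': "e' \<in> E" "far a e' g" using ex[OF g] by blast
        define t where "t = max (opoint (C g)) (opoint (C g0))"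
        have "\<phi> (a, t) \<in> beyond e g0" "\<phi> (a, t) \<in> beyond e' g"
          using far_t[OF g00 a e(2) _ e(1), of t] far_t[OF g a e'(2) _ e'(1), of t] by (auto simp: t_def)
        \<comment> \<open>The end cannot depend on the size: far out the point would lie beyond both
          ends at once.\<close>
        then have "e = e'"
          using E_cases[OF e(1)] E_cases[OF e'(1)] lo_origin[of g] lo_origin[of g0] lo_hi(1)[OF g] lo_hi(1)[OF g00]
          by (auto simp: beyond_def)
        then show ?thesis using e' by simp
      qed
      then have "a \<in> F e" using a by (simp add: F_def)
      then show ?thesis using E_cases[OF e(1)] by auto
    qed simp
  qed
  have OF: "Of \<inter> F e = {}" if "e \<in> E" for e
  proof -
    have False if "a \<in> topspace Q" "omega0 < g" "fin a g" "\<forall>g. omega0 < g \<longrightarrow> far a e g" for a g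
      using that beyond_obox[OF \<open>e \<in> E\<close>, of g] by (auto simp: fin_def far_def)
    then show ?thesis by (auto simp: Of_def F_def)
  qed
  have FF: "F 1 \<inter> F (-1) = {}"
  proof -
    have "lo g0 < hi g0" using lo_origin[of g0] lo_hi(1)[OF g00] by simp
    then have "far a 1 g0 \<Longrightarrow> far a (-1) g0 \<Longrightarrow> False" for a by (auto simp: far_def beyond_def)
    then show ?thesis using g00 unfolding F_def by blast
  qed
  define R where "R = (if -1 \<in> E then F (-1) else {})"
  have R: "closedin Q R" using F_closed by (simp add: R_def)
  have F1R: "F 1 \<inter> R = {}" using FF by (simp add: R_def)
  have OFR: "Of \<inter> (F 1 \<union> R) = {}" using OF[OF one_E] OF[of "-1"] by (auto simp: R_def)
  have far_tends: "tends Q \<phi> e" if "topspace Q \<subseteq> F e" "e \<in> E" for e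
  proof -
    have e0: "e \<noteq> 0" using that(2) zero_notin_E by metis
    have "\<exists>c. \<forall>a\<in>topspace Q. \<forall>t\<ge>opoint c. \<phi> (a, t) \<in> beyond e g" for g
    proof (intro exI[of _ "C (max g g0)"] ballI allI impI)
      fix a t assume a: "a \<in> topspace Q" and t: "opoint (C (max g g0)) \<le> t"
      have m: "omega0 < max g g0" by (rule less_le_trans[OF g00]) simp
      have "far a e (max g g0)" using that(1) a m by (auto simp: F_def)
      from far_t[OF m a this t that(2)] show "\<phi> (a, t) \<in> beyond e g"
        using beyond_mono[OF that(2), of g "max g g0"] by auto
    qed
    then show ?thesis using e0 by (simp add: tends_def)
  qed
  consider "topspace Q \<subseteq> Of" | "topspace Q \<subseteq> F 1" | "topspace Q \<subseteq> R"
  proof -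
    have "Of = {} \<or> F 1 \<union> R = {}"
      using conn O_closed closedin_Un[OF F_closed[of 1] R] cover OFR unfolding connected_space_closedin R_def[symmetric] by metis
    then show thesis
    proof
      assume 1: "Of = {}"
      then have "topspace Q \<subseteq> F 1 \<union> R" using cover by (simp add: R_def)
      then have "F 1 = {} \<or> R = {}"
        using conn F_closed[of 1] R F1R unfolding connected_space_closedin by metis
      then show thesis using that \<open>topspace Q \<subseteq> F 1 \<union> R\<close> by auto
    next
      assume "F 1 \<union> R = {}"
      then show thesis using that cover by (simp add: R_def)
    qed
  qed
  then show ?thesis
  proof cases
    case 1
    define g where "g = max g1 (C g1)"
    have "\<phi> (a, t) \<in> obox g" if a: "a \<in> topspace Q" and t: "opoint g \<le> t" for a t
    proof -
      have "a \<in> K" using 1 OK a by blast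
      then have f: "fin a g1" using box_obox[OF g1] by (auto simp: K_def fin_def)
      have "opoint (C g1) \<le> opoint g" by (simp add: opoint_mono g_def)
      then have "\<phi> (a, t) = \<phi> (a, opoint (C g1))" using fin_t[OF g10 a f order_trans[OF _ t]] by simp
      then show ?thesis using f obox_mono[of g1 g] by (auto simp: fin_def g_def)
    qed
    then have "tends Q \<phi> 0" by (auto simp: tends_def)
    then show ?thesis by blast
  next
    case 2
    then show ?thesis using far_tends[OF 2 one_E] by auto
  next
    case 3
    then have "-1 \<in> E" using ne by (auto simp: R_def split: if_splits)
    then show ?thesis using far_tends[of "-1"] 3 by (auto simp: R_def)
  qed
qed


text \<open>The chart is rescaled affinely. It attains every value by the intermediate value
  theorem, and its inverse is continuous because it preserves the order.\<close>

lemma box_chart: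
  assumes g: "omega0 < g"
  defines "l \<equiv> (if -1 \<in> E then -1 else 0 :: real)"
  shows "\<exists>w v. continuous_on UNIV w \<and> continuous_on {l..1} v \<and> (\<forall>x\<in>box g. w x \<in> {l..1} \<and> v (w x) = x) \<and>
    (\<forall>s\<in>{l..1}. v s \<in> box g \<and> w (v s) = s) \<and> w (hi g) = 1 \<and> w (lo g) = l"
proof -
  let ?c = "chart g"
  have lh: "lo g < hi g" using lo_origin[of g] lo_hi(1)[OF g] by simp
  define m where "m = (1 - l) / (?c (hi g) - ?c (lo g))"
  have c: "?c (lo g) < ?c (hi g)" using chart(3)[OF g, of "lo g" "hi g"] lh by simp
  have l: "l < 1" by (simp add: l_def)
  have m: "0 < m" using c l by (simp add: m_def)
  define w where "w = (\<lambda>x. l + m * (?c x - ?c (lo g)))"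
  have wlo: "w (lo g) = l" by (simp add: w_def)
  have whi: "w (hi g) = 1" using c by (simp add: w_def m_def)
  have wc: "continuous_on UNIV w" unfolding w_def by (intro continuous_intros chart(1)[OF g])
  have wmono: "w x < w y \<longleftrightarrow> x < y" if "x \<in> box g" "y \<in> box g" for x y
  proof -
    have "w x < w y \<longleftrightarrow> ?c x < ?c y" using m by (simp add: w_def)
    also have "\<dots> \<longleftrightarrow> x < y"
      using chart(3)[OF g, of x y] chart(2)[OF g, of y x] that by (meson atLeastAtMost_iff not_less)
    finally show ?thesis .
  qed
  have wle: "w x \<le> w y \<longleftrightarrow> x \<le> y" if "x \<in> box g" "y \<in> box g" for x y
    using wmono[OF that(2,1)] by (simp add: not_less[symmetric])
  have ends: "lo g \<in> box g" "hi g \<in> box g" using lh by auto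
  have wr: "w x \<in> {l..1}" if "x \<in> box g" for x
    using wle[OF ends(1) that] wle[OF that ends(2)] that wlo whi by auto
  have "\<exists>x\<in>box g. w x = s" if "s \<in> {l..1}" for s
  proof -
    have "\<exists>x. lo g \<le> x \<and> x \<le> hi g \<and> w x = s"
      by (rule IVT') (use that wlo whi lh continuous_on_subset[OF wc] in auto)
    then obtain x where "lo g \<le> x" "x \<le> hi g" "w x = s" by blast
    then show ?thesis by (intro bexI[of _ x]) auto
  qed
  then obtain v where v: "\<And>s. s \<in> {l..1} \<Longrightarrow> v s \<in> box g \<and> w (v s) = s" by metis
  have vw: "v (w x) = x" if "x \<in> box g" for x
  proof -
    have "v (w x) \<in> box g" "w (v (w x)) = w x" using v[OF wr[OF that]] by auto
    then show ?thesis using wle[of "v (w x)" x] wle[of x "v (w x)"] that by (auto intro: antisym)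
  qed
  have "continuous_on {l..1} v"
  proof (rule continuous_on_generate_topology[OF open_generated_order])
    fix B :: "'x set" assume "B \<in> range (\<lambda>a. {..<a}) \<union> range greaterThan"
    then consider b where "B = {..<b}" | b where "B = {b<..}" by auto
    then show "\<exists>C. open C \<and> C \<inter> {l..1} = v -` B \<inter> {l..1}"
    proof cases
      case 1
      consider "b \<le> lo g" | "b \<in> box g" | "hi g < b" by fastforce
      then show ?thesis
      proof cases
        case 1
        then have "v -` B \<inter> {l..1} = {}" using v \<open>B = {..<b}\<close> by fastforce
        then show ?thesis by (intro exI[of _ "{}"]) simp
      next
        case 2
        then have "v s < b \<longleftrightarrow> s < w b" if "s \<in> {l..1}" for s using wmono[of "v s" b] v[OF that] by auto
        then show ?thesis using \<open>B = {..<b}\<close> by (intro exI[of _ "{..<w b}"]) auto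
      next
        case 3
        then have "v -` B \<inter> {l..1} = {l..1}" using v \<open>B = {..<b}\<close> by fastforce
        then show ?thesis by (intro exI[of _ UNIV]) simp
      qed
    next
      case 2
      consider "b < lo g" | "b \<in> box g" | "hi g \<le> b" by fastforce
      then show ?thesis
      proof cases
        case 1
        then have "v -` B \<inter> {l..1} = {l..1}" using v \<open>B = {b<..}\<close> by fastforce
        then show ?thesis by (intro exI[of _ UNIV]) simp
      next
        case 2
        then have "b < v s \<longleftrightarrow> w b < s" if "s \<in> {l..1}" for s using wmono[of b "v s"] v[OF that] by auto
        then show ?thesis using \<open>B = {b<..}\<close> by (intro exI[of _ "{w b<..}"]) auto
      next
        case 3
        then have "v -` B \<inter> {l..1} = {}" using v \<open>B = {b<..}\<close> by fastforce
        then show ?thesis by (intro exI[of _ "{}"]) simp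
      qed
    qed
  qed
  then show ?thesis using wc wr vw v whi wlo by (intro exI[of _ w] exI[of _ v]) simp
qed

lemma box_separable:
  assumes g: "omega0 < g"
  shows "\<exists>D. countable D \<and> D \<subseteq> box g \<and> (top_of_set (box g)) closure_of D = box g"
proof -
  define l where "l = (if -1 \<in> E then -1 else 0 :: real)"
  obtain w v where w: "continuous_on UNIV w" "continuous_on {l..1} v" "\<forall>x\<in>box g. w x \<in> {l..1} \<and> v (w x) = x"
    "\<forall>s\<in>{l..1}. v s \<in> box g \<and> w (v s) = s" using box_chart[OF g] unfolding l_def by blast
  obtain T where T: "countable T" "T \<subseteq> {l..1}" "{l..1} \<subseteq> closure T" using separable by blast
  have "continuous_map (top_of_set {l..1}) (top_of_set (box g)) v" using w by auto
  from continuous_map_image_closure_subset[OF this, of T]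
  have "v ` (top_of_set {l..1} closure_of T) \<subseteq> top_of_set (box g) closure_of (v ` T)" .
  moreover have "top_of_set {l..1} closure_of T = {l..1}"
    using T by (auto simp: closure_of_subtopology Int_absorb1)
  moreover have "box g \<subseteq> v ` {l..1}" using w by force
  ultimately have "box g \<subseteq> top_of_set (box g) closure_of (v ` T)" by blast
  moreover have "top_of_set (box g) closure_of (v ` T) \<subseteq> box g" by (metis closure_of_subset_topspace topspace_euclidean_subtopology)
  ultimately show ?thesis using T w by (intro exI[of _ "v ` T"]) auto
qed

subsection \<open>Faces of large cubes\<close>

definition cube :: "nat \<Rightarrow> omega1 \<Rightarrow> (nat \<Rightarrow> 'x) topology" where
  "cube n g = product_topology (\<lambda>_. top_of_set (box g)) {1..n}"

lemma topspace_cube: "topspace (cube n g) = {1..n} \<rightarrow>\<^sub>E box g"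
  by (simp add: cube_def)

lemma connected_cube: "connected_space (cube n g)"
proof -
  have "connected_space (top_of_set (box g))"
    using connected_Icc[of "lo g" "hi g"] connectedin_iff_connected[of "box g"] by (simp add: connectedin_def)
  then show ?thesis unfolding cube_def connected_space_product_topology by blast
qed

lemma cube_separable:
  assumes "omega0 < g"
  shows "\<exists>D. countable D \<and> D \<subseteq> topspace (cube n g) \<and> cube n g closure_of D = topspace (cube n g)"
proof -
  obtain D where D: "countable D" "D \<subseteq> box g" "(top_of_set (box g)) closure_of D = box g" using box_separable[OF assms] by blast
  have "cube n g closure_of ({1..n} \<rightarrow>\<^sub>E D) = topspace (cube n g)"
    unfolding topspace_cube unfolding cube_def closure_of_product_topology D(3) ..
  moreover have "countable ({1..n} \<rightarrow>\<^sub>E D)" using D(1) by (intro countable_PiE) auto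
  moreover have "({1..n} \<rightarrow>\<^sub>E D) \<subseteq> topspace (cube n g)" unfolding topspace_cube by (intro PiE_mono D(2))
  ultimately show ?thesis by blast
qed

text \<open>A path that runs out along all axes with a nonzero label at once; started in the open
  cube of size \<open>r\<close>, it reaches the face of label \<open>A\<close> at parameter
  \<open>opoint r\<close>.\<close>

definition ray :: "nat \<Rightarrow> (nat \<Rightarrow> int) \<Rightarrow> (nat \<Rightarrow> 'x) \<Rightarrow> half_long_line \<Rightarrow> nat \<Rightarrow> 'x" where
  "ray n A a t = (\<lambda>i\<in>{1..n}. if A i = 0 then a i else \<iota> (A i) t)"

definition labels :: "nat \<Rightarrow> (nat \<Rightarrow> int) set" where "labels n = ({1..n} \<rightarrow>\<^sub>E insert 0 E)"

definition lab :: "omega1 \<Rightarrow> 'x \<Rightarrow> int" where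
  "lab r x = (if x = hi r then 1 else if -1 \<in> E \<and> x = lo r then -1 else 0)"

text \<open>Every point of the cube lies in exactly one open face. On the half-long line a
  coordinate 0 counts as free, so the walls there do not form faces of their own.\<close>

definition face :: "nat \<Rightarrow> omega1 \<Rightarrow> (nat \<Rightarrow> int) \<Rightarrow> (nat \<Rightarrow> 'x) set" where
  "face n r A = {x \<in> {1..n} \<rightarrow>\<^sub>E box r. \<forall>i\<in>{1..n}. lab r (x i) = A i}"

lemma labelsD: "A \<in> labels n \<Longrightarrow> i \<in> {1..n} \<Longrightarrow> A i \<noteq> 0 \<Longrightarrow> A i \<in> E"
  by (auto simp: labels_def)

lemma labels_ext: "A \<in> labels n \<Longrightarrow> B \<in> labels n \<Longrightarrow> (\<And>i. i \<in> {1..n} \<Longrightarrow> A i = B i) \<Longrightarrow> A = B"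
  unfolding labels_def by (rule PiE_ext)

lemma topspace_power [simp]: "topspace (power_topology (euclidean :: 'x topology) n) = {1..n} \<rightarrow>\<^sub>E UNIV"
  by (simp add: power_topology_def)

lemma continuous_map_ray:
  assumes A: "A \<in> labels n" and a: "continuous_map Z (power_topology euclidean n) a" and t: "continuous_map Z euclidean t"
  shows "continuous_map Z (power_topology (euclidean :: 'x topology) n) (\<lambda>z. ray n A (a z) (t z))"
proof -
  have "continuous_map Z euclidean (\<lambda>z. if A i = 0 then a z i else \<iota> (A i) (t z))" if i: "i \<in> {1..n}" for i
  proof (cases "A i = 0")
    case True
    have "continuous_map (power_topology (euclidean :: 'x topology) n) euclidean (\<lambda>x. x i)"
      unfolding power_topology_def using i by (rule continuous_map_product_projection)
    from continuous_map_compose[OF a this] show ?thesis using True by (simp add: o_def)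
  next
    case False
    have "continuous_map euclidean euclidean (\<iota> (A i))" using end_continuous labelsD[OF A i False] by simp
    from continuous_map_compose[OF t this] show ?thesis using False by (simp add: o_def)
  qed
  then show ?thesis unfolding power_topology_def ray_def by (auto simp: continuous_map_componentwise)
qed

lemma lab_obox: "omega0 < r \<Longrightarrow> x \<in> obox r \<Longrightarrow> lab r x = 0"
  by (auto simp: lab_def obox_def)

lemma lab_0_obox: "x \<in> box r \<Longrightarrow> lab r x = 0 \<Longrightarrow> x \<in> obox r"
  by (auto simp: lab_def obox_def split: if_splits)

lemma lab_end: "omega0 < r \<Longrightarrow> e \<in> E \<Longrightarrow> lab r (\<iota> e (opoint r)) = e"
  using E_cases[of e] lo_hi(1)[of r] lo_origin[of r] by (auto simp: lab_def hi_def lo_def)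

lemma lab_eq_end: "lab r x = e \<Longrightarrow> e \<noteq> 0 \<Longrightarrow> x = \<iota> e (opoint r) \<and> e \<in> E"
  by (auto simp: lab_def hi_def lo_def split: if_splits)

lemma end_in_box: "e \<in> E \<Longrightarrow> t \<le> opoint r \<Longrightarrow> \<iota> e t \<in> box r"
proof -
  assume e: "e \<in> E" and t: "t \<le> opoint r"
  consider "e = 1" | "e = -1" "-1 \<in> E" using E_cases e by blast
  then show "\<iota> e t \<in> box r"
  proof cases
    case 1
    then show ?thesis using end_le(1)[OF t] end_le(1)[OF zero_half_long_line_le[of t]] lo_origin[of r] by (auto simp: hi_def origin_def)
  next
    case 2
    then show ?thesis using end_le(2)[OF 2(2) t] end_le(2)[OF 2(2) zero_half_long_line_le[of t]] end_0[OF 2(2)] hi_origin[of r]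
      by (auto simp: lo_def origin_def)
  qed
qed

lemma end_in_obox:
  assumes "e \<in> E" "t < opoint r" shows "\<iota> e t \<in> obox r"
proof -
  have b: "\<iota> e t \<in> box r" using end_in_box assms by simp
  have r: "omega0 < r" using le_less_trans[OF zero_half_long_line_le[of t] assms(2)] opoint_mono(2)[of omega0 r] by (simp add: opoint_0)
  consider "e = 1" | "e = -1" "-1 \<in> E" using E_cases assms(1) by blast
  then show ?thesis
  proof cases
    case 1
    have "origin \<le> \<iota> 1 t" unfolding origin_def by (rule end_le) (rule zero_half_long_line_le)
    then show ?thesis using end_mono[OF assms(2)] lo_hi(2)[OF _ r] 1 by (auto simp: obox_def hi_def)
  next
    case 2
    have "\<iota> (-1) t \<le> origin" unfolding origin_def using end_le(2)[OF 2(2) zero_half_long_line_le[of t]] end_0[OF 2(2)] by simp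
    then show ?thesis using end_antimono[OF 2(2) assms(2)] lo_hi(1)[OF r] 2 by (auto simp: obox_def lo_def)
  qed
qed

lemma ray_in_face:
  assumes r: "omega0 < r" and A: "A \<in> labels n" and a: "\<And>i. i \<in> {1..n} \<Longrightarrow> A i = 0 \<Longrightarrow> a i \<in> obox r"
  shows "ray n A a (opoint r) \<in> face n r A"
  unfolding face_def
proof (intro CollectI conjI ballI PiE_I)
  fix i assume i: "i \<in> {1..n}"
  show "ray n A a (opoint r) i \<in> box r"
    using i a[OF i] obox_box[of r] end_in_box[OF labelsD[OF A i], of "opoint r" r] by (auto simp: ray_def)
  show "lab r (ray n A a (opoint r) i) = A i"
    using i lab_obox[OF r a[OF i]] lab_end[OF r labelsD[OF A i]] by (auto simp: ray_def)
qed (auto simp: ray_def)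

lemma face_nonempty: "omega0 < r \<Longrightarrow> A \<in> labels n \<Longrightarrow> face n r A \<noteq> {}"
  using ray_in_face[of r A n "\<lambda>_. origin"] origin_obox by blast

lemma face_disjoint: "x \<in> face n r A \<Longrightarrow> x \<in> face n r B \<Longrightarrow> A \<in> labels n \<Longrightarrow> B \<in> labels n \<Longrightarrow> A = B"
  by (rule labels_ext) (auto simp: face_def)

lemma face_topspace: "face n r A \<subseteq> {1..n} \<rightarrow>\<^sub>E UNIV"
  by (auto simp: face_def)

lemma labels_of_point:
  assumes "x \<in> {1..n} \<rightarrow>\<^sub>E box r"
  shows "(\<lambda>i\<in>{1..n}. lab r (x i)) \<in> labels n" "x \<in> face n r (\<lambda>i\<in>{1..n}. lab r (x i))"
  using assms by (auto simp: labels_def face_def lab_def)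

lemma face_ray:
  assumes "x \<in> face n r A" shows "ray n A x (opoint r) = x"
proof
  fix i
  show "ray n A x (opoint r) i = x i"
  proof (cases "i \<in> {1..n}")
    case True
    then have "lab r (x i) = A i" using assms by (simp add: face_def)
    then show ?thesis using True lab_eq_end[of r "x i" "A i"] by (auto simp: ray_def)
  next
    case False
    then show ?thesis using assms by (auto simp: face_def ray_def PiE_def extensional_def)
  qed
qed

text \<open>The order is dense, so every neighbourhood of \<open>opoint r\<close> contains smaller
  points.\<close>

lemma left_limit_closed:
  assumes cl: "closedin Y S" and f: "continuous_map euclidean Y f" and r: "0 < opoint r"
    and h: "\<And>t. t < opoint r \<Longrightarrow> f t \<in> S"
  shows "f (opoint r) \<in> S"
proof (rule ccontr)
  assume n: "f (opoint r) \<notin> S"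
  have "closedin euclidean {t \<in> topspace euclidean. f t \<in> S}" by (rule closedin_continuous_map_preimage[OF f cl])
  then have "open (- {t. f t \<in> S})" by (simp add: closed_closedin[symmetric] open_closed)
  then obtain b where b: "b < opoint r" "{b<..opoint r} \<subseteq> - {t. f t \<in> S}"
    using open_left[of "- {t. f t \<in> S}" "opoint r" 0] n r by auto
  obtain t where "b < t" "t < opoint r" using dense[OF b(1)] by blast
  then show False using b(2) h[of t] by (auto simp: subset_iff)
qed

lemma cube_exhausts:
  assumes r: "\<forall>b<r. \<exists>c<r. b < c" "omega0 < r" and a: "a \<in> {1..n} \<rightarrow>\<^sub>E obox r"
  shows "\<exists>b<r. omega0 < b \<and> a \<in> topspace (cube n b)"
proof -
  have "\<exists>b<r. omega0 < b \<and> (\<forall>i\<in>S. a i \<in> box b)" if "finite S" "S \<subseteq> {1..n}" for S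
    using that
  proof (induction S)
    case empty
    then show ?case using r by blast
  next
    case (insert i S)
    then obtain b where b: "b < r" "omega0 < b" "\<forall>i\<in>S. a i \<in> box b" by blast
    have "a i \<in> obox r" using a insert.prems by auto
    then obtain c where c: "c < r" "omega0 < c" "a i \<in> box c" using obox_limit[OF r] by blast
    show ?case
      using b c box_mono[of b "max b c"] box_mono[of c "max b c"]
      by (intro exI[of _ "max b c"]) (auto simp: less_max_iff_disj)
  qed
  from this[of "{1..n}"] show ?thesis using a by (auto simp: topspace_cube PiE_iff)
qed


lemma continuous_map_cube_incl: "continuous_map (cube n g) (power_topology (euclidean :: 'x topology) n) (\<lambda>x. x)"
proof -
  have "continuous_map (cube n g) euclidean (\<lambda>x. x i)" if "i \<in> {1..n}" for i
    using continuous_map_into_fulltopology[OF continuous_map_product_projection[OF that, of "\<lambda>_. top_of_set (box g)"]]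
    unfolding cube_def .
  then show ?thesis unfolding power_topology_def by (auto simp: continuous_map_componentwise topspace_cube PiE_def)
qed

text \<open>The trichotomy is applied to each coordinate of the image of the rays over a cube. The
  outcome is the same for all sizes, because all cubes share the point with every coordinate at the
  origin.\<close>

lemma face_kind:
  fixes f :: "(nat \<Rightarrow> 'x) \<Rightarrow> nat \<Rightarrow> 'x"
  assumes f: "continuous_map (power_topology euclidean n) (power_topology euclidean n) f" and A: "A \<in> labels n"
  shows "\<exists>B\<in>labels n. \<forall>j\<in>{1..n}. \<forall>b>omega0. tends (cube n b) (\<lambda>z. f (ray n A (fst z) (snd z)) j) (B j)"
proof -
  let ?\<phi> = "\<lambda>j z. f (ray n A (fst z) (snd z)) j"
  define a0 :: "nat \<Rightarrow> 'x" where "a0 = (\<lambda>i\<in>{1..n}. origin)"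
  have a0: "a0 \<in> topspace (cube n b)" for b using origin_box by (auto simp: topspace_cube a0_def)
  have tri: "\<exists>e\<in>insert 0 E. tends (cube n b) (?\<phi> j) e" if j: "j \<in> {1..n}" and b: "omega0 < b" for j b
  proof -
    obtain D where D: "countable D" "D \<subseteq> topspace (cube n b)" "cube n b closure_of D = topspace (cube n b)"
      using cube_separable[OF b] by blast
    have "continuous_map (prod_topology (cube n b) euclidean) (power_topology euclidean n) (\<lambda>z. ray n A (fst z) (snd z))"
      using continuous_map_compose[OF continuous_map_fst continuous_map_cube_incl[of n b]]
      by (intro continuous_map_ray[OF A] continuous_map_snd) (simp add: o_def)
    note continuous_map_compose[OF continuous_map_compose[OF this f]
        continuous_map_product_projection[OF j, of "\<lambda>_. euclidean", folded power_topology_def]]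
    then have "continuous_map (prod_topology (cube n b) euclidean) euclidean (?\<phi> j)" by (simp add: o_def)
    then show ?thesis using trichotomy[OF connected_cube _ D(1,3,2)] a0 by blast
  qed
  obtain h where h: "omega0 < h" using omega1_no_max by blast
  have "\<forall>j\<in>{1..n}. \<exists>e\<in>insert 0 E. tends (cube n h) (?\<phi> j) e" using tri h by blast
  then obtain B0 where B0: "\<And>j. j \<in> {1..n} \<Longrightarrow> B0 j \<in> insert 0 E \<and> tends (cube n h) (?\<phi> j) (B0 j)" by metis
  define B where "B = restrict B0 {1..n}"
  have "tends (cube n b) (?\<phi> j) (B j)" if j: "j \<in> {1..n}" and b: "omega0 < b" for j b
  proof -
    obtain e where e: "e \<in> insert 0 E" "tends (cube n b) (?\<phi> j) e" using tri[OF j b] by blast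
    have "e = B0 j" using tends_unique[OF a0 a0 e(1) _ e(2)] B0[OF j] by blast
    then show ?thesis using e j by (simp add: B_def)
  qed
  moreover have "B \<in> labels n" using B0 by (auto simp: labels_def B_def)
  ultimately show ?thesis by blast
qed

text \<open>For the zero label the ray stands still, so its image cannot escape and the bounded case
  remains.\<close>

lemma image_bounded:
  fixes f :: "(nat \<Rightarrow> 'x) \<Rightarrow> nat \<Rightarrow> 'x"
  assumes f: "continuous_map (power_topology euclidean n) (power_topology euclidean n) f" and j: "j \<in> {1..n}" and b: "omega0 < b"
  shows "\<exists>g. \<forall>a\<in>topspace (cube n b). f a j \<in> obox g"
proof -
  define Z :: "nat \<Rightarrow> int" where "Z = (\<lambda>i\<in>{1..n}. 0)"
  have Z: "Z \<in> labels n" by (auto simp: Z_def labels_def)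
  obtain B where B: "tends (cube n b) (\<lambda>z. f (ray n Z (fst z) (snd z)) j) (B j)" "B \<in> labels n"
    using face_kind[OF f Z] j b by blast
  have ray: "ray n Z a t = a" if "a \<in> topspace (cube n b)" for a t
    using that by (intro ext) (auto simp: ray_def Z_def topspace_cube PiE_def extensional_def)
  have "B j = 0"
  proof (rule ccontr)
    assume nz: "B j \<noteq> 0"
    define a0 :: "nat \<Rightarrow> 'x" where "a0 = (\<lambda>i\<in>{1..n}. origin)"
    have a0: "a0 \<in> topspace (cube n b)" using origin_box by (auto simp: topspace_cube a0_def)
    obtain g where g: "f a0 j \<in> obox g" using in_some_obox by blast
    have "\<exists>c. \<forall>a\<in>topspace (cube n b). \<forall>t\<ge>opoint c. f (ray n Z (fst (a, t)) (snd (a, t))) j \<in> beyond (B j) g"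
      using B(1) nz by (simp add: tends_def)
    then obtain c where "\<forall>t\<ge>opoint c. f (ray n Z a0 t) j \<in> beyond (B j) g" using a0 by auto
    then have "f a0 j \<in> beyond (B j) g" using ray[OF a0] by auto
    then show False using g beyond_obox[OF labelsD[OF B(2) j nz], of g] by blast
  qed
  then obtain g where "\<forall>a\<in>topspace (cube n b). \<forall>t\<ge>opoint g. f (ray n Z a t) j \<in> obox g"
    using B(1) by (auto simp: tends_def)
  then show ?thesis using ray by (metis order_refl)
qed

text \<open>Take a limit ordinal \<open>r\<close> closed under the bounds for images of smaller
  cubes and under the thresholds of the trichotomy. A point of a face of size \<open>r\<close> is a
  limit of points of smaller cubes, whose images stay inside size \<open>r\<close>; so its image
  lies in the closed cube. The thresholds below \<open>r\<close> then force the label of each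
  coordinate.\<close>

theorem face_map:
  fixes f :: "(nat \<Rightarrow> 'x) \<Rightarrow> nat \<Rightarrow> 'x"
  assumes f: "continuous_map (power_topology euclidean n) (power_topology euclidean n) f" and A: "A \<in> labels n"
  shows "\<exists>B\<in>labels n. eventually (\<lambda>r. f ` face n r A \<subseteq> face n r B) club"
proof -
  obtain B where B: "B \<in> labels n" "\<And>j b. j \<in> {1..n} \<Longrightarrow> omega0 < b \<Longrightarrow> tends (cube n b) (\<lambda>z. f (ray n A (fst z) (snd z)) j) (B j)"
    using face_kind[OF f A] by blast
  have "eventually (\<lambda>r. \<forall>b<r. \<exists>c<r. omega0 < b \<longrightarrow> (\<forall>a\<in>topspace (cube n b). f a j \<in> obox c)) club" if "j \<in> {1..n}" for j
    by (rule eventually_club_closed) (use image_bounded[OF f that] in blast)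
  then have E3: "eventually (\<lambda>r. \<forall>j\<in>{1..n}. \<forall>b<r. \<exists>c<r. omega0 < b \<longrightarrow> (\<forall>a\<in>topspace (cube n b). f a j \<in> obox c)) club"
    by (intro eventually_ball_finite) auto
  let ?R = "\<lambda>j b c. omega0 < b \<longrightarrow> (\<forall>a\<in>topspace (cube n b). \<forall>t\<ge>opoint c. f (ray n A a t) j \<in> (if B j = 0 then obox c else beyond (B j) b))"
  have "\<exists>c. ?R j b c" if j: "j \<in> {1..n}" for j b
  proof (cases "omega0 < b")
    case True
    show ?thesis
    proof (cases "B j = 0")
      case B0: True
      obtain g where "\<forall>a\<in>topspace (cube n b). \<forall>t\<ge>opoint g. f (ray n A a t) j \<in> obox g"
        using B(2)[OF j True] B0 by (auto simp: tends_def)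
      then show ?thesis using B0 by auto
    next
      case False
      have "\<forall>g. \<exists>c. \<forall>a\<in>topspace (cube n b). \<forall>t\<ge>opoint c. f (ray n A a t) j \<in> beyond (B j) g"
        using B(2)[OF j True] False by (simp add: tends_def)
      then show ?thesis using False by auto
    qed
  qed simp
  then have "eventually (\<lambda>r. \<forall>b<r. \<exists>c<r. ?R j b c) club" if "j \<in> {1..n}" for j
    using that by (intro eventually_club_closed) blast
  then have E4: "eventually (\<lambda>r. \<forall>j\<in>{1..n}. \<forall>b<r. \<exists>c<r. ?R j b c) club"
    by (intro eventually_ball_finite) auto
  have "eventually (\<lambda>r. f ` face n r A \<subseteq> face n r B) club"
    using eventually_club_limit eventually_club_gt[of omega0] E3 E4
  proof eventually_elim
    fix r assume lim: "\<forall>b<r. \<exists>c<r. b < c" and r0: "omega0 < r"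
      and e3: "\<forall>j\<in>{1..n}. \<forall>b<r. \<exists>c<r. omega0 < b \<longrightarrow> (\<forall>a\<in>topspace (cube n b). f a j \<in> obox c)"
      and e4: "\<forall>j\<in>{1..n}. \<forall>b<r. \<exists>c<r. ?R j b c"
    have r00: "0 < opoint r" using r0 opoint_mono(2)[of omega0 r] by (simp add: opoint_0)
    show "f ` face n r A \<subseteq> face n r B"
    proof (rule image_subsetI)
      fix x assume x: "x \<in> face n r A"
      have xP: "x \<in> {1..n} \<rightarrow>\<^sub>E UNIV" using x face_topspace by blast
      have fP: "f y \<in> {1..n} \<rightarrow>\<^sub>E UNIV" if "y \<in> {1..n} \<rightarrow>\<^sub>E UNIV" for y
        using continuous_map_image_subset_topspace[OF f] that by (simp add: image_subset_iff Pi_iff)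
      \<comment> \<open>Coordinates at an end are reset to the origin, and the ray restores them at
        \<open>opoint r\<close>.\<close>
      define a where "a = (\<lambda>i\<in>{1..n}. if A i = 0 then x i else origin)"
      have a: "a \<in> {1..n} \<rightarrow>\<^sub>E obox r"
        using x lab_0_obox origin_obox[OF r0] by (auto simp: a_def face_def PiE_iff)
      have ax: "ray n A a (opoint r) = x"
      proof -
        have "ray n A a (opoint r) = ray n A x (opoint r)" by (auto simp: a_def ray_def)
        then show ?thesis using face_ray[OF x] by simp
      qed
      obtain b where b: "b < r" "omega0 < b" "a \<in> topspace (cube n b)" using cube_exhausts[OF lim r0 a] by blast
      have rayo: "ray n A a t \<in> {1..n} \<rightarrow>\<^sub>E obox r" if "t < opoint r" for t
        using a end_in_obox[OF _ that] labelsD[OF A] by (auto simp: ray_def PiE_iff)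
      have box: "f x j \<in> box r" if j: "j \<in> {1..n}" for j
      proof -
        have "f (ray n A a (opoint r)) \<in> {y \<in> topspace (power_topology euclidean n). y j \<in> box r}"
        proof (rule left_limit_closed[OF _ _ r00, of "power_topology euclidean n" _ "\<lambda>t. f (ray n A a t)"])
          show "closedin (power_topology euclidean n) {y \<in> topspace (power_topology euclidean n). y j \<in> box r}"
            unfolding power_topology_def
            by (rule closedin_continuous_map_preimage[OF continuous_map_product_projection[OF j]]) (simp add: closed_closedin[symmetric])
          have "continuous_map euclidean (power_topology euclidean n) (\<lambda>t. ray n A a t)"
            by (rule continuous_map_ray[OF A]) (use a in \<open>auto simp: PiE_def\<close>)
          from continuous_map_compose[OF this f] show "continuous_map euclidean (power_topology euclidean n) (\<lambda>t. f (ray n A a t))"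
            by (simp add: o_def)
          fix t assume "t < opoint r"
          then have ro: "ray n A a t \<in> {1..n} \<rightarrow>\<^sub>E obox r" by (rule rayo)
          then obtain c where c: "c < r" "omega0 < c" "ray n A a t \<in> topspace (cube n c)" using cube_exhausts[OF lim r0] by blast
          then obtain d where "d < r" "f (ray n A a t) j \<in> obox d" using e3 j by blast
          then have "f (ray n A a t) j \<in> box r" using obox_mono[of d r] obox_box[of r] by (meson less_imp_le subsetD)
          moreover have "f (ray n A a t) \<in> {1..n} \<rightarrow>\<^sub>E UNIV" by (rule fP) (use ro in \<open>auto simp: PiE_def\<close>)
          ultimately show "f (ray n A a t) \<in> {y \<in> topspace (power_topology euclidean n). y j \<in> box r}" by simp
        qed
        then show ?thesis using ax by simp
      qed
      have lab: "lab r (f x j) = B j" if j: "j \<in> {1..n}" for j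
      proof (cases "B j = 0")
        case True
        obtain c where c: "c < r" "?R j b c" using e4 j b(1) by blast
        have "f (ray n A a (opoint r)) j \<in> obox c"
          using c(2) b(2,3) True c(1) by (simp add: opoint_mono less_imp_le)
        then have "f x j \<in> obox r" using subsetD[OF obox_mono[of c r]] c(1) ax by (simp add: less_imp_le)
        then show ?thesis using lab_obox[OF r0] True by simp
      next
        case False
        have eE: "B j \<in> E" using labelsD[OF B(1) j False] .
        have "f x j \<in> beyond (B j) b'" if b': "b' < r" for b'
        proof -
          define m where "m = max b b'"
          have m: "m < r" "omega0 < m" using b b' by (auto simp: m_def max_def)
          have am: "a \<in> topspace (cube n m)"
            using b(3) box_mono[of b m] by (auto simp: topspace_cube PiE_iff m_def)
          obtain c where c: "c < r" "?R j m c" using e4 j m(1) by blast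
          have "f (ray n A a (opoint r)) j \<in> beyond (B j) m"
            using c m am False by (simp add: opoint_mono less_imp_le)
          then show ?thesis using beyond_mono[OF eE, of b' m] ax by (auto simp: m_def)
        qed
        then have "f x j = \<iota> (B j) (opoint r)" using beyond_limit[OF lim r0 eE box[OF j]] by blast
        then show ?thesis using lab_end[OF r0 eE] by simp
      qed
      show "f x \<in> face n r B" using fP[OF xP] box lab by (auto simp: face_def PiE_iff)
    qed
  qed
  then show ?thesis using B(1) by blast
qed

end

section \<open>The induced map of faces\<close>

definition extends :: "nat \<Rightarrow> (nat \<Rightarrow> int) \<Rightarrow> (nat \<Rightarrow> int) \<Rightarrow> bool" where
  "extends n A A' \<longleftrightarrow> (\<forall>i\<in>{1..n}. A i \<noteq> 0 \<longrightarrow> A' i = A i)"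

definition single :: "nat \<Rightarrow> nat \<Rightarrow> int \<Rightarrow> nat \<Rightarrow> int" where
  "single n i e = (\<lambda>k\<in>{1..n}. if k = i then e else 0)"

lemma single_extends: "i \<in> {1..n} \<Longrightarrow> extends n (single n i e) A \<longleftrightarrow> e = 0 \<or> A i = e"
  by (auto simp: single_def extends_def)

lemma single_inject: "i \<in> {1..n} \<Longrightarrow> e \<noteq> 0 \<Longrightarrow> single n i e = single n j e' \<Longrightarrow> i = j \<and> e = e'"
  by (auto simp: single_def fun_eq_iff dest!: spec[of _ i] split: if_splits)

context long_space
begin

abbreviation space :: "nat \<Rightarrow> (nat \<Rightarrow> 'x) topology" where "space n \<equiv> power_topology euclidean n"

definition face_fun :: "nat \<Rightarrow> ((nat \<Rightarrow> 'x) \<Rightarrow> nat \<Rightarrow> 'x) \<Rightarrow> (nat \<Rightarrow> int) \<Rightarrow> (nat \<Rightarrow> int)" where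
  "face_fun n f A = (THE B. B \<in> labels n \<and> eventually (\<lambda>r. f ` face n r A \<subseteq> face n r B) club)"

lemma face_fun_unique:
  assumes A: "A \<in> labels n" and B: "B \<in> labels n" "eventually (\<lambda>r. f ` face n r A \<subseteq> face n r B) club"
    and B': "B' \<in> labels n" "eventually (\<lambda>r. f ` face n r A \<subseteq> face n r B') club"
  shows "B = B'"
proof -
  obtain r where r: "omega0 < r" "f ` face n r A \<subseteq> face n r B \<and> f ` face n r A \<subseteq> face n r B'"
    using club_frequently[OF eventually_conj[OF B(2) B'(2)]] by blast
  obtain x where "x \<in> face n r A" using face_nonempty[OF r(1) A] by blast
  then show ?thesis using r(2) face_disjoint B(1) B'(1) by blast
qed

lemma face_fun_eqI:
  assumes "A \<in> labels n" "B \<in> labels n" "eventually (\<lambda>r. f ` face n r A \<subseteq> face n r B) club"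
  shows "face_fun n f A = B"
  unfolding face_fun_def by (rule the_equality) (use assms face_fun_unique[OF assms(1)] in blast)+

lemma face_fun:
  assumes "continuous_map (space n) (space n) f" "A \<in> labels n"
  shows "face_fun n f A \<in> labels n" "eventually (\<lambda>r. f ` face n r A \<subseteq> face n r (face_fun n f A)) club"
proof -
  obtain B where B: "B \<in> labels n" "eventually (\<lambda>r. f ` face n r A \<subseteq> face n r B) club" using face_map[OF assms] by blast
  then have "face_fun n f A = B" by (rule face_fun_eqI[OF assms(2)])
  then show "face_fun n f A \<in> labels n" "eventually (\<lambda>r. f ` face n r A \<subseteq> face n r (face_fun n f A)) club" using B by auto
qed

lemma face_fun_compose:
  assumes f: "continuous_map (space n) (space n) f" and g: "continuous_map (space n) (space n) g" and A: "A \<in> labels n"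
    and h: "\<And>x. x \<in> topspace (space n) \<Longrightarrow> h x = g (f x)"
  shows "face_fun n h A = face_fun n g (face_fun n f A)"
proof (rule face_fun_eqI[OF A])
  show "face_fun n g (face_fun n f A) \<in> labels n" by (intro face_fun f g A)
  show "eventually (\<lambda>r. h ` face n r A \<subseteq> face n r (face_fun n g (face_fun n f A))) club"
    using face_fun(2)[OF f A] face_fun(2)[OF g face_fun(1)[OF f A]]
  proof eventually_elim
    fix r assume "f ` face n r A \<subseteq> face n r (face_fun n f A)"
      "g ` face n r (face_fun n f A) \<subseteq> face n r (face_fun n g (face_fun n f A))"
    moreover have "h x = g (f x)" if "x \<in> face n r A" for x using h[of x] subsetD[OF face_topspace that] by simp
    ultimately show "h ` face n r A \<subseteq> face n r (face_fun n g (face_fun n f A))" by (auto simp: image_subset_iff)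
  qed
qed

lemma face_fun_id:
  assumes "A \<in> labels n" "\<And>x. x \<in> topspace (space n) \<Longrightarrow> f x = x"
  shows "face_fun n f A = A"
proof (rule face_fun_eqI[OF assms(1,1)])
  have "f ` face n r A \<subseteq> face n r A" for r using assms(2) face_topspace[of n r A] by (auto simp: subset_iff)
  then show "eventually (\<lambda>r. f ` face n r A \<subseteq> face n r A) club" by simp
qed

lemma extends_antisym: "A \<in> labels n \<Longrightarrow> B \<in> labels n \<Longrightarrow> extends n A B \<Longrightarrow> extends n B A \<Longrightarrow> A = B"
  by (rule labels_ext[of A n B]; (assumption | metis extends_def))

lemma labels_mem: "A \<in> labels n \<Longrightarrow> i \<in> {1..n} \<Longrightarrow> A i \<in> insert 0 E"
  unfolding labels_def by (rule PiE_mem)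

text \<open>A face lies in the closure of another one iff its label extends the other label.\<close>

lemma face_fun_mono:
  assumes f: "continuous_map (space n) (space n) f" and A: "A \<in> labels n" "A' \<in> labels n" "extends n A A'"
  shows "extends n (face_fun n f A) (face_fun n f A')"
proof -
  let ?B = "face_fun n f A" and ?B' = "face_fun n f A'"
  obtain r where r0: "omega0 < r" and r: "f ` face n r A \<subseteq> face n r ?B" "f ` face n r A' \<subseteq> face n r ?B'"
    using club_frequently[OF eventually_conj[OF face_fun(2)[OF f A(1)] face_fun(2)[OF f A(2)]]] by blast
  have r00: "0 < opoint r" using r0 opoint_mono(2)[of omega0 r] by (simp add: opoint_0)
  \<comment> \<open>The path keeps the coordinates labelled by \<open>A\<close> at their ends and
    moves only along the ends that \<open>A'\<close> adds, collected in \<open>A''\<close>. It runs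
    in the face of \<open>A\<close> before \<open>opoint r\<close> and lands in the face of
    \<open>A'\<close>.\<close>
  define c :: "nat \<Rightarrow> 'x" where "c = (\<lambda>i\<in>{1..n}. if A' i = 0 then origin else \<iota> (A' i) (opoint r))"
  define A'' where "A'' = (\<lambda>i\<in>{1..n}. if A i = 0 then A' i else 0)"
  have A'': "A'' \<in> labels n"
    unfolding A''_def labels_def using labels_mem[OF A(2)] by (simp add: restrict_PiE_iff del: atLeastAtMost_iff)
  let ?x = "\<lambda>t. ray n A'' c t"
  have xA: "?x t \<in> face n r A" if t: "t < opoint r" for t
    unfolding face_def
  proof (intro CollectI conjI ballI PiE_I)
    fix i assume i: "i \<in> {1..n}"
    have eq: "A i \<noteq> 0 \<Longrightarrow> A i = A' i" using A(3) i unfolding extends_def by metis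
    consider "A' i = 0" "A i = 0" | "A' i \<noteq> 0" "A i = 0" | "A' i \<noteq> 0" "A i = A' i"
    proof (cases "A i = 0")
      case True
      then show thesis using that(1,2) by blast
    next
      case False
      then show thesis using that(3) eq[OF False] by metis
    qed
    then have "?x t i \<in> box r \<and> lab r (?x t i) = A i"
    proof cases
      case 1
      then show ?thesis using i origin_box[of r] lab_obox[OF r0 origin_obox[OF r0]] by (simp add: ray_def A''_def c_def del: atLeastAtMost_iff)
    next
      case 2
      have "?x t i = \<iota> (A' i) t" using 2 i by (simp add: ray_def A''_def)
      moreover have "\<iota> (A' i) t \<in> obox r" using end_in_obox[OF labelsD[OF A(2) i 2(1)] t] .
      ultimately show ?thesis using 2 lab_obox[OF r0] subsetD[OF obox_box] by metis
    next
      case 3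
      have "?x t i = \<iota> (A' i) (opoint r)" using 3 i by (simp add: ray_def A''_def c_def)
      then show ?thesis using 3 lab_end[OF r0 labelsD[OF A(2) i 3(1)]] end_in_box[OF labelsD[OF A(2) i 3(1)] order_refl, of r] by metis
    qed
    then show "?x t i \<in> box r" "lab r (?x t i) = A i" by blast+
  qed (auto simp: ray_def)
  have "?x (opoint r) = ray n A' (\<lambda>_. origin) (opoint r)"
    using A(3) by (auto simp: ray_def A''_def c_def extends_def)
  then have xA': "?x (opoint r) \<in> face n r A'"
    using ray_in_face[OF r0 A(2), of "\<lambda>_. origin"] origin_obox[OF r0] by simp
  show ?thesis
    unfolding extends_def
  proof (intro ballI impI)
    fix j assume j: "j \<in> {1..n}" and nz: "?B j \<noteq> 0"
    \<comment> \<open>Before \<open>opoint r\<close> this coordinate of the image is constantly an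
      end of the box, hence also in the limit.\<close>
    have "f (?x (opoint r)) \<in> {y \<in> topspace (space n). y j \<in> {\<iota> (?B j) (opoint r)}}"
    proof (rule left_limit_closed[OF _ _ r00, of "space n" _ "\<lambda>t. f (?x t)"])
      show "closedin (space n) {y \<in> topspace (space n). y j \<in> {\<iota> (?B j) (opoint r)}}"
        unfolding power_topology_def
        by (rule closedin_continuous_map_preimage[OF continuous_map_product_projection[OF j]]) (simp add: closed_closedin[symmetric])
      have "continuous_map euclidean (space n) ?x"
        by (rule continuous_map_ray[OF A'']) (auto simp: c_def)
      from continuous_map_compose[OF this f] show "continuous_map euclidean (space n) (\<lambda>t. f (?x t))" by (simp add: o_def)
      fix t assume "t < opoint r"
      then have "f (?x t) \<in> face n r ?B" using xA r(1) by blast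
      then have "f (?x t) \<in> topspace (space n)" "lab r (f (?x t) j) = ?B j" using face_topspace j by (auto simp: face_def)
      then show "f (?x t) \<in> {y \<in> topspace (space n). y j \<in> {\<iota> (?B j) (opoint r)}}" using lab_eq_end nz by blast
    qed
    then have "f (?x (opoint r)) j = \<iota> (?B j) (opoint r)" by simp
    moreover have "f (?x (opoint r)) \<in> face n r ?B'" using xA' r(2) by blast
    then have "lab r (f (?x (opoint r)) j) = ?B' j" using j unfolding face_def by blast
    ultimately show "?B' j = ?B j" using lab_end[OF r0 labelsD[OF face_fun(1)[OF f A(1)] j nz]] by simp
  qed
qed

lemma single_labels: "e \<in> E \<Longrightarrow> single n i e \<in> labels n"
  by (auto simp: single_def labels_def)

context
  fixes n :: nat and f f' :: "(nat \<Rightarrow> 'x) \<Rightarrow> nat \<Rightarrow> 'x"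
  assumes f: "continuous_map (space n) (space n) f" and f': "continuous_map (space n) (space n) f'"
    and inv: "\<And>x. x \<in> topspace (space n) \<Longrightarrow> f' (f x) = x" "\<And>x. x \<in> topspace (space n) \<Longrightarrow> f (f' x) = x"
begin

lemma face_fun_inverse:
  assumes "A \<in> labels n"
  shows "face_fun n f' (face_fun n f A) = A" "face_fun n f (face_fun n f' A) = A"
proof -
  show "face_fun n f' (face_fun n f A) = A"
    using face_fun_compose[OF f f' assms, of "f' \<circ> f"] face_fun_id[OF assms, of "f' \<circ> f"] inv by simp
  show "face_fun n f (face_fun n f' A) = A"
    using face_fun_compose[OF f' f assms, of "f \<circ> f'"] face_fun_id[OF assms, of "f \<circ> f'"] inv by simp
qed

text \<open>The induced map is an automorphism of the incidence order, whose least element is the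
  zero label and whose atoms are the labels with one nonzero entry. An atom below the image of an
  atom pulls back to a nonzero label below that atom, hence to the atom itself.\<close>

lemma face_fun_single_ex:
  assumes i: "i \<in> {1..n}" and e: "e \<in> E"
  shows "\<exists>j\<in>{1..n}. \<exists>d\<in>E. face_fun n f (single n i e) = single n j d"
proof -
  let ?J = "face_fun n f" and ?J' = "face_fun n f'"
  have e0: "e \<noteq> 0" using e zero_notin_E by metis
  define Z :: "nat \<Rightarrow> int" where "Z = (\<lambda>i\<in>{1..n}. 0)"
  have Z: "Z \<in> labels n" by (auto simp: Z_def labels_def)
  have Zext: "extends n Z A" for A by (auto simp: Z_def extends_def)
  have sl: "single n i e \<in> labels n" using single_labels[OF e] .
  have Z_of: "A = Z" if "A \<in> labels n" "\<And>j. j \<in> {1..n} \<Longrightarrow> A j = 0" for A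
    by (rule labels_ext[OF that(1) Z]) (use that in \<open>simp add: Z_def\<close>)
  have JZ': "?J' Z = Z"
  proof (rule extends_antisym[OF _ Z _ Zext])
    show "?J' Z \<in> labels n" by (rule face_fun(1)[OF f' Z])
    have "extends n (?J' Z) (?J' (?J Z))" by (rule face_fun_mono[OF f' Z face_fun(1)[OF f Z] Zext])
    then show "extends n (?J' Z) Z" using face_fun_inverse(1)[OF Z] by simp
  qed
  let ?B = "?J (single n i e)"
  have B: "?B \<in> labels n" by (rule face_fun(1)[OF f sl])
  have "?B \<noteq> Z"
  proof
    assume "?B = Z"
    then have "single n i e = Z" using face_fun_inverse(1)[OF sl] JZ' by simp
    then show False using i e0 by (auto simp: single_def Z_def fun_eq_iff dest!: spec[of _ i])
  qed
  then obtain j where j: "j \<in> {1..n}" "?B j \<noteq> 0" using Z_of[OF B] by blast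
  let ?d = "?B j"
  have d: "?d \<in> E" using labelsD[OF B j] .
  have sj: "single n j ?d \<in> labels n" using single_labels[OF d] .
  have "extends n (single n j ?d) ?B" using single_extends[OF j(1)] by simp
  then have "extends n (?J' (single n j ?d)) (single n i e)"
    using face_fun_mono[OF f' sj B] face_fun_inverse(1)[OF sl] by simp
  then have 1: "?J' (single n j ?d) k = 0" if "k \<in> {1..n}" "k \<noteq> i" for k
    using that by (auto simp: extends_def single_def)
  have sub: "?J' (single n j ?d) \<in> labels n" by (rule face_fun(1)[OF f' sj])
  have "?J' (single n j ?d) \<noteq> Z"
  proof
    assume "?J' (single n j ?d) = Z"
    then have "single n j ?d = ?J Z" using face_fun_inverse(2)[OF sj] by simp
    also have "?J Z = Z" using JZ' face_fun_inverse(2)[OF Z] by simp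
    finally show False using j by (auto simp: single_def Z_def fun_eq_iff dest!: spec[of _ j])
  qed
  then have "?J' (single n j ?d) i \<noteq> 0" using 1 Z_of[OF sub] by blast
  then have "?J' (single n j ?d) i = e"
    using \<open>extends n (?J' (single n j ?d)) (single n i e)\<close> i by (auto simp: extends_def single_def)
  then have "?J' (single n j ?d) = single n i e"
    by (intro labels_ext[OF sub sl]) (use 1 in \<open>auto simp: single_def\<close>)
  then have "?B = single n j ?d" using face_fun_inverse(2)[OF sj] by metis
  then show ?thesis using j d by blast
qed

text \<open>Ends of two different axes have a common extension, opposite ends of one axis do not. A
  common extension of the images would pull back to one of the opposite ends.\<close>

lemma face_fun_opposite:
  assumes i: "i \<in> {1..n}" and m1: "-1 \<in> E"
    and a: "face_fun n f (single n i 1) = single n j d" "j \<in> {1..n}" "d \<in> E"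
  shows "face_fun n f (single n i (-1)) = single n j (- d)"
proof -
  let ?J = "face_fun n f" and ?J' = "face_fun n f'"
  obtain k e where k: "k \<in> {1..n}" "e \<in> E" "?J (single n i (-1)) = single n k e"
    using face_fun_single_ex[OF i m1] by blast
  have s: "single n i 1 \<in> labels n" "single n i (-1) \<in> labels n" "single n j d \<in> labels n" "single n k e \<in> labels n"
    using single_labels one_E m1 a k by auto
  have d0: "d \<noteq> 0" "e \<noteq> 0" using a k zero_notin_E by metis+
  have jk: "j = k"
  proof (rule ccontr)
    assume ne: "j \<noteq> k"
    define C where "C = (\<lambda>l\<in>{1..n}. if l = j then d else if l = k then e else 0)"
    have C: "C \<in> labels n" using a k by (auto simp: C_def labels_def)
    have "extends n (single n j d) C" "extends n (single n k e) C" using ne by (auto simp: C_def extends_def single_def)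
    then have "extends n (single n i 1) (?J' C)" "extends n (single n i (-1)) (?J' C)"
      using face_fun_mono[OF f' s(3) C] face_fun_mono[OF f' s(4) C] face_fun_inverse(1)[OF s(1)] face_fun_inverse(1)[OF s(2)] a k by simp_all
    then show False using single_extends[OF i] by auto
  qed
  have "e \<noteq> d"
  proof
    assume "e = d"
    then have "?J (single n i (-1)) = ?J (single n i 1)" using a k jk by simp
    then have "single n i (-1) = single n i 1" using face_fun_inverse(1)[OF s(1)] face_fun_inverse(1)[OF s(2)] by metis
    then show False using single_inject[OF i, of "-1" i 1] by simp
  qed
  then have "e = - d" using E_cases[OF a(3)] E_cases[OF k(2)] by auto
  then show ?thesis using k jk by simp
qed

text \<open>A label is the join of the atoms below it, so a monotone map that fixes the atoms can
  only enlarge labels. The inverse does the same, and antisymmetry gives equality.\<close>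

lemma face_fun_determined:
  assumes s: "\<And>i e. i \<in> {1..n} \<Longrightarrow> e \<in> E \<Longrightarrow> face_fun n f (single n i e) = single n i e" and A: "A \<in> labels n"
  shows "face_fun n f A = A"
proof -
  have gen: "extends n A (face_fun n g A)"
    if g: "continuous_map (space n) (space n) g" "\<And>i e. i \<in> {1..n} \<Longrightarrow> e \<in> E \<Longrightarrow> face_fun n g (single n i e) = single n i e" for g
    unfolding extends_def
  proof (intro ballI impI)
    fix i assume i: "i \<in> {1..n}" "A i \<noteq> 0"
    have e: "A i \<in> E" using labelsD[OF A i] .
    have "extends n (single n i (A i)) A" using single_extends[OF i(1)] by simp
    then have "extends n (single n i (A i)) (face_fun n g A)"
      using face_fun_mono[OF g(1) single_labels[OF e] A] g(2)[OF i(1) e] by metis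
    then show "face_fun n g A i = A i" using single_extends[OF i(1)] i(2) by simp
  qed
  have s': "face_fun n f' (single n i e) = single n i e" if "i \<in> {1..n}" "e \<in> E" for i e
    using s[OF that] face_fun_inverse(1)[OF single_labels[OF that(2)]] by metis
  have "extends n A (face_fun n f' A)" by (rule gen[OF f' s'])
  then have "extends n (face_fun n f A) A"
    using face_fun_mono[OF f A face_fun(1)[OF f' A]] face_fun_inverse(2)[OF A] by simp
  then show ?thesis using gen[OF f s] extends_antisym[OF face_fun(1)[OF f A] A] by blast
qed

end


subsection \<open>Maps of prime order that fix all faces\<close>

text \<open>Induction on the number of free coordinates. Charts turn the closed face into a cube,
  and the proper subfaces, fixed by induction, become what the theorems on cubes ask for: the whole
  boundary if there are two ends, the faces with a coordinate 1 if there is one.\<close>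

lemma face_fixed:
  assumes p: "prime p" and h: "continuous_map (space n) (space n) h" "\<And>x. x \<in> topspace (space n) \<Longrightarrow> (h ^^ p) x = x"
    and r0: "omega0 < r" and inv: "\<And>A. A \<in> labels n \<Longrightarrow> h ` face n r A \<subseteq> face n r A"
    and A: "A \<in> labels n" and x: "x \<in> face n r A"
  shows "h x = x"
  using A x
proof (induction "card {i \<in> {1..n}. A i = 0}" arbitrary: A x rule: less_induct)
  case (less A x)
  let ?Z = "{i \<in> {1..n}. A i = 0}"
  have A: "A \<in> labels n" by fact
  show ?case
  proof (cases "?Z = {}")
    case True
    \<comment> \<open>Without free coordinates the face is a single point.\<close>
    have "ray n A x (opoint r) = ray n A (h x) (opoint r)" using True by (auto simp: ray_def)
    moreover have "h x \<in> face n r A" using inv[OF A] less.prems by blast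
    ultimately show ?thesis using face_ray less.prems by metis
  next
    case False
    then have "card ?Z \<noteq> 0" by simp
    then obtain d where d: "card ?Z = Suc d" using not0_implies_Suc by blast
    obtain b where "bij_betw b {0..<card ?Z} ?Z" using ex_bij_betw_nat_finite[of ?Z] by auto
    then have b: "bij_betw b {..d} ?Z" by (simp only: d atLeast0LessThan lessThan_Suc_atMost)
    define bi where "bi = inv_into {..d} b"
    have bZ: "b k \<in> {1..n}" "A (b k) = 0" "bi (b k) = k" if "k \<le> d" for k
      using b that unfolding bi_def bij_betw_def by (auto simp: inv_into_f_f)
    have biZ: "bi i \<le> d" "b (bi i) = i" if "i \<in> {1..n}" "A i = 0" for i
    proof -
      have "i \<in> b ` {..d}" using b that by (simp add: bij_betw_def)
      then show "bi i \<le> d" "b (bi i) = i" unfolding bi_def using inv_into_into[of i b "{..d}"] f_inv_into_f[of i b "{..d}"] by auto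
    qed
    define l :: real where "l = (if -1 \<in> E then -1 else 0)"
    obtain w v where w: "continuous_on UNIV w" and v: "continuous_on {l..1} v"
      and wv: "\<And>x. x \<in> box r \<Longrightarrow> w x \<in> {l..1} \<and> v (w x) = x" "\<And>s. s \<in> {l..1} \<Longrightarrow> v s \<in> box r \<and> w (v s) = s"
      and we: "w (hi r) = 1" "w (lo r) = l"
      using box_chart[OF r0] unfolding l_def by blast
    \<comment> \<open>The closed face: free coordinates may also sit at an end.\<close>
    define K where "K = {x \<in> {1..n} \<rightarrow>\<^sub>E box r. \<forall>i\<in>{1..n}. A i \<noteq> 0 \<longrightarrow> lab r (x i) = A i}"
    have faceK: "face n r A \<subseteq> K" by (auto simp: K_def face_def)
    have KP: "K \<subseteq> topspace (space n)" by (auto simp: K_def)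
    have fixK: "h x = x" if xK: "x \<in> K" "x \<notin> face n r A" for x
    proof -
      \<comment> \<open>The actual label of \<open>x\<close> properly extends \<open>A\<close>, so
        it has fewer zeros and the induction hypothesis applies.\<close>
      define A' where "A' = (\<lambda>i\<in>{1..n}. lab r (x i))"
      have A': "A' \<in> labels n" "x \<in> face n r A'" unfolding A'_def using xK(1) by (intro labels_of_point; simp add: K_def)+
      have eq: "A' i = A i" if "i \<in> {1..n}" "A i \<noteq> 0" for i using xK(1) that by (simp add: K_def A'_def)
      have "\<exists>i\<in>{1..n}. A' i \<noteq> A i" using xK by (auto simp: K_def face_def A'_def)
      then obtain i where i: "i \<in> {1..n}" "A' i \<noteq> A i" by blast
      have "A i = 0" using eq[OF i(1)] i(2) by blast
      then have "i \<in> ?Z" "i \<notin> {i \<in> {1..n}. A' i = 0}" using i by auto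
      moreover have "{i \<in> {1..n}. A' i = 0} \<subseteq> ?Z"
      proof (intro subsetI CollectI conjI)
        fix m assume m: "m \<in> {i \<in> {1..n}. A' i = 0}"
        then show "m \<in> {1..n}" by blast
        show "A m = 0" using eq[of m] m by (cases "A m = 0") auto
      qed
      ultimately have "{i \<in> {1..n}. A' i = 0} \<subset> ?Z" by (rule_tac psubsetI) blast+
      then have "card {i \<in> {1..n}. A' i = 0} < card ?Z" by (rule psubset_card_mono[rotated]) simp
      then show ?thesis using less.hyps A' by blast
    qed
    have hK: "h x \<in> K" if "x \<in> K" for x
      using fixK[OF that] inv[OF A] faceK that by (cases "x \<in> face n r A") auto
    define C where "C = {s. \<forall>k\<le>d. l \<le> s k \<and> s k \<le> 1}"
    define X where "X = subtopology (Euclidean_space (Suc d)) C"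
    have tX: "topspace X = {s. (\<forall>k>d. s k = 0) \<and> (\<forall>k\<le>d. s k \<in> {l..1})}"
      by (auto simp: X_def C_def topspace_Euclidean_space Suc_le_eq)
    define out where "out = (\<lambda>x k. if k \<le> d then w (x (b k)) else 0)"
    define into where "into = (\<lambda>s. \<lambda>i\<in>{1..n}. if A i = 0 then v (s (bi i)) else \<iota> (A i) (opoint r))"
    have outX: "out x \<in> topspace X" if "x \<in> K" for x
      using that wv(1) bZ by (auto simp: tX out_def K_def PiE_iff)
    have intoK: "into s \<in> K" if s: "s \<in> topspace X" for s
      unfolding K_def
    proof (intro CollectI conjI ballI impI PiE_I)
      fix i assume i: "i \<in> {1..n}"
      show "into s i \<in> box r"
      proof (cases "A i = 0")
        case True
        then show ?thesis using i wv(2) s biZ[OF i True] by (simp add: into_def tX del: atLeastAtMost_iff)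
      next
        case False
        then show ?thesis using i end_in_box[OF labelsD[OF A i False] order_refl, of r] by (simp add: into_def del: atLeastAtMost_iff)
      qed
      show "lab r (into s i) = A i" if nz: "A i \<noteq> 0"
        using i lab_end[OF r0 labelsD[OF A i nz]] nz by (simp add: into_def)
    qed (auto simp: into_def)
    have out_into: "out (into s) = s" if s: "s \<in> topspace X" for s
    proof
      fix k show "out (into s) k = s k"
        using s bZ[of k] wv(2)[of "s k"] by (cases "k \<le> d") (auto simp: out_def into_def tX)
    qed
    have into_out: "into (out x) = x" if x: "x \<in> K" for x
    proof
      fix i show "into (out x) i = x i"
      proof (cases "i \<in> {1..n}")
        case True
        show ?thesis
        proof (cases "A i = 0")
          case z: True
          have "x i \<in> box r" using x True by (auto simp: K_def PiE_iff)
          then show ?thesis using True z biZ[OF True z] wv(1)[of "x i"] by (simp add: into_def out_def)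
        next
          case False
          then have "lab r (x i) = A i" using x True by (simp add: K_def)
          then show ?thesis using lab_eq_end[of r "x i" "A i"] False True by (simp add: into_def)
        qed
      next
        case False
        then show ?thesis using x by (auto simp: into_def K_def PiE_iff extensional_def)
      qed
    qed
    have into_c: "continuous_map X (subtopology (space n) K) into"
    proof -
      have "continuous_map X euclidean (\<lambda>s. if A i = 0 then v (s (bi i)) else \<iota> (A i) (opoint r))" if i: "i \<in> {1..n}" for i
      proof (cases "A i = 0")
        case True
        have "continuous_map X euclideanreal (\<lambda>s. s (bi i))"
          unfolding X_def by (intro continuous_map_from_subtopology continuous_map_Euclidean_space_projection)
        then have "continuous_map X (top_of_set {l..1}) (\<lambda>s. s (bi i))"
          using biZ[OF i True] by (auto simp: continuous_map_in_subtopology tX)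
        moreover have "continuous_map (top_of_set {l..1}) euclidean v" using v by simp
        ultimately have "continuous_map X euclidean (v \<circ> (\<lambda>s. s (bi i)))" by (rule continuous_map_compose)
        then show ?thesis using True by (simp add: o_def)
      qed simp
      then have "continuous_map X (space n) into"
        unfolding power_topology_def into_def by (auto simp: continuous_map_componentwise)
      then show ?thesis using intoK by (auto simp: continuous_map_in_subtopology)
    qed
    have out_c: "continuous_map (subtopology (space n) K) X out"
    proof -
      have "continuous_map (subtopology (space n) K) euclideanreal (\<lambda>x. out x k)" for k
      proof (cases "k \<le> d")
        case True
        have "continuous_map (space n) euclidean (\<lambda>x. x (b k))"
          unfolding power_topology_def by (rule continuous_map_product_projection) (rule bZ(1)[OF True])
        moreover have "continuous_map euclidean euclideanreal w" using w by simp
        ultimately have "continuous_map (space n) euclideanreal (w \<circ> (\<lambda>x. x (b k)))" by (rule continuous_map_compose)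
        then show ?thesis using True by (simp add: out_def o_def continuous_map_from_subtopology)
      qed (simp add: out_def)
      then have "continuous_map (subtopology (space n) K) (Euclidean_space (Suc d)) out"
        by (auto simp: Euclidean_space_def continuous_map_in_subtopology continuous_map_componentwise_UNIV out_def)
      then show ?thesis using outX KP unfolding X_def by (auto simp: continuous_map_in_subtopology)
    qed
    define H where "H = (\<lambda>s. out (h (into s)))"
    have Hc: "continuous_map X X H"
    proof -
      have "continuous_map (subtopology (space n) K) (subtopology (space n) K) h"
        using continuous_map_from_subtopology[OF h(1)] hK by (auto simp: continuous_map_in_subtopology)
      from continuous_map_compose[OF continuous_map_compose[OF into_c this] out_c] show ?thesis by (simp add: H_def o_def)
    qed
    have hjK: "(h ^^ j) x \<in> K" if "x \<in> K" for x j using that by (induction j) (auto intro: hK)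
    have Hj: "(H ^^ j) s = out ((h ^^ j) (into s))" if s: "s \<in> topspace X" for s j
      using out_into[OF s] into_out[OF hjK[OF intoK[OF s]]] by (induction j) (auto simp: H_def)
    have Hp: "(H ^^ p) s = s" if s: "s \<in> topspace X" for s
      using Hj[OF s] h(2)[of "into s"] subsetD[OF KP intoK[OF s]] out_into[OF s] by simp
    \<comment> \<open>An extreme coordinate of the cube means a nonzero label at a free coordinate,
      so the point lies on a proper subface.\<close>
    have Hfix: "H s = s" if s: "s \<in> topspace X" and k: "k \<le> d" "s k = 1 \<or> -1 \<in> E \<and> s k = -1" for s k
    proof -
      have lh: "lo r \<le> hi r" by (rule lo_le_hi)
      have ends: "v 1 = hi r" "v l = lo r" using wv(1)[of "hi r"] wv(1)[of "lo r"] we lh by auto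
      have "into s (b k) = v (s k)" using bZ[OF k(1)] by (simp add: into_def del: atLeastAtMost_iff)
      then have "lab r (into s (b k)) \<noteq> A (b k)"
        using k(2) ends bZ(2)[OF k(1)] by (auto simp: lab_def l_def)
      then have "into s \<notin> face n r A" using bZ(1)[OF k(1)] by (auto simp: face_def)
      then show ?thesis using fixK[OF intoK[OF s]] out_into[OF s] by (simp add: H_def)
    qed
    have all: "H s = s" if s: "s \<in> topspace X" for s
    proof (cases "-1 \<in> E")
      case True
      have "C = {s. \<forall>k\<le>d. \<bar>s k\<bar> \<le> 1}" using True by (auto simp: C_def l_def abs_le_iff minus_le_iff)
      then have X: "X = subtopology (Euclidean_space (Suc d)) {s. \<forall>k\<le>d. \<bar>s k\<bar> \<le> 1}" by (simp add: X_def)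
      show ?thesis
      proof (rule symmetric_cube_periodic_trivial[OF p, of d H s], goal_cases)
        case (3 s k)
        then have "s k = 1 \<or> s k = -1" by linarith
        then show ?case using Hfix[of s k] 3 True unfolding X by blast
      qed (use Hc Hp s in \<open>auto simp: X\<close>)
    next
      case False
      then have X: "X = subtopology (Euclidean_space (Suc d)) {s. \<forall>k\<le>d. 0 \<le> s k \<and> s k \<le> 1}"
        by (simp add: X_def C_def l_def)
      show ?thesis
      proof (rule corner_cube_periodic_trivial[OF p, of d H s], goal_cases)
        case (3 s k)
        then show ?case using Hfix[of s k] unfolding X by blast
      qed (use Hc Hp s in \<open>auto simp: X\<close>)
    qed
    have xK: "x \<in> K" using less.prems faceK by blast
    have "into (H (out x)) = into (out x)" using all[OF outX[OF xK]] by simp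
    then show ?thesis using into_out[OF xK] into_out[OF hK[OF xK]] by (simp add: H_def)
  qed
qed

lemma finite_labels: "finite (labels n)"
  unfolding labels_def by (rule finite_PiE) auto

lemma point_in_cube:
  assumes "x \<in> topspace (space n)" shows "\<exists>b. x \<in> {1..n} \<rightarrow>\<^sub>E box b"
proof -
  have "\<forall>i. \<exists>g. x i \<in> obox g" using in_some_obox by blast
  then obtain G where G: "\<And>i. x i \<in> obox (G i)" by metis
  have "countable (G ` {1..n})" by simp
  then obtain b where b: "\<And>a. a \<in> G ` {1..n} \<Longrightarrow> a < b" using omega1_bounded by blast
  have "x i \<in> box b" if "i \<in> {1..n}" for i
  proof -
    have "G i \<le> b" using b[of "G i"] that by (simp add: less_imp_le)
    then show ?thesis using G[of i] subsetD[OF obox_box] subsetD[OF obox_mono[of "G i" b]] by blast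
  qed
  then show ?thesis using assms by (intro exI[of _ b]) (simp add: PiE_iff del: atLeastAtMost_iff)
qed

text \<open>There are finitely many labels, so all faces of some common size \<open>r\<close> are
  invariant, and \<open>r\<close> can be taken large enough for the cube to contain
  \<open>x\<close>.\<close>

theorem prime_order_trivial:
  assumes p: "prime p" and h: "continuous_map (space n) (space n) h" "\<And>x. x \<in> topspace (space n) \<Longrightarrow> (h ^^ p) x = x"
    and J: "\<And>A. A \<in> labels n \<Longrightarrow> face_fun n h A = A" and x: "x \<in> topspace (space n)"
  shows "h x = x"
proof -
  have "eventually (\<lambda>r. \<forall>A\<in>labels n. h ` face n r A \<subseteq> face n r A) club"
    by (rule eventually_ball_finite[OF finite_labels]) (use face_fun(2)[OF h(1)] J in metis)
  moreover obtain b where b: "x \<in> {1..n} \<rightarrow>\<^sub>E box b" using point_in_cube[OF x] by blast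
  ultimately obtain r where r: "b < r" "\<forall>A\<in>labels n. h ` face n r A \<subseteq> face n r A" using club_frequently by blast
  have "x \<in> {1..n} \<rightarrow>\<^sub>E box r" by (rule subsetD[OF PiE_mono b]) (rule box_mono[OF less_imp_le[OF r(1)]])
  note labels_of_point[OF this]
  then show ?thesis using face_fixed[OF p h le_less_trans[OF omega0_le r(1)]] r(2) by blast
qed

end

section \<open>Torsion subgroups\<close>

lemma iso_image_of_trivial_kernel:
  assumes G: "group G" and T: "subgroup T G" and K: "group K"
    and \<theta>: "\<And>f. f \<in> T \<Longrightarrow> \<theta> f \<in> carrier K" "\<And>f g. f \<in> T \<Longrightarrow> g \<in> T \<Longrightarrow> \<theta> (f \<otimes>\<^bsub>G\<^esub> g) = \<theta> f \<otimes>\<^bsub>K\<^esub> \<theta> g"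
    and ker: "\<And>f. f \<in> T \<Longrightarrow> \<theta> f = \<one>\<^bsub>K\<^esub> \<Longrightarrow> f = \<one>\<^bsub>G\<^esub>"
  shows "\<exists>H. subgroup H K \<and> G\<lparr>carrier := T\<rparr> \<cong> K\<lparr>carrier := H\<rparr>"
proof -
  let ?T = "G\<lparr>carrier := T\<rparr>"
  have gT: "group ?T" by (rule group.subgroup_imp_group[OF G T])
  have hom: "\<theta> \<in> hom ?T K" by (rule homI) (simp_all add: \<theta>)
  have gh: "group_hom ?T K \<theta>" by (rule group_hom.intro[OF gT K group_hom_axioms.intro[OF hom]])
  have one: "\<one>\<^bsub>?T\<^esub> = \<one>\<^bsub>G\<^esub>" "carrier ?T = T" by simp_all
  have oneT: "\<one>\<^bsub>G\<^esub> \<in> T" by (rule subgroup.one_closed[OF T])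
  have "kernel ?T K \<theta> = {\<one>\<^bsub>?T\<^esub>}"
  proof (intro equalityI subsetI)
    fix f assume "f \<in> kernel ?T K \<theta>"
    then have "f \<in> T" "\<theta> f = \<one>\<^bsub>K\<^esub>" by (simp_all add: kernel_def)
    then show "f \<in> {\<one>\<^bsub>?T\<^esub>}" using ker[of f] one(1) by simp
  next
    fix f assume "f \<in> {\<one>\<^bsub>?T\<^esub>}"
    then have f: "f = \<one>\<^bsub>?T\<^esub>" by blast
    show "f \<in> kernel ?T K \<theta>"
      using group_hom.hom_one[OF gh] oneT by (simp add: kernel_def f)
  qed
  then have "inj_on \<theta> (carrier ?T)" using group_hom.inj_iff_trivial_ker[OF gh] by blast
  then have inj: "inj_on \<theta> T" unfolding one(2) .
  have "subgroup (\<theta> ` T) K" using group_hom.img_is_subgroup[OF gh] unfolding one(2) .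
  moreover have "\<theta> \<in> iso ?T (K\<lparr>carrier := \<theta> ` T\<rparr>)"
    using hom inj by (auto simp: iso_def hom_def bij_betw_def)
  ultimately show ?thesis unfolding is_iso_def by blast
qed

lemma carrier_homeo_group: "carrier (homeo_group X) = {f \<in> extensional (topspace X). homeomorphic_map X X f}"
  by (simp add: homeo_group_def)

lemma homeo_group_Bij: "f \<in> carrier (homeo_group X) \<Longrightarrow> f \<in> Bij (topspace X)"
  by (auto simp: carrier_homeo_group Bij_def bij_betw_def homeomorphic_imp_injective_map homeomorphic_imp_surjective_map)

lemma mult_homeo_group:
  "f \<in> carrier (homeo_group X) \<Longrightarrow> g \<in> carrier (homeo_group X) \<Longrightarrow> f \<otimes>\<^bsub>homeo_group X\<^esub> g = compose (topspace X) f g"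
  using homeo_group_Bij by (auto simp: homeo_group_def BijGroup_def)

lemma one_homeo_group: "\<one>\<^bsub>homeo_group X\<^esub> = (\<lambda>x\<in>topspace X. x)"
  by (simp add: homeo_group_def BijGroup_def)

lemma homeo_group_continuous: "f \<in> carrier (homeo_group X) \<Longrightarrow> continuous_map X X f"
  by (simp add: carrier_homeo_group homeomorphic_imp_continuous_map)

lemma homeo_group_pow:
  assumes f: "f \<in> carrier (homeo_group X)" and x: "x \<in> topspace X"
  shows "(f [^]\<^bsub>homeo_group X\<^esub> (k::nat)) x = (f ^^ k) x"
  using x
proof (induction k arbitrary: x)
  case 0
  interpret group "homeo_group X" by (rule group_homeo_group)
  show ?case using 0 by (simp add: one_homeo_group)
next
  case (Suc k)
  interpret group "homeo_group X" by (rule group_homeo_group)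
  have "f x \<in> topspace X" using continuous_map_image_subset_topspace[OF homeo_group_continuous[OF f]] Suc.prems by blast
  then show ?case
    using Suc f by (simp add: mult_homeo_group compose_def funpow_swap1)
qed

section \<open>The signed permutation of the axes\<close>

context long_space
begin

abbreviation homeo where "homeo n \<equiv> homeo_group (space n)"

lemma homeo_inverse:
  assumes "f \<in> carrier (homeo n)"
  obtains f' where "continuous_map (space n) (space n) f'" "\<And>x. x \<in> topspace (space n) \<Longrightarrow> f' (f x) = x"
    "\<And>x. x \<in> topspace (space n) \<Longrightarrow> f (f' x) = x"
proof -
  obtain f' where "homeomorphic_maps (space n) (space n) f f'"
    using assms by (auto simp: carrier_homeo_group homeomorphic_map_maps)
  then show thesis using that unfolding homeomorphic_maps_def by blast
qed

definition end_image :: "nat \<Rightarrow> ((nat \<Rightarrow> 'x) \<Rightarrow> nat \<Rightarrow> 'x) \<Rightarrow> nat \<Rightarrow> nat \<times> int" where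
  "end_image n f i = (SOME z. fst z \<in> {1..n} \<and> snd z \<in> E \<and> face_fun n f (single n i 1) = single n (fst z) (snd z))"

definition end_perm :: "nat \<Rightarrow> ((nat \<Rightarrow> 'x) \<Rightarrow> nat \<Rightarrow> 'x) \<Rightarrow> nat \<Rightarrow> nat" where
  "end_perm n f i = (if i \<in> {1..n} then fst (end_image n f i) else i)"

definition end_sign :: "nat \<Rightarrow> ((nat \<Rightarrow> 'x) \<Rightarrow> nat \<Rightarrow> 'x) \<Rightarrow> nat \<Rightarrow> int" where
  "end_sign n f i = snd (end_image n f i)"

text \<open>Opposite ends go to opposite ends, so the image of the positive end of an axis
  determines that of the negative one.\<close>

lemma end_image:
  assumes f: "f \<in> carrier (homeo n)" and i: "i \<in> {1..n}"
  shows "end_perm n f i \<in> {1..n}" "end_sign n f i \<in> E"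
    "e \<in> E \<Longrightarrow> face_fun n f (single n i e) = single n (end_perm n f i) (e * end_sign n f i)"
proof -
  obtain f' where f': "continuous_map (space n) (space n) f'" "\<And>x. x \<in> topspace (space n) \<Longrightarrow> f' (f x) = x"
    "\<And>x. x \<in> topspace (space n) \<Longrightarrow> f (f' x) = x" using homeo_inverse[OF f] by blast
  note fc = homeo_group_continuous[OF f]
  have "\<exists>j\<in>{1..n}. \<exists>d\<in>E. face_fun n f (single n i 1) = single n j d"
    by (rule face_fun_single_ex[OF fc f' i one_E])
  then have "\<exists>z. fst z \<in> {1..n} \<and> snd z \<in> E \<and> face_fun n f (single n i 1) = single n (fst z) (snd z)" by auto
  from someI_ex[OF this, folded end_image_def]
  have z: "end_perm n f i \<in> {1..n}" "end_sign n f i \<in> E"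
    "face_fun n f (single n i 1) = single n (end_perm n f i) (end_sign n f i)"
    using i by (auto simp: end_perm_def end_sign_def)
  show "end_perm n f i \<in> {1..n}" "end_sign n f i \<in> E" by fact+
  show "face_fun n f (single n i e) = single n (end_perm n f i) (e * end_sign n f i)" if e: "e \<in> E"
  proof -
    consider "e = 1" | "e = -1" "-1 \<in> E" using E_cases[OF e] by blast
    then show ?thesis
    proof cases
      case 1 then show ?thesis using z(3) by simp
    next
      case 2 then show ?thesis using face_fun_opposite[OF fc f' i 2(2) z(3,1,2)] by simp
    qed
  qed
qed

lemma sign_E: "d \<in> E \<Longrightarrow> e \<in> E \<Longrightarrow> e * d \<in> E"
  using E_cases[of d] E_cases[of e] by auto

text \<open>If two axes had the same image, the product of their signs would select an end of one
  axis with the same image as the positive end of the other, because signs are their own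
  inverses.\<close>

lemma end_perm_permutes:
  assumes f: "f \<in> carrier (homeo n)" shows "end_perm n f permutes {1..n}"
proof -
  obtain f' where f': "continuous_map (space n) (space n) f'" "\<And>x. x \<in> topspace (space n) \<Longrightarrow> f' (f x) = x"
    "\<And>x. x \<in> topspace (space n) \<Longrightarrow> f (f' x) = x" using homeo_inverse[OF f] by blast
  note fc = homeo_group_continuous[OF f]
  have "inj_on (end_perm n f) {1..n}"
  proof (rule inj_onI)
    fix i j assume i: "i \<in> {1..n}" and j: "j \<in> {1..n}" and eq: "end_perm n f i = end_perm n f j"
    let ?e = "end_sign n f i * end_sign n f j"
    have e: "?e \<in> E" using sign_E end_image(2)[OF f] i j by blast
    have s: "?e * end_sign n f j = end_sign n f i" using E_cases[OF end_image(2)[OF f j]] by auto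
    have "face_fun n f (single n j ?e) = face_fun n f (single n i 1)"
      unfolding end_image(3)[OF f j e] end_image(3)[OF f i one_E] eq s by simp
    then have "single n j ?e = single n i 1"
      using face_fun_inverse(1)[OF fc f' single_labels[OF e, of n j]] face_fun_inverse(1)[OF fc f' single_labels[OF one_E, of n i]] by simp
    then show "i = j" using single_inject[OF i, of 1 j ?e] by simp
  qed
  moreover have "end_perm n f ` {1..n} \<subseteq> {1..n}" using end_image(1)[OF f] by blast
  ultimately have "bij_betw (end_perm n f) {1..n} {1..n}"
    by (simp add: bij_betw_def endo_inj_surj)
  then show ?thesis by (rule bij_imp_permutes) (unfold end_perm_def, rule if_not_P)
qed

text \<open>An end passes through \<open>g\<close> first and picks up its sign at \<open>i\<close>,
  then the sign of \<open>f\<close> at the axis reached: the cocycle rule behind the semidirect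
  product.\<close>

lemma end_image_mult:
  assumes f: "f \<in> carrier (homeo n)" and g: "g \<in> carrier (homeo n)"
  shows "end_perm n (f \<otimes>\<^bsub>homeo n\<^esub> g) = end_perm n f \<circ> end_perm n g"
    "i \<in> {1..n} \<Longrightarrow> end_sign n (f \<otimes>\<^bsub>homeo n\<^esub> g) i = end_sign n g i * end_sign n f (end_perm n g i)"
proof -
  interpret group "homeo n" by (rule group_homeo_group)
  let ?h = "f \<otimes>\<^bsub>homeo n\<^esub> g"
  have h: "?h \<in> carrier (homeo n)" using f g by simp
  have *: "end_perm n ?h i = end_perm n f (end_perm n g i) \<and> end_sign n ?h i = end_sign n g i * end_sign n f (end_perm n g i)"
    if i: "i \<in> {1..n}" for i
  proof -
    note gi = end_image[OF g i]
    have "face_fun n ?h (single n i 1) = face_fun n f (face_fun n g (single n i 1))"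
      by (rule face_fun_compose[OF homeo_group_continuous[OF g] homeo_group_continuous[OF f] single_labels[OF one_E]])
        (simp add: mult_homeo_group[OF f g] compose_def)
    also have "\<dots> = single n (end_perm n f (end_perm n g i)) (end_sign n g i * end_sign n f (end_perm n g i))"
      using gi(3)[OF one_E] end_image(3)[OF f gi(1) gi(2)] by simp
    finally have "single n (end_perm n ?h i) (end_sign n ?h i) = single n (end_perm n f (end_perm n g i)) (end_sign n g i * end_sign n f (end_perm n g i))"
      using end_image(3)[OF h i one_E] by simp
    moreover have "end_sign n ?h i \<noteq> 0" using end_image(2)[OF h i] zero_notin_E by metis
    ultimately show ?thesis using single_inject[OF end_image(1)[OF h i]] by blast
  qed
  show "end_perm n ?h = end_perm n f \<circ> end_perm n g"
  proof
    fix i show "end_perm n ?h i = (end_perm n f \<circ> end_perm n g) i"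
      using * by (cases "i \<in> {1..n}") (auto simp: end_perm_def)
  qed
  show "end_sign n ?h i = end_sign n g i * end_sign n f (end_perm n g i)" if "i \<in> {1..n}" using *[OF that] by blast
qed

text \<open>A least positive exponent \<open>k\<close> other than 1 has a prime factor
  \<open>p\<close>. The power of \<open>f\<close> with exponent \<open>k div p\<close> has prime
  period and fixes all faces, so it is the identity, against minimality.\<close>

lemma trivial_on_ends:
  assumes f: "f \<in> carrier (homeo n)" and ord: "0 < (m::nat)" "f [^]\<^bsub>homeo n\<^esub> m = \<one>\<^bsub>homeo n\<^esub>"
    and triv: "\<And>i. i \<in> {1..n} \<Longrightarrow> end_perm n f i = i \<and> end_sign n f i = 1"
  shows "f = \<one>\<^bsub>homeo n\<^esub>"
proof (rule ccontr)
  assume ne: "f \<noteq> \<one>\<^bsub>homeo n\<^esub>"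
  interpret group "homeo n" by (rule group_homeo_group)
  obtain f' where f': "continuous_map (space n) (space n) f'" "\<And>x. x \<in> topspace (space n) \<Longrightarrow> f' (f x) = x"
    "\<And>x. x \<in> topspace (space n) \<Longrightarrow> f (f' x) = x" using homeo_inverse[OF f] by blast
  note fc = homeo_group_continuous[OF f]
  have J: "face_fun n f A = A" if "A \<in> labels n" for A
  proof (rule face_fun_determined[OF fc f' _ that])
    fix i e assume i: "i \<in> {1..n}" and "e \<in> E"
    then show "face_fun n f (single n i e) = single n i e"
      using end_image(3)[OF f] triv[OF i] by simp
  qed
  have Jk: "face_fun n (f [^]\<^bsub>homeo n\<^esub> (k::nat)) A = A" if A: "A \<in> labels n" for A k
  proof (induction k)
    case 0
    show ?case by (rule face_fun_id[OF A]) (simp add: one_homeo_group)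
  next
    case (Suc k)
    have fk: "f [^]\<^bsub>homeo n\<^esub> k \<in> carrier (homeo n)" using f by simp
    have "face_fun n (f [^]\<^bsub>homeo n\<^esub> Suc k) A = face_fun n (f [^]\<^bsub>homeo n\<^esub> k) (face_fun n f A)"
      by (rule face_fun_compose[OF fc homeo_group_continuous[OF fk] A]) (use fk f in \<open>simp add: mult_homeo_group compose_def\<close>)
    then show ?case using Suc J[OF A] by simp
  qed
  define k where "k = (LEAST k. 0 < k \<and> f [^]\<^bsub>homeo n\<^esub> (k::nat) = \<one>\<^bsub>homeo n\<^esub>)"
  have k: "0 < k \<and> f [^]\<^bsub>homeo n\<^esub> k = \<one>\<^bsub>homeo n\<^esub>" unfolding k_def by (rule LeastI[of _ m]) (use ord in blast)
  have "k \<noteq> 1" using k ne f by auto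
  then obtain p where p: "prime p" "p dvd k" using prime_factor_nat by blast
  define h where "h = f [^]\<^bsub>homeo n\<^esub> (k div p)"
  have h: "h \<in> carrier (homeo n)" using f by (simp add: h_def)
  have "h [^]\<^bsub>homeo n\<^esub> p = \<one>\<^bsub>homeo n\<^esub>"
    using k p f by (simp add: h_def nat_pow_pow)
  then have hp: "(h ^^ p) x = x" if "x \<in> topspace (space n)" for x
    using homeo_group_pow[OF h that, of p] that by (simp add: one_homeo_group)
  have "h x = x" if "x \<in> topspace (space n)" for x
    by (rule prime_order_trivial[OF p(1) homeo_group_continuous[OF h] hp _ that]) (simp_all add: h_def Jk)
  then have "h = \<one>\<^bsub>homeo n\<^esub>"
    using h by (intro extensionalityI[of _ "topspace (space n)"]) (auto simp: one_homeo_group carrier_homeo_group)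
  moreover have "0 < k div p" "k div p < k"
    using k p prime_gt_1_nat[OF p(1)] by (auto simp: div_greater_zero_iff dvd_imp_le)
  ultimately show False using not_less_Least[of "k div p" "\<lambda>k. 0 < k \<and> f [^]\<^bsub>homeo n\<^esub> (k::nat) = \<one>\<^bsub>homeo n\<^esub>"]
    unfolding k_def[symmetric] h_def by blast
qed

text \<open>Signs are recorded at the source axis, while entry \<open>k\<close> of the vector
  belongs to the target axis \<open>k\<close>; the inverse permutation translates, in agreement with
  the left action \<open>permute_factors\<close>.\<close>

definition end_element :: "nat \<Rightarrow> ((nat \<Rightarrow> 'x) \<Rightarrow> nat \<Rightarrow> 'x) \<Rightarrow> (nat \<Rightarrow> int) \<times> (nat \<Rightarrow> nat)" where
  "end_element n f = ((\<lambda>k\<in>{1..n}. if end_sign n f (inv_into UNIV (end_perm n f) k) = 1 then 0 else 1), end_perm n f)"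

lemma end_element_carrier:
  assumes "f \<in> carrier (homeo n)" shows "end_element n f \<in> carrier (G_group n)"
  using end_perm_permutes[OF assms]
  by (auto simp: end_element_def G_group_def semidirect_product_def sym_group_def carrier_integer_mod_group product_group_def)

lemma end_element_mult:
  assumes f: "f \<in> carrier (homeo n)" and g: "g \<in> carrier (homeo n)"
  shows "end_element n (f \<otimes>\<^bsub>homeo n\<^esub> g) = end_element n f \<otimes>\<^bsub>G_group n\<^esub> end_element n g"
proof -
  let ?p = "end_perm n f" and ?q = "end_perm n g" and ?h = "f \<otimes>\<^bsub>homeo n\<^esub> g"
  have p: "?p permutes {1..n}" and q: "?q permutes {1..n}" using end_perm_permutes f g by auto
  have mult: "(a, p) \<otimes>\<^bsub>G_group n\<^esub> (b, q) = ((\<lambda>i\<in>{1..n}. (a i + permute_factors n p b i) mod 2), p \<circ> q)" for a b p q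
    by (simp add: G_group_def semidirect_product_def sym_group_def product_group_def)
  have "(if end_sign n ?h (inv_into UNIV (end_perm n ?h) k) = 1 then 0 else 1)
     = ((if end_sign n f (inv_into UNIV ?p k) = 1 then 0 else 1) +
        (if end_sign n g (inv_into UNIV ?q (inv_into UNIV ?p k)) = 1 then 0 else 1)) mod (2::int)" if k: "k \<in> {1..n}" for k
  proof -
    let ?k = "inv_into UNIV ?p k" and ?m = "inv_into UNIV ?q (inv_into UNIV ?p k)"
    have inv: "inv_into UNIV (end_perm n ?h) k = ?m"
      using o_inv_distrib[OF permutes_bij[OF p] permutes_bij[OF q]] end_image_mult(1)[OF f g] by simp
    have kI: "?k \<in> {1..n}" using permutes_in_image[OF permutes_inv[OF p]] k by blast
    then have mI: "?m \<in> {1..n}" using permutes_in_image[OF permutes_inv[OF q]] by blast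
    have "?q ?m = ?k" using permutes_inverses(1)[OF q] by simp
    then have s: "end_sign n ?h ?m = end_sign n g ?m * end_sign n f ?k" using end_image_mult(2)[OF f g mI] by simp
    show ?thesis unfolding inv s
      using E_cases[OF end_image(2)[OF f kI]] E_cases[OF end_image(2)[OF g mI]] by auto
  qed
  moreover have "inv_into UNIV ?p k \<in> {1..n}" if "k \<in> {1..n}" for k
    using permutes_in_image[OF permutes_inv[OF p]] that by blast
  ultimately show ?thesis
    unfolding end_element_def mult end_image_mult(1)[OF f g]
    by (auto simp: permute_factors_def end_image_mult(1)[OF f g] intro!: restrict_ext)
qed

theorem torsion_subgroup_G:
  assumes T: "subgroup T (homeo n)"
    and tors: "\<And>f. f \<in> T \<Longrightarrow> \<exists>k::nat. k > 0 \<and> f [^]\<^bsub>homeo n\<^esub> k = \<one>\<^bsub>homeo n\<^esub>"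
  shows "\<exists>H. subgroup H (G_group n) \<and> homeo n\<lparr>carrier := T\<rparr> \<cong> G_group n\<lparr>carrier := H\<rparr>"
proof (rule iso_image_of_trivial_kernel[OF group_homeo_group T group_G_group, of "end_element n"])
  note TC = subgroup.mem_carrier[OF T]
  show "end_element n f \<in> carrier (G_group n)" if "f \<in> T" for f using end_element_carrier[OF TC[OF that]] .
  show "end_element n (f \<otimes>\<^bsub>homeo n\<^esub> g) = end_element n f \<otimes>\<^bsub>G_group n\<^esub> end_element n g" if "f \<in> T" "g \<in> T" for f g
    using end_element_mult[OF TC[OF that(1)] TC[OF that(2)]] .
  fix f assume fT: "f \<in> T" and one: "end_element n f = \<one>\<^bsub>G_group n\<^esub>"
  have "\<one>\<^bsub>G_group n\<^esub> = ((\<lambda>i\<in>{1..n}. 0), id)"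
    by (simp add: G_group_def semidirect_product_def sym_group_def product_group_def)
  then have perm: "end_perm n f = id" and sg: "(\<lambda>k\<in>{1..n}. if end_sign n f k = 1 then 0 else 1) = (\<lambda>i\<in>{1..n}. 0 :: int)"
    using one by (auto simp: end_element_def)
  have "end_sign n f i = 1" if "i \<in> {1..n}" for i
    using fun_cong[OF sg, of i] that by (auto split: if_splits)
  then show "f = \<one>\<^bsub>homeo n\<^esub>" using tors[OF fT] trivial_on_ends[OF TC[OF fT]] perm by auto
qed

text \<open>With one end per axis every sign is 1, so the permutation alone already has trivial
  kernel on \<open>T\<close>.\<close>

theorem torsion_subgroup_S:
  assumes E1: "-1 \<notin> E" and T: "subgroup T (homeo n)"
    and tors: "\<And>f. f \<in> T \<Longrightarrow> \<exists>k::nat. k > 0 \<and> f [^]\<^bsub>homeo n\<^esub> k = \<one>\<^bsub>homeo n\<^esub>"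
  shows "\<exists>H. subgroup H (sym_group n) \<and> homeo n\<lparr>carrier := T\<rparr> \<cong> sym_group n\<lparr>carrier := H\<rparr>"
proof (rule iso_image_of_trivial_kernel[OF group_homeo_group T sym_group_is_group, of "end_perm n"])
  note TC = subgroup.mem_carrier[OF T]
  show "end_perm n f \<in> carrier (sym_group n)" if "f \<in> T" for f
    using end_perm_permutes[OF TC[OF that]] by (simp add: sym_group_def)
  show "end_perm n (f \<otimes>\<^bsub>homeo n\<^esub> g) = end_perm n f \<otimes>\<^bsub>sym_group n\<^esub> end_perm n g" if "f \<in> T" "g \<in> T" for f g
    using end_image_mult(1)[OF TC[OF that(1)] TC[OF that(2)]] by (simp add: sym_group_def)
  fix f assume fT: "f \<in> T" and one: "end_perm n f = \<one>\<^bsub>sym_group n\<^esub>"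
  then have perm: "end_perm n f = id" by (simp add: sym_group_def)
  have "end_sign n f i = 1" if "i \<in> {1..n}" for i
    using E_cases[OF end_image(2)[OF TC[OF fT] that]] E1 by blast
  then show "f = \<one>\<^bsub>homeo n\<^esub>" using tors[OF fT] trivial_on_ends[OF TC[OF fT]] perm by auto
qed

end

theorem theorem1p3:
  fixes n :: nat
  assumes "n \<ge> 1"
  shows
    "(\<forall>T. subgroup T (homeo_group (power_topology (euclidean :: long_line topology) n)) \<and>
        (\<forall>f\<in>T. \<exists>k::nat. k > 0 \<and>
          f [^]\<^bsub>homeo_group (power_topology euclidean n)\<^esub> k
            = \<one>\<^bsub>homeo_group (power_topology euclidean n)\<^esub>)
      \<longrightarrow> (\<exists>H. subgroup H (G_group n) \<and>
            homeo_group (power_topology euclidean n)\<lparr>carrier := T\<rparr> \<cong> G_group n\<lparr>carrier := H\<rparr>))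
   \<and> (\<forall>T. subgroup T (homeo_group (power_topology (euclidean :: half_long_line topology) n)) \<and>
        (\<forall>f\<in>T. \<exists>k::nat. k > 0 \<and>
          f [^]\<^bsub>homeo_group (power_topology euclidean n)\<^esub> k
            = \<one>\<^bsub>homeo_group (power_topology euclidean n)\<^esub>)
      \<longrightarrow> (\<exists>H. subgroup H (sym_group n) \<and>
            homeo_group (power_topology euclidean n)\<lparr>carrier := T\<rparr> \<cong> sym_group n\<lparr>carrier := H\<rparr>))"
  using long.torsion_subgroup_G half_long.torsion_subgroup_S by auto

end
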